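(* Fix natural numbers $k,n$ satisfying $1\leq k\leq n-1$. Consider the free involution $\sigma:T^n\to T^n$ defined by $$\sigma(x_1,\dots,x_n)=(x_1+1/2,\dots,x_{k}+1/2,-x_{k+1},\dots,-x_n).$$ Let $X'=T^n$ and let $X=T^n/\sigma$. Then the natural projection $\rho:X'\to X$ is a covering map, and we have $\operatorname{disc-sym}(X')=n$ and $\operatorname{disc-sym}(X)=k$.
   Context: $T^n=(\mathbb{R}/\mathbb{Z})^n$, with additive notation for its group structure. All group actions on manifolds are continuous. Closed manifolds are compact topological manifolds without boundary. For a closed topological manifold $X$, let $\mu(X)$ be the set of natural numbers $m$ for which there is a sequence of integers $r_i\to\infty$ and, for each $i$, an effective action of $(\mathbb{Z}/r_i)^m$ on $X$. The set $\mu(X)$ is finite, and $\operatorname{disc-sym}(X):=\max(\{0\}\cup\mu(X))$. *)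

theory Defs
  imports "HOL-Analysis.Analysis" "HOL-Algebra.Group_Action" "HOL-Algebra.Product_Groups"
begin

section \<open>Quotient topologies and covering maps\<close>

definition quotient_topology :: "'a topology \<Rightarrow> ('a \<Rightarrow> 'b) \<Rightarrow> 'b topology" where
  "quotient_topology X p =
     topology (\<lambda>U. U \<subseteq> p ` topspace X \<and> openin X {x \<in> topspace X. p x \<in> U})"

lemma openin_quotient_topology:
  "openin (quotient_topology X p) U \<longleftrightarrow>
     U \<subseteq> p ` topspace X \<and> openin X {x \<in> topspace X. p x \<in> U}"
proof -
  have "istopology (\<lambda>U. U \<subseteq> p ` topspace X \<and> openin X {x \<in> topspace X. p x \<in> U})"
    unfolding istopology_def
  proof (intro conjI allI impI)
    fix S T
    assume "S \<subseteq> p ` topspace X \<and> openin X {x \<in> topspace X. p x \<in> S}"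
      and "T \<subseteq> p ` topspace X \<and> openin X {x \<in> topspace X. p x \<in> T}"
    moreover have "{x \<in> topspace X. p x \<in> S \<inter> T} =
        {x \<in> topspace X. p x \<in> S} \<inter> {x \<in> topspace X. p x \<in> T}"
      by auto
    ultimately show "S \<inter> T \<subseteq> p ` topspace X" "openin X {x \<in> topspace X. p x \<in> S \<inter> T}"
      by auto
  next
    fix K
    assume K: "\<forall>S\<in>K. S \<subseteq> p ` topspace X \<and> openin X {x \<in> topspace X. p x \<in> S}"
    then show "\<Union>K \<subseteq> p ` topspace X"
      by blast
    have "{x \<in> topspace X. p x \<in> \<Union>K} = (\<Union>S\<in>K. {x \<in> topspace X. p x \<in> S})"
      by auto
    then show "openin X {x \<in> topspace X. p x \<in> \<Union>K}"
      using K by (metis (no_types, lifting) openin_clauses(3) imageE)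
  qed
  then show ?thesis
    by (simp add: quotient_topology_def)
qed

lemma topspace_quotient_topology [simp]: "topspace (quotient_topology X p) = p ` topspace X"
proof
  show "topspace (quotient_topology X p) \<subseteq> p ` topspace X"
    using openin_quotient_topology[of X p "topspace (quotient_topology X p)"] by simp
  have "{x \<in> topspace X. p x \<in> p ` topspace X} = topspace X"
    by auto
  then have "openin (quotient_topology X p) (p ` topspace X)"
    by (simp add: openin_quotient_topology)
  then show "p ` topspace X \<subseteq> topspace (quotient_topology X p)"
    by (rule openin_subset)
qed

lemma quotient_map_quotient_topology: "quotient_map X (quotient_topology X p) p"
  by (auto simp: quotient_map_def openin_quotient_topology)

text \<open>The counterpart for abstract topologies of the library's \<^const>\<open>covering_space\<close>.\<close>

definition covering_map :: "'a topology \<Rightarrow> 'b topology \<Rightarrow> ('a \<Rightarrow> 'b) \<Rightarrow> bool" where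
  "covering_map X Y p \<longleftrightarrow>
     continuous_map X Y p \<and> p ` topspace X = topspace Y \<and>
     (\<forall>y \<in> topspace Y. \<exists>T. y \<in> T \<and> openin Y T \<and>
        (\<exists>\<V>. \<Union>\<V> = {x \<in> topspace X. p x \<in> T} \<and>
             (\<forall>U \<in> \<V>. openin X U) \<and>
             pairwise disjnt \<V> \<and>
             (\<forall>U \<in> \<V>. homeomorphic_map (subtopology X U) (subtopology Y T) p)))"


section \<open>Effective actions and the discrete degree of symmetry\<close>

abbreviation Z_mod_power :: "nat \<Rightarrow> nat \<Rightarrow> (nat \<Rightarrow> int) monoid" where
  "Z_mod_power r m \<equiv> product_group {..<m} (\<lambda>_. integer_mod_group r)"

text \<open>
  The acting groups are discrete, so an action is continuous iff every group element
  acts by a continuous map.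
\<close>

definition acts_effectively :: "('g, 'b) monoid_scheme \<Rightarrow> 'a topology \<Rightarrow> bool" where
  "acts_effectively G X \<longleftrightarrow>
     (\<exists>\<phi>. faithful_action G (topspace X) \<phi> \<and> (\<forall>g \<in> carrier G. continuous_map X X (\<phi> g)))"

text \<open>
  Since \<open>r\<close> tends to infinity, the degenerate value \<open>r i = 0\<close> (where
  \<^const>\<open>integer_mod_group\<close> is the infinite cyclic group) occurs only finitely often
  and can be skipped; allowing it does not change \<open>mu X\<close>.
\<close>

definition mu :: "'a topology \<Rightarrow> nat set" where
  "mu X = {m. \<exists>r :: nat \<Rightarrow> nat. filterlim r at_top sequentially \<and>
                (\<forall>i. acts_effectively (Z_mod_power (r i) m) X)}"

text \<open>Meaningful whenever \<open>mu X\<close> is finite, which is the case for every closed manifold.\<close>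

definition disc_sym :: "'a topology \<Rightarrow> nat" where
  "disc_sym X = Max ({0} \<union> mu X)"


section \<open>The torus, the involution and its orbit space\<close>

definition Z_coset :: "real \<Rightarrow> real set" where
  "Z_coset t = {t + of_int j | j. True}"

definition R_mod_Z :: "real set topology" where
  "R_mod_Z = quotient_topology euclideanreal Z_coset"

definition torus :: "nat \<Rightarrow> (nat \<Rightarrow> real set) topology" where
  "torus n = product_topology (\<lambda>_. R_mod_Z) {1..n}"

text \<open>
  Coordinates are cosets, and the group operations of $\mathbb{R}/\mathbb{Z}$ used here are
  images: see \<open>shift_Z_coset\<close> and \<open>uminus_Z_coset\<close> below. (Plain unary minus on
  a set would be the complement.)
\<close>

definition sigma_inv :: "nat \<Rightarrow> nat \<Rightarrow> (nat \<Rightarrow> real set) \<Rightarrow> nat \<Rightarrow> real set" where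
  "sigma_inv n k x = (\<lambda>i\<in>{1..n}. if i \<le> k then (\<lambda>t. t + 1/2) ` x i else uminus ` x i)"

text \<open>For an involution \<open>s\<close>, the set \<open>{x, s x}\<close> is the orbit of \<open>x\<close>.\<close>

definition orbit_proj :: "('a \<Rightarrow> 'a) \<Rightarrow> 'a \<Rightarrow> 'a set" where
  "orbit_proj s x = {x, s x}"

definition orbit_space :: "'a topology \<Rightarrow> ('a \<Rightarrow> 'a) \<Rightarrow> 'a set topology" where
  "orbit_space X s = quotient_topology X (orbit_proj s)"

lemma in_Z_coset_iff: "u \<in> Z_coset t \<longleftrightarrow> u - t \<in> \<int>"
proof
  assume "u - t \<in> \<int>"
  then obtain j where "u - t = of_int j"
    by (elim Ints_cases)
  then have "u = t + of_int j"
    by simp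
  then show "u \<in> Z_coset t"
    unfolding Z_coset_def by blast
qed (auto simp: Z_coset_def)

lemma Z_coset_eq_iff: "Z_coset s = Z_coset t \<longleftrightarrow> s - t \<in> \<int>"
proof
  assume "Z_coset s = Z_coset t"
  moreover have "s \<in> Z_coset s"
    by (simp add: in_Z_coset_iff)
  ultimately show "s - t \<in> \<int>"
    by (simp add: in_Z_coset_iff)
next
  assume st: "s - t \<in> \<int>"
  have "u - s \<in> \<int> \<longleftrightarrow> u - t \<in> \<int>" for u
    using Ints_add[OF _ st, of "u - s"] Ints_diff[OF _ st, of "u - t"] by auto
  then show "Z_coset s = Z_coset t"
    by (auto simp: in_Z_coset_iff)
qed

lemma shift_Z_coset: "(\<lambda>u. u + 1/2) ` Z_coset t = Z_coset (t + 1/2)"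
proof (intro subset_antisym subsetI)
  fix u
  assume "u \<in> Z_coset (t + 1/2)"
  then have "u - 1/2 \<in> Z_coset t"
    by (simp add: in_Z_coset_iff algebra_simps)
  then show "u \<in> (\<lambda>u. u + 1/2) ` Z_coset t"
    by (rule rev_image_eqI) simp
qed (auto simp: in_Z_coset_iff)

lemma uminus_Z_coset: "uminus ` Z_coset t = Z_coset (- t)"
proof (intro subset_antisym subsetI)
  fix u
  assume "u \<in> Z_coset (- t)"
  then have "- (u + t) \<in> \<int>"
    unfolding in_Z_coset_iff by (intro Ints_minus) simp
  then have "- u \<in> Z_coset t"
    by (simp add: in_Z_coset_iff)
  then show "u \<in> uminus ` Z_coset t"
    by (rule rev_image_eqI) simp
next
  fix u
  assume "u \<in> uminus ` Z_coset t"
  then obtain v where v: "v - t \<in> \<int>" "u = - v"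
    by (auto simp: in_Z_coset_iff)
  then show "u \<in> Z_coset (- t)"
    using Ints_minus[OF v(1)] by (simp add: in_Z_coset_iff)
qed

lemma topspace_R_mod_Z: "topspace R_mod_Z = range Z_coset"
  by (simp add: R_mod_Z_def)

lemma topspace_torus: "topspace (torus n) = {1..n} \<rightarrow>\<^sub>E range Z_coset"
  by (simp add: torus_def topspace_R_mod_Z)

lemma torus_coordinate:
  assumes "x \<in> topspace (torus n)" "i \<in> {1..n}"
  obtains t where "x i = Z_coset t"
proof -
  have "x i \<in> range Z_coset"
    using assms unfolding topspace_torus by (rule PiE_mem)
  then show thesis
    using that by blast
qed

lemma sigma_inv_in_torus:
  assumes "x \<in> topspace (torus n)"
  shows "sigma_inv n k x \<in> topspace (torus n)"
proof -
  have "sigma_inv n k x i \<in> range Z_coset" if i: "i \<in> {1..n}" for i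
  proof -
    obtain t where "x i = Z_coset t"
      using assms i by (rule torus_coordinate)
    then show ?thesis
      using i by (auto simp: sigma_inv_def shift_Z_coset uminus_Z_coset)
  qed
  then show ?thesis
    by (auto simp: topspace_torus PiE_iff extensional_def sigma_inv_def)
qed

lemma sigma_inv_involution:
  assumes "x \<in> topspace (torus n)"
  shows "sigma_inv n k (sigma_inv n k x) = x"
proof
  fix i
  show "sigma_inv n k (sigma_inv n k x) i = x i"
  proof (cases "i \<in> {1..n}")
    case True
    obtain t where t: "x i = Z_coset t"
      using assms True by (rule torus_coordinate)
    have "Z_coset (t + 1/2 + 1/2) = Z_coset t"
      unfolding Z_coset_eq_iff by simp
    then show ?thesis
      using True by (simp add: sigma_inv_def t shift_Z_coset uminus_Z_coset)
  next
    case False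
    then show ?thesis
      using assms by (auto simp: sigma_inv_def topspace_torus PiE_iff extensional_def)
  qed
qed

lemma sigma_inv_free:
  assumes "1 \<le> k" "1 \<le> n" "x \<in> topspace (torus n)"
  shows "sigma_inv n k x \<noteq> x"
proof
  assume eq: "sigma_inv n k x = x"
  obtain t where t: "x (Suc 0) = Z_coset t"
    using assms by (auto intro: torus_coordinate[of x n "Suc 0"])
  have "Z_coset (t + 1/2) = Z_coset t"
    using fun_cong[OF eq, of "Suc 0"] assms by (simp add: sigma_inv_def t shift_Z_coset)
  then have "(1/2 :: real) \<in> \<int>"
    unfolding Z_coset_eq_iff by simp
  then obtain j :: int where "1/2 = (of_int j :: real)"
    by (elim Ints_cases)
  then have "of_int (2 * j) = (of_int 1 :: real)"
    by simp
  then have "2 * j = 1"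
    by (simp only: of_int_eq_iff)
  then show False
    by presburger
qed

lemma continuous_map_R_mod_Z:
  assumes "continuous_map euclideanreal euclideanreal f"
    and "\<And>t. g (Z_coset t) = Z_coset (f t)"
  shows "continuous_map R_mod_Z R_mod_Z g"
proof -
  have q: "quotient_map euclideanreal R_mod_Z Z_coset"
    by (simp add: R_mod_Z_def quotient_map_quotient_topology)
  have "continuous_map euclideanreal R_mod_Z (Z_coset \<circ> f)"
    using assms(1) quotient_imp_continuous_map[OF q] by (rule continuous_map_compose)
  moreover have "Z_coset \<circ> f = g \<circ> Z_coset"
    using assms(2) by auto
  ultimately show ?thesis
    using continuous_compose_quotient_map[OF q] by metis
qed

lemma continuous_map_sigma_inv: "continuous_map (torus n) (torus n) (sigma_inv n k)"
proof -
  have "continuous_map (torus n) R_mod_Z (\<lambda>x. sigma_inv n k x i)" if i: "i \<in> {1..n}" for i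
  proof -
    have proj: "continuous_map (torus n) R_mod_Z (\<lambda>x. x i)"
      unfolding torus_def using i by (rule continuous_map_product_projection)
    have "continuous_map R_mod_Z R_mod_Z ((`) (\<lambda>t. t + 1/2))"
      by (rule continuous_map_R_mod_Z[where f = "\<lambda>t. t + 1/2"])
         (auto simp: shift_Z_coset intro!: continuous_intros)
    moreover have "continuous_map R_mod_Z R_mod_Z ((`) uminus)"
      by (rule continuous_map_R_mod_Z[where f = uminus])
         (auto simp: uminus_Z_coset intro!: continuous_intros)
    ultimately show ?thesis
      using i continuous_map_compose[OF proj] by (auto simp: sigma_inv_def o_def)
  qed
  then show ?thesis
    unfolding torus_def continuous_map_componentwise
    by (auto simp: sigma_inv_def)
qed

end

theory Submission
  imports Defs "HOL-Homology.Homology" "HOL-Number_Theory.Cong"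
begin

text \<open>
  Let \<open>X\<close> be the quotient of \<open>T^n\<close> by the involution. Rotations give the lower bounds:
  \<open>(\<int>/r)^n\<close> acts on \<open>T^n\<close> by rotations, and the rotations of the first \<open>k\<close> coordinates commute
  with the involution, so \<open>(\<int>/r)^k\<close> acts on \<open>X\<close>.

  For the upper bounds, write either space as the quotient of \<open>\<real>^n\<close> by a discrete group \<open>\<Gamma>\<close> of
  isometries that contains the translations by \<open>\<int>^n\<close> (locale \<open>flat_quotient\<close>), and let an abelian
  group \<open>A\<close> of exponent \<open>r\<close> act effectively on it. Every element of \<open>A\<close> lifts to \<open>\<real>^n\<close>
  (\<open>ex_lift\<close>), and two lifts of the same element differ by an element of \<open>\<Gamma>\<close>. Conjugation by a
  lift permutes the translations by \<open>\<int>^n\<close> and is thus an integer matrix, of finite order. An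
  integer matrix of finite order that is congruent to \<open>1\<close> modulo 9 is the identity
  (\<open>minkowski_congruence\<close>). Hence \<open>A\<close> has at most \<open>9^(n^2)\<close> times as many elements as the set
  \<open>A1\<close> of those elements that have a lift commuting with \<open>\<int>^n\<close>.

  If \<open>f\<close> is such a lift, then \<open>f^r\<close> is the translation by some \<open>u \<in> \<int>^n\<close>. As this translation
  is central and \<open>A\<close> is abelian, any two lifts of this kind commute. The vector \<open>u\<close> modulo \<open>r\<close>
  determines the element of \<open>A\<close> (\<open>rotation_injective\<close>): otherwise some lift different from the
  identity would commute with \<open>\<int>^n\<close> and have finite order, but it moves points by a bounded
  amount, and a periodic map of \<open>\<real>^n\<close> with bounded displacement is the identity
  (\<open>periodic_bounded_displacement_imp_identity\<close>, a form of Newman's theorem).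
  On the torus this gives \<open>r^m \<le> 9^(n^2) r^n\<close> if \<open>A = (\<int>/r)^m\<close>. On \<open>X\<close>, conjugation by a lift of
  the involution changes \<open>f\<close> only by an integer translation, whence \<open>r\<close> divides \<open>2 u_j\<close> for the
  last \<open>n - k\<close> coordinates, and \<open>r^m \<le> 9^(n^2) 2^n r^k\<close>. Letting \<open>r\<close> tend to infinity bounds \<open>m\<close>
  by \<open>n\<close> and \<open>k\<close>, respectively.

  Newman's theorem rests on degrees. Suppose \<open>f\<close> has prime period \<open>p\<close> and moves \<open>x0\<close>. The average of
  the iterates of \<open>f\<close> is an \<open>f\<close>-invariant map at bounded distance from the identity that
  is the identity on the fixed points of \<open>f\<close>. Collapsing the complement of a ball around \<open>x0\<close>
  turns it into an \<open>f\<close>-invariant map from \<open>\<real>^n\<close> to the sphere, of degree 1. But the degree of an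
  invariant map is divisible by \<open>p\<close> when \<open>f\<close> acts freely on the preimage of the north pole
  (\<open>period_dvd_degree\<close>): cover that preimage by cubes with \<open>p\<close> disjoint images,
  move the map off the pole along the orbit of the frontier of one cube, and split off the \<open>p\<close>
  restrictions to the images of this cube, which have equal degrees.
  Additivity of the degree (\<open>Brouwer_degree2_wedge_sum\<close>) comes from the homology of a thickened
  wedge of two spheres.
\<close>

section \<open>Maps into the sphere and additivity of the Brouwer degree\<close>

text \<open>
  The poles lie on the last axis, so that the first \<open>n\<close> coordinates of a point of \<open>nsphere n\<close> form a
  vector of the Euclidean space \<open>Rn n\<close>. In degree arguments the south pole is the base point, the
  value "at infinity", and the north pole is the regular value whose preimage is studied.
\<close>

definition north :: "nat \<Rightarrow> nat \<Rightarrow> real" where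
  "north n = (\<lambda>i. if i = n then 1 else 0)"

definition south :: "nat \<Rightarrow> nat \<Rightarrow> real" where
  "south n = (\<lambda>i. if i = n then -1 else 0)"

lemma topspace_nsphere: "topspace (nsphere n) = {x. (\<forall>i>n. x i = 0) \<and> (\<Sum>i\<le>n. (x i)\<^sup>2) = 1}"
  by (auto simp: nsphere)

lemma north_in_nsphere: "north n \<in> topspace (nsphere n)"
  by (simp add: topspace_nsphere north_def power2_eq_square if_distrib [where f = "\<lambda>x. x * _"] cong: if_cong)

lemma south_in_nsphere: "south n \<in> topspace (nsphere n)"
  by (simp add: topspace_nsphere south_def power2_eq_square if_distrib [where f = "\<lambda>x. x * _"] cong: if_cong)

lemma nsphere_abs_le_1:
  assumes "x \<in> topspace (nsphere n)" shows "\<bar>x i\<bar> \<le> 1"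
proof (cases "i \<le> n")
  case True
  then have "(x i)\<^sup>2 \<le> (\<Sum>i\<le>n. (x i)\<^sup>2)"
    by (intro member_le_sum) auto
  then show ?thesis
    using assms by (simp add: topspace_nsphere abs_le_square_iff[of "x i" 1, simplified])
qed (use assms in \<open>auto simp: topspace_nsphere\<close>)

lemma nsphere_last_zero:
  assumes "x \<in> topspace (nsphere n)" "\<And>i. i < n \<Longrightarrow> x i = 0"
  shows "x = north n \<or> x = south n"
proof -
  have "(\<Sum>i\<le>n. (x i)\<^sup>2) = (x n)\<^sup>2"
    using assms(2) by (subst sum.remove[of _ n]) (auto intro!: sum.neutral)
  then have "x n = 1 \<or> x n = -1"
    using assms(1) by (auto simp: topspace_nsphere power2_eq_1_iff)
  moreover have "x i = 0" if "i \<noteq> n" for i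
    using assms that by (cases "i < n") (auto simp: topspace_nsphere)
  ultimately show ?thesis
    by (auto simp: north_def south_def fun_eq_iff)
qed

lemma nsphere_eq_south_iff:
  assumes "x \<in> topspace (nsphere n)" shows "x = south n \<longleftrightarrow> x n = -1"
proof
  assume x: "x n = -1"
  have "(\<Sum>i\<le>n. (x i)\<^sup>2) = (x n)\<^sup>2 + (\<Sum>i<n. (x i)\<^sup>2)"
    by (simp add: lessThan_Suc_atMost[symmetric])
  then have "(\<Sum>i<n. (x i)\<^sup>2) = 0"
    using assms x by (simp add: topspace_nsphere)
  then have "\<And>i. i < n \<Longrightarrow> x i = 0"
    by (subst (asm) sum_nonneg_eq_0_iff) auto
  then show "x = south n"
    using nsphere_last_zero[OF assms] x by (auto simp: north_def)
qed (simp add: south_def)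

lemma nsphere_eq_north_iff:
  assumes "x \<in> topspace (nsphere n)" shows "x = north n \<longleftrightarrow> x n = 1"
proof
  assume x: "x n = 1"
  have "(\<Sum>i\<le>n. (x i)\<^sup>2) = (x n)\<^sup>2 + (\<Sum>i<n. (x i)\<^sup>2)"
    by (simp add: lessThan_Suc_atMost[symmetric])
  then have "(\<Sum>i<n. (x i)\<^sup>2) = 0"
    using assms x by (simp add: topspace_nsphere)
  then have "\<And>i. i < n \<Longrightarrow> x i = 0"
    by (subst (asm) sum_nonneg_eq_0_iff) auto
  then show "x = north n"
    using nsphere_last_zero[OF assms] x by (auto simp: south_def)
qed (simp add: north_def)

text \<open>
  Coordinates above \<open>n\<close> are reset to 0, so the argument need not lie in \<open>Euclidean_space (Suc n)\<close>.
\<close>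

definition sphere_normalize :: "nat \<Rightarrow> (nat \<Rightarrow> real) \<Rightarrow> nat \<Rightarrow> real" where
  "sphere_normalize n x = (\<lambda>i. if i \<le> n then x i / sqrt (\<Sum>j\<le>n. (x j)\<^sup>2) else 0)"

lemma sphere_normalize_in:
  assumes "i \<le> n" "x i \<noteq> 0"
  shows "sphere_normalize n x \<in> topspace (nsphere n)"
proof -
  have "(\<Sum>j\<le>n. (x j)\<^sup>2) > 0"
    using assms by (intro sum_pos2[of _ i]) auto
  then show ?thesis
    by (simp add: topspace_nsphere sphere_normalize_def power_divide flip: sum_divide_distrib)
qed

lemma sphere_normalize_id: "x \<in> topspace (nsphere n) \<Longrightarrow> sphere_normalize n x = x"
  by (auto simp: topspace_nsphere sphere_normalize_def fun_eq_iff)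

lemma continuous_map_sphere_normalize:
  assumes "\<And>i. i \<le> n \<Longrightarrow> continuous_map X euclideanreal (\<lambda>x. f x i)"
    and "\<And>x. x \<in> topspace X \<Longrightarrow> \<exists>i\<le>n. f x i \<noteq> 0"
  shows "continuous_map X (nsphere n) (\<lambda>x. sphere_normalize n (f x))"
proof -
  have pos: "(\<Sum>j\<le>n. (f x j)\<^sup>2) > 0" if x: "x \<in> topspace X" for x
  proof -
    obtain i where "i \<le> n" "f x i \<noteq> 0" using assms(2)[OF x] by blast
    then show ?thesis by (intro sum_pos2[of _ i]) auto
  qed
  have "continuous_map X euclideanreal (\<lambda>x. sphere_normalize n (f x) i)" for i
  proof (cases "i \<le> n")
    case True
    then show ?thesis
      unfolding sphere_normalize_def using assms(1) pos
      by (auto intro!: continuous_intros simp: less_imp_neq[THEN not_sym])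
  qed (simp add: sphere_normalize_def)
  moreover have "sphere_normalize n (f x) \<in> topspace (nsphere n)" if "x \<in> topspace X" for x
    using assms(2)[OF that] sphere_normalize_in by blast
  ultimately show ?thesis
    by (auto simp: nsphere continuous_map_in_subtopology continuous_map_componentwise_UNIV image_subset_iff)
qed

lemma continuous_map_nsphere_coord:
  "continuous_map X (nsphere n) f \<Longrightarrow> continuous_map X euclideanreal (\<lambda>x. f x i)"
  using continuous_map_compose[OF _ continuous_map_nsphere_projection, unfolded o_def] by blast

text \<open>
  The segment from \<open>f x\<close> to \<open>g x\<close> avoids the origin, so it can be projected to the sphere.
\<close>

lemma homotopic_never_antipodal:
  assumes f: "continuous_map X (nsphere n) f" and g: "continuous_map X (nsphere n) g"
    and na: "\<And>x. x \<in> topspace X \<Longrightarrow> \<exists>i\<le>n. f x i \<noteq> - g x i"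
  shows "homotopic_with (\<lambda>h. True) X (nsphere n) f g"
proof -
  let ?h = "\<lambda>z. sphere_normalize n (\<lambda>i. (1 - fst z) * f (snd z) i + fst z * g (snd z) i)"
  have "continuous_map (prod_topology (top_of_set {0..1::real}) X) (nsphere n) ?h"
  proof (rule continuous_map_sphere_normalize)
    fix i
    have c: "continuous_map (prod_topology (top_of_set {0..1::real}) X) euclideanreal fst"
      using continuous_map_fst continuous_map_into_fulltopology by blast
    have "continuous_map (prod_topology (top_of_set {0..1::real}) X) euclideanreal (\<lambda>z. f (snd z) i)"
      "continuous_map (prod_topology (top_of_set {0..1::real}) X) euclideanreal (\<lambda>z. g (snd z) i)"
      using continuous_map_compose[OF continuous_map_snd continuous_map_nsphere_coord[OF f], unfolded o_def]
       continuous_map_compose[OF continuous_map_snd continuous_map_nsphere_coord[OF g], unfolded o_def] by blast+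
    with c show "continuous_map (prod_topology (top_of_set {0..1::real}) X) euclideanreal
        (\<lambda>z. (1 - fst z) * f (snd z) i + fst z * g (snd z) i)"
      by (intro continuous_intros)
  next
    fix z assume "z \<in> topspace (prod_topology (top_of_set {0..1::real}) X)"
    then obtain t x where z: "z = (t, x)" "0 \<le> t" "t \<le> 1" "x \<in> topspace X" by auto
    show "\<exists>i\<le>n. (1 - fst z) * f (snd z) i + fst z * g (snd z) i \<noteq> 0"
    proof (rule ccontr)
      assume "\<not> ?thesis"
      then have eq: "(1 - t) * f x i = - t * g x i" if "i \<le> n" for i
        using that z by (auto simp: algebra_simps)
      have "(\<Sum>i\<le>n. (f x i)\<^sup>2) = 1" "(\<Sum>i\<le>n. (g x i)\<^sup>2) = 1"
        using f g z by (auto simp: continuous_map_def topspace_nsphere Pi_iff)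
      moreover have "(\<Sum>i\<le>n. ((1 - t) * f x i)\<^sup>2) = (\<Sum>i\<le>n. (- t * g x i)\<^sup>2)"
        using eq by (intro sum.cong) auto
      ultimately have "(1 - t)\<^sup>2 = t\<^sup>2"
        by (simp add: power_mult_distrib flip: sum_distrib_left)
      then have "t = 1/2" by (simp add: power2_eq_square algebra_simps)
      then show False using eq na[OF z(4)] by force
    qed
  qed
  moreover have "?h (0, x) = f x" "?h (1, x) = g x" if "x \<in> topspace X" for x
    using that f g by (auto simp: continuous_map_def sphere_normalize_id Pi_iff)
  ultimately show ?thesis
    by (subst homotopic_with) auto
qed

text \<open>
  The open half-sphere contracts along the projected segments to the south pole. An open
  half-sphere is needed because excision is applied to sets that are built from it.
\<close>

lemma homotopic_id_south_cap:
  "homotopic_with (\<lambda>h. True) (subtopology (nsphere n) {x. x n < 0}) (subtopology (nsphere n) {x. x n < 0})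
     id (\<lambda>x. south n)"
proof -
  let ?N = "subtopology (nsphere n) {x. x n < 0}"
  let ?h = "\<lambda>z. sphere_normalize n (\<lambda>i. (1 - fst z) * snd z i + fst z * south n i)"
  have neg: "(1 - t) * x n + t * south n n < 0" if "0 \<le> t" "t \<le> 1" "x n < 0" for t :: real and x
  proof -
    have "(1 - t) * x n \<le> 0" using that by (simp add: mult_nonneg_nonpos)
    moreover have "(1 - t) * x n < 0 \<or> t = 1" using that by (auto simp: mult_less_0_iff)
    ultimately show ?thesis using that by (auto simp: south_def)
  qed
  have "continuous_map (prod_topology (top_of_set {0..1::real}) ?N) (nsphere n) ?h"
  proof (rule continuous_map_sphere_normalize)
    fix i
    have c: "continuous_map (prod_topology (top_of_set {0..1::real}) ?N) euclideanreal fst"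
      using continuous_map_fst continuous_map_into_fulltopology by blast
    have "continuous_map (prod_topology (top_of_set {0..1::real}) ?N) euclideanreal (\<lambda>z. snd z i)"
      using continuous_map_compose[OF continuous_map_snd continuous_map_from_subtopology[OF continuous_map_nsphere_projection[of n i]], unfolded o_def] .
    with c show "continuous_map (prod_topology (top_of_set {0..1::real}) ?N) euclideanreal
        (\<lambda>z. (1 - fst z) * snd z i + fst z * south n i)"
      by (intro continuous_intros)
  qed (use neg in \<open>force intro!: exI[of _ n]\<close>)
  moreover have "?h z n < 0" if z: "z \<in> topspace (prod_topology (top_of_set {0..1::real}) ?N)" for z
  proof -
    have "(1 - fst z) * snd z n + fst z * south n n < 0"
      using z by (intro neg) auto
    then show ?thesis
      by (auto simp: sphere_normalize_def divide_neg_pos intro!: divide_neg_pos sum_pos2[of _ n])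
  qed
  ultimately have "continuous_map (prod_topology (top_of_set {0..1::real}) ?N) ?N ?h"
    by (auto simp: continuous_map_in_subtopology)
  moreover have "?h (0, x) = x" "?h (1, x) = south n" if "x \<in> topspace ?N" for x
    using that by (auto simp: sphere_normalize_id south_in_nsphere)
  ultimately show ?thesis
    by (subst homotopic_with) (simp, intro exI[of _ ?h], simp)
qed

text \<open>
  A constant map factors through a point, whose homology vanishes away from dimension 0.
\<close>

lemma hom_induced_const:
  assumes "p \<noteq> 0" "continuous_map X Y (\<lambda>x. a)" "c \<in> carrier (homology_group p X)"
  shows "hom_induced p X {} Y {} (\<lambda>x. a) c = \<one>\<^bsub>homology_group p Y\<^esub>"
proof (cases "topspace X = {}")
  case True
  then have "c = \<one>\<^bsub>homology_group p X\<^esub>"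
    using trivial_homology_group_empty[OF True, of p] assms(3) by (auto simp: trivial_group_def)
  then show ?thesis
    using hom_one[OF hom_induced_empty_hom] by simp
next
  case False
  then have a: "a \<in> topspace Y" using assms(2) by (auto simp: continuous_map_def)
  have c1: "continuous_map X (subtopology Y {a}) (\<lambda>x. a)"
    using assms(2) by (auto simp: continuous_map_in_subtopology)
  have "hom_induced p X {} Y {} (id \<circ> (\<lambda>x. a)) =
      hom_induced p (subtopology Y {a}) {} Y {} id \<circ> hom_induced p X {} (subtopology Y {a}) {} (\<lambda>x. a)"
    by (rule hom_induced_compose_empty[OF c1]) auto
  moreover have "trivial_group (homology_group p (subtopology Y {a}))"
    using a assms(1) by (intro homology_dimension_axiom) auto
  then have "hom_induced p X {} (subtopology Y {a}) {} (\<lambda>x. a) c = \<one>\<^bsub>homology_group p (subtopology Y {a})\<^esub>"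
    using hom_induced_carrier[of p X "{}" "subtopology Y {a}" "{}"] by (auto simp: trivial_group_def)
  ultimately show ?thesis
    using hom_one[OF hom_induced_empty_hom] by (simp add: o_def fun_eq_iff)
qed

lemma trivial_homology_group_contractible:
  assumes "contractible_space X" "p \<noteq> 0"
  shows "trivial_group (homology_group p X)"
  using trivial_reduced_homology_group_contractible_space[OF assms(1), of p] assms(2)
  by (simp add: un_reduced_homology_group)

text \<open>
  The wedge of two spheres inside their product, with the base point enlarged to an open
  half-sphere: the two thickened spheres are then open, and excision applies to them.
\<close>

definition fat_wedge :: "nat \<Rightarrow> ((nat \<Rightarrow> real) \<times> (nat \<Rightarrow> real)) topology" where
  "fat_wedge n = subtopology (prod_topology (nsphere n) (nsphere n)) {z. fst z n < 0 \<or> snd z n < 0}"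

lemma fat_wedge_left:
  "subtopology (fat_wedge n) {z. snd z n < 0} = prod_topology (nsphere n) (subtopology (nsphere n) {x. x n < 0})"
proof -
  have "{z::(nat\<Rightarrow>real)\<times>(nat\<Rightarrow>real). fst z n < 0 \<or> snd z n < 0} \<inter> {z. snd z n < 0} = UNIV \<times> {x::nat\<Rightarrow>real. x n < (0::real)}" by auto
  then show ?thesis
    unfolding fat_wedge_def subtopology_subtopology
    by (simp only: subtopology_Times subtopology_UNIV)
qed

lemma fat_wedge_right:
  "subtopology (fat_wedge n) {z. fst z n < 0} = prod_topology (subtopology (nsphere n) {x. x n < 0}) (nsphere n)"
proof -
  have "{z::(nat\<Rightarrow>real)\<times>(nat\<Rightarrow>real). fst z n < 0 \<or> snd z n < 0} \<inter> {z. fst z n < 0} = {x::nat\<Rightarrow>real. x n < (0::real)} \<times> UNIV" by auto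
  then show ?thesis
    unfolding fat_wedge_def subtopology_subtopology
    by (simp only: subtopology_Times subtopology_UNIV)
qed

lemma fat_wedge_corner:
  "subtopology (fat_wedge n) ({z. fst z n < 0} \<inter> {z. snd z n < 0}) =
   prod_topology (subtopology (nsphere n) {x. x n < 0}) (subtopology (nsphere n) {x. x n < 0})"
proof -
  have "{z::(nat\<Rightarrow>real)\<times>(nat\<Rightarrow>real). fst z n < 0 \<or> snd z n < 0} \<inter> ({z. fst z n < 0} \<inter> {z. snd z n < 0}) =
    {x::nat\<Rightarrow>real. x n < (0::real)} \<times> {x. x n < 0}" by auto
  then show ?thesis
    unfolding fat_wedge_def subtopology_subtopology
    by (simp only: subtopology_Times)
qed

lemma openin_fat_wedge:
  "openin (fat_wedge n) (topspace (fat_wedge n) \<inter> {z. fst z n < 0})"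
  "openin (fat_wedge n) (topspace (fat_wedge n) \<inter> {z. snd z n < 0})"
proof -
  have f: "continuous_map (fat_wedge n) euclideanreal (\<lambda>z. fst z n)"
    unfolding fat_wedge_def
    using continuous_map_compose[OF continuous_map_fst continuous_map_nsphere_projection, unfolded o_def]
    by (rule continuous_map_from_subtopology)
  have s: "continuous_map (fat_wedge n) euclideanreal (\<lambda>z. snd z n)"
    unfolding fat_wedge_def
    using continuous_map_compose[OF continuous_map_snd continuous_map_nsphere_projection, unfolded o_def]
    by (rule continuous_map_from_subtopology)
  show "openin (fat_wedge n) (topspace (fat_wedge n) \<inter> {z. fst z n < 0})"
    using openin_continuous_map_preimage[OF f, of "{..<0}"] by (simp add: Int_def)
  show "openin (fat_wedge n) (topspace (fat_wedge n) \<inter> {z. snd z n < 0})"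
    using openin_continuous_map_preimage[OF s, of "{..<0}"] by (simp add: Int_def)
qed

text \<open>
  This is the surjectivity in the Mayer-Vietoris sequence of the two open halves, whose
  intersection is contractible. A class \<open>z\<close> maps to the homology relative to the first half, which by
  excision comes from the second half relative to the intersection; there it lifts to an absolute
  class, as the homology of the intersection vanishes in dimension \<open>n - 1 \<ge> 1\<close>.
\<close>

lemma fat_wedge_homology_split:
  assumes n: "n \<ge> 2" and z: "z \<in> carrier (homology_group (int n) (fat_wedge n))"
  obtains \<alpha> \<beta> where
    "\<alpha> \<in> carrier (homology_group (int n) (subtopology (fat_wedge n) {z. snd z n < 0}))"
    "\<beta> \<in> carrier (homology_group (int n) (subtopology (fat_wedge n) {z. fst z n < 0}))"
    "z = hom_induced (int n) (subtopology (fat_wedge n) {z. snd z n < 0}) {} (fat_wedge n) {} id \<alpha>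
      \<otimes>\<^bsub>homology_group (int n) (fat_wedge n)\<^esub>
      hom_induced (int n) (subtopology (fat_wedge n) {z. fst z n < 0}) {} (fat_wedge n) {} id \<beta>"
proof -
  let ?E = "fat_wedge n" and ?p = "int n"
  let ?A = "{z::(nat\<Rightarrow>real)\<times>(nat\<Rightarrow>real). snd z n < 0}" and ?B = "{z::(nat\<Rightarrow>real)\<times>(nat\<Rightarrow>real). fst z n < 0}"
  let ?U = "topspace ?E - ?B"
  have cover: "topspace ?E \<subseteq> ?A \<union> ?B" by (auto simp: fat_wedge_def)
  have sub1: "subtopology ?E (topspace ?E - ?U) = subtopology ?E ?B"
    by (simp add: Diff_Diff_Int flip: subtopology_restrict[of _ ?B])
  have closU: "closedin ?E ?U"
    using openin_closedin_eq[of ?E "topspace ?E \<inter> ?B"] openin_fat_wedge(1)[of n] by (simp add: Diff_Int)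
  have "?E closure_of ?U \<subseteq> ?E interior_of (topspace ?E \<inter> ?A)"
    using closU cover openin_fat_wedge(2)[of n]
    by (auto simp: closure_of_closedin interior_of_openin)
  then have exc: "hom_induced ?p (subtopology ?E (topspace ?E - ?U)) (topspace ?E \<inter> ?A - ?U) (subtopology ?E (topspace ?E)) (topspace ?E \<inter> ?A) id
    \<in> iso (relative_homology_group ?p (subtopology ?E (topspace ?E - ?U)) (topspace ?E \<inter> ?A - ?U))
          (relative_homology_group ?p (subtopology ?E (topspace ?E)) (topspace ?E \<inter> ?A))"
    by (intro homology_excision_axiom) auto
  have TU: "topspace ?E \<inter> ?A - ?U = topspace (subtopology ?E ?B) \<inter> ?A" by auto
  have exc': "hom_induced ?p (subtopology ?E ?B) ?A ?E ?A id
    \<in> iso (relative_homology_group ?p (subtopology ?E ?B) ?A) (relative_homology_group ?p ?E ?A)"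
  proof -
    have "hom_induced ?p (subtopology ?E ?B) (topspace (subtopology ?E ?B) \<inter> ?A) ?E (topspace ?E \<inter> ?A) id
    \<in> iso (relative_homology_group ?p (subtopology ?E ?B) (topspace (subtopology ?E ?B) \<inter> ?A))
       (relative_homology_group ?p ?E (topspace ?E \<inter> ?A))"
      using exc unfolding sub1 TU by simp
    then show ?thesis
      by (simp only: hom_induced_restrict relative_homology_group_restrict)
  qed
  let ?w = "hom_induced ?p ?E {} ?E ?A id z"
  have wc: "?w \<in> carrier (relative_homology_group ?p ?E ?A)"
    by (rule hom_induced_carrier)
  have "hom_induced ?p (subtopology ?E ?B) ?A ?E ?A id ` carrier (relative_homology_group ?p (subtopology ?E ?B) ?A)
     = carrier (relative_homology_group ?p ?E ?A)"
    using exc' unfolding iso_def bij_betw_def by blast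
  with wc have "?w \<in> hom_induced ?p (subtopology ?E ?B) ?A ?E ?A id ` carrier (relative_homology_group ?p (subtopology ?E ?B) ?A)"
    by simp
  then obtain w' where w': "w' \<in> carrier (relative_homology_group ?p (subtopology ?E ?B) ?A)"
     "hom_induced ?p (subtopology ?E ?B) ?A ?E ?A id w' = ?w"
    by (elim imageE) simp
  have "contractible_space (subtopology (subtopology ?E ?B) ?A)"
    unfolding subtopology_subtopology fat_wedge_corner
    using homotopic_id_south_cap[of n]
    by (simp add: contractible_space_prod_topology) (auto simp: contractible_space_def)
  then have triv: "trivial_group (homology_group (?p - 1) (subtopology (subtopology ?E ?B) ?A))"
    using n by (intro trivial_homology_group_contractible) auto
  have "hom_boundary ?p (subtopology ?E ?B) ?A w' = \<one>\<^bsub>homology_group (?p - 1) (subtopology (subtopology ?E ?B) ?A)\<^esub>"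
    using triv hom_boundary_carrier[of ?p "subtopology ?E ?B" ?A w'] by (auto simp: trivial_group_def)
  then have "w' \<in> kernel (relative_homology_group ?p (subtopology ?E ?B) ?A)
      (homology_group (?p - 1) (subtopology (subtopology ?E ?B) ?A)) (hom_boundary ?p (subtopology ?E ?B) ?A)"
    using w'(1) by (simp add: kernel_def del: one_relative_homology_group)
  then obtain \<beta> where \<beta>: "\<beta> \<in> carrier (homology_group ?p (subtopology ?E ?B))"
    "hom_induced ?p (subtopology ?E ?B) {} (subtopology ?E ?B) ?A id \<beta> = w'"
    using homology_exactness_axiom_1[of ?p "subtopology ?E ?B" ?A] by auto
  let ?y = "hom_induced ?p (subtopology ?E ?B) {} ?E {} id \<beta>"
  have y: "?y \<in> carrier (homology_group ?p ?E)" by (rule hom_induced_carrier)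
  have "hom_induced ?p ?E {} ?E ?A id ?y = hom_induced ?p (subtopology ?E ?B) {} ?E ?A (id \<circ> id) \<beta>"
    by (rule hom_induced_compose') auto
  also have "\<dots> = hom_induced ?p (subtopology ?E ?B) ?A ?E ?A id (hom_induced ?p (subtopology ?E ?B) {} (subtopology ?E ?B) ?A id \<beta>)"
    by (rule hom_induced_compose'[symmetric]) auto
  also have "\<dots> = ?w" using \<beta> w' by simp
  finally have yw: "hom_induced ?p ?E {} ?E ?A id ?y = ?w" .
  interpret G: group "homology_group ?p ?E" by simp
  interpret R: group_hom "homology_group ?p ?E" "relative_homology_group ?p ?E ?A" "hom_induced ?p ?E {} ?E ?A id"
    by (simp add: group_hom_def group_hom_axioms_def hom_induced_hom)
  have "hom_induced ?p ?E {} ?E ?A id (z \<otimes>\<^bsub>homology_group ?p ?E\<^esub> inv\<^bsub>homology_group ?p ?E\<^esub> ?y)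
     = \<one>\<^bsub>relative_homology_group ?p ?E ?A\<^esub>"
    using z y yw by (simp del: one_relative_homology_group)
  then have "z \<otimes>\<^bsub>homology_group ?p ?E\<^esub> inv\<^bsub>homology_group ?p ?E\<^esub> ?y \<in>
     kernel (homology_group ?p ?E) (relative_homology_group ?p ?E ?A) (hom_induced ?p ?E {} ?E ?A id)"
    using z y by (simp add: kernel_def del: one_relative_homology_group)
  then obtain \<alpha> where \<alpha>: "\<alpha> \<in> carrier (homology_group ?p (subtopology ?E ?A))"
    "hom_induced ?p (subtopology ?E ?A) {} ?E {} id \<alpha> = z \<otimes>\<^bsub>homology_group ?p ?E\<^esub> inv\<^bsub>homology_group ?p ?E\<^esub> ?y"
    using homology_exactness_axiom_3[of ?p ?E ?A] by auto
  have "z = hom_induced ?p (subtopology ?E ?A) {} ?E {} id \<alpha> \<otimes>\<^bsub>homology_group ?p ?E\<^esub> ?y"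
    using \<alpha>(2) z y by (simp add: G.m_assoc del: one_relative_homology_group)
  then show thesis using that \<alpha> \<beta> by blast
qed

text \<open>
  Each half retracts to its sphere, so \<open>z\<close> is the sum of a class from the first and one from the
  second sphere. The two projections recover these classes, because each projection is constant on
  the other sphere.
\<close>

lemma fat_wedge_homology_generated:
  assumes n: "n \<ge> 2" and z: "z \<in> carrier (homology_group (int n) (fat_wedge n))"
  shows "z = hom_induced (int n) (nsphere n) {} (fat_wedge n) {} (\<lambda>u. (u, south n))
        (hom_induced (int n) (fat_wedge n) {} (nsphere n) {} fst z)
      \<otimes>\<^bsub>homology_group (int n) (fat_wedge n)\<^esub>
      hom_induced (int n) (nsphere n) {} (fat_wedge n) {} (\<lambda>v. (south n, v))
        (hom_induced (int n) (fat_wedge n) {} (nsphere n) {} snd z)"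
proof -
  let ?E = "fat_wedge n" and ?p = "int n" and ?S = "nsphere n" and ?N = "subtopology (nsphere n) {x. x n < 0}"
  let ?A = "subtopology ?E {z. snd z n < 0}" and ?B = "subtopology ?E {z. fst z n < 0}"
  let ?i = "\<lambda>u. (u, south n)" and ?j = "\<lambda>v. (south n, v)"
  obtain \<alpha> \<beta> where \<alpha>: "\<alpha> \<in> carrier (homology_group ?p ?A)" and \<beta>: "\<beta> \<in> carrier (homology_group ?p ?B)"
    and zeq: "z = hom_induced ?p ?A {} ?E {} id \<alpha> \<otimes>\<^bsub>homology_group ?p ?E\<^esub> hom_induced ?p ?B {} ?E {} id \<beta>"
    using fat_wedge_homology_split[OF assms] by blast
  have fE: "continuous_map ?E ?S fst" and sE: "continuous_map ?E ?S snd"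
    unfolding fat_wedge_def
    by (auto intro: continuous_map_from_subtopology continuous_map_fst continuous_map_snd)
  have ci: "continuous_map ?S ?E ?i" and cj: "continuous_map ?S ?E ?j"
    unfolding fat_wedge_def continuous_map_in_subtopology
    using south_in_nsphere by (auto simp: south_def intro!: continuous_map_pairedI)
  have cA: "continuous_map ?A ?E id" and cB: "continuous_map ?B ?E id"
    by auto
  have "homotopic_with (\<lambda>h. True) (prod_topology ?S ?N) (prod_topology ?S ?N)
        (\<lambda>z. (id (fst z), id (snd z))) (\<lambda>z. (id (fst z), south n))"
    by (rule homotopic_with_prod_topology[OF _ homotopic_id_south_cap]) (auto simp flip: id_def)
  then have "homotopic_with (\<lambda>h. True) ?A ?E id (?i \<circ> fst)"
    unfolding fat_wedge_left[symmetric]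
    by (intro homotopic_with_compose_continuous_map_left[OF _ cA, where f = id, unfolded id_o, simplified])
       (auto simp: o_def id_def)
  then have hA: "hom_induced ?p ?A {} ?E {} id \<alpha> = hom_induced ?p ?S {} ?E {} ?i (hom_induced ?p ?A {} ?S {} fst \<alpha>)"
    by (simp only: homology_homotopy_empty hom_induced_compose_empty[OF continuous_map_compose[OF cA fE, simplified] ci] comp_apply)
  have "homotopic_with (\<lambda>h. True) (prod_topology ?N ?S) (prod_topology ?N ?S)
        (\<lambda>z. (id (fst z), id (snd z))) (\<lambda>z. (south n, id (snd z)))"
    by (rule homotopic_with_prod_topology[OF homotopic_id_south_cap]) (auto simp flip: id_def)
  then have "homotopic_with (\<lambda>h. True) ?B ?E id (?j \<circ> snd)"
    unfolding fat_wedge_right[symmetric]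
    by (intro homotopic_with_compose_continuous_map_left[OF _ cB, where f = id, unfolded id_o, simplified])
       (auto simp: o_def id_def)
  then have hB: "hom_induced ?p ?B {} ?E {} id \<beta> = hom_induced ?p ?S {} ?E {} ?j (hom_induced ?p ?B {} ?S {} snd \<beta>)"
    by (simp only: homology_homotopy_empty hom_induced_compose_empty[OF continuous_map_compose[OF cB sE, simplified] cj] comp_apply)
  define a where "a = hom_induced ?p ?A {} ?S {} fst \<alpha>"
  define b where "b = hom_induced ?p ?B {} ?S {} snd \<beta>"
  have ab: "a \<in> carrier (homology_group ?p ?S)" "b \<in> carrier (homology_group ?p ?S)"
    by (simp_all add: a_def b_def hom_induced_carrier)
  have zab: "z = hom_induced ?p ?S {} ?E {} ?i a \<otimes>\<^bsub>homology_group ?p ?E\<^esub> hom_induced ?p ?S {} ?E {} ?j b"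
    unfolding a_def b_def zeq hA hB ..
  have p0: "?p \<noteq> 0" using n by simp
  have cc: "continuous_map ?S ?S (\<lambda>v. south n)" using south_in_nsphere by simp
  interpret F: group_hom "homology_group ?p ?E" "homology_group ?p ?S" "hom_induced ?p ?E {} ?S {} fst"
    by (simp add: group_hom_def group_hom_axioms_def hom_induced_hom)
  interpret G: group_hom "homology_group ?p ?E" "homology_group ?p ?S" "hom_induced ?p ?E {} ?S {} snd"
    by (simp add: group_hom_def group_hom_axioms_def hom_induced_hom)
  have "hom_induced ?p ?E {} ?S {} fst (hom_induced ?p ?S {} ?E {} ?i a) = hom_induced ?p ?S {} ?S {} (fst \<circ> ?i) a"
    by (simp only: hom_induced_compose_empty[OF ci fE] comp_apply)
  also have "\<dots> = a" using hom_induced_id[OF ab(1)] by (simp add: o_def id_def)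
  finally have 1: "hom_induced ?p ?E {} ?S {} fst (hom_induced ?p ?S {} ?E {} ?i a) = a" .
  have "hom_induced ?p ?E {} ?S {} fst (hom_induced ?p ?S {} ?E {} ?j b) = hom_induced ?p ?S {} ?S {} (fst \<circ> ?j) b"
    by (simp only: hom_induced_compose_empty[OF cj fE] comp_apply)
  also have "\<dots> = \<one>\<^bsub>homology_group ?p ?S\<^esub>"
    using hom_induced_const[OF p0 cc ab(2)] by (simp add: o_def)
  finally have 2: "hom_induced ?p ?E {} ?S {} fst (hom_induced ?p ?S {} ?E {} ?j b) = \<one>\<^bsub>homology_group ?p ?S\<^esub>" .
  have "hom_induced ?p ?E {} ?S {} snd (hom_induced ?p ?S {} ?E {} ?i a) = hom_induced ?p ?S {} ?S {} (snd \<circ> ?i) a"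
    by (simp only: hom_induced_compose_empty[OF ci sE] comp_apply)
  also have "\<dots> = \<one>\<^bsub>homology_group ?p ?S\<^esub>"
    using hom_induced_const[OF p0 cc ab(1)] by (simp add: o_def)
  finally have 3: "hom_induced ?p ?E {} ?S {} snd (hom_induced ?p ?S {} ?E {} ?i a) = \<one>\<^bsub>homology_group ?p ?S\<^esub>" .
  have "hom_induced ?p ?E {} ?S {} snd (hom_induced ?p ?S {} ?E {} ?j b) = hom_induced ?p ?S {} ?S {} (snd \<circ> ?j) b"
    by (simp only: hom_induced_compose_empty[OF cj sE] comp_apply)
  also have "\<dots> = b" using hom_induced_id[OF ab(2)] by (simp add: o_def id_def)
  finally have 4: "hom_induced ?p ?E {} ?S {} snd (hom_induced ?p ?S {} ?E {} ?j b) = b" .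
  have "hom_induced ?p ?E {} ?S {} fst z = a" "hom_induced ?p ?E {} ?S {} snd z = b"
    using 1 2 3 4 ab by (simp_all add: zab hom_induced_carrier del: one_relative_homology_group)
  then show ?thesis using zab by simp
qed

text \<open>
  Pushes the part of the sphere below height \<open>\<nu>\<close> to the south pole and stretches the rest over
  the sphere: the height \<open>s\<close>, rescaled to run from 0 to 1 between \<open>\<nu>\<close> and the north pole, scales the
  horizontal part, and the vertical part runs from -1 to 1.
\<close>

definition sphere_collapse :: "nat \<Rightarrow> real \<Rightarrow> (nat \<Rightarrow> real) \<Rightarrow> nat \<Rightarrow> real" where
  "sphere_collapse n \<nu> x = (let s = max 0 ((x n - \<nu>) / (1 - \<nu>)) in
     sphere_normalize n (\<lambda>i. if i = n then 2 * s - 1 else s * x i))"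

lemma sphere_collapse_south:
  assumes "x n \<le> \<nu>" "\<nu> < 1"
  shows "sphere_collapse n \<nu> x = south n"
proof -
  have "(x n - \<nu>) / (1 - \<nu>) \<le> 0" using assms by (simp add: divide_nonpos_pos)
  then have "sphere_collapse n \<nu> x = sphere_normalize n (south n)"
    unfolding sphere_collapse_def south_def by (simp add: Let_def max_def cong: if_cong)
  then show ?thesis by (simp add: sphere_normalize_id south_in_nsphere)
qed

lemma sphere_collapse_nonzero:
  assumes "x \<in> topspace (nsphere n)" "-1 \<le> \<nu>" "\<nu> < 1" "s = max 0 ((x n - \<nu>) / (1 - \<nu>))"
  shows "\<exists>i\<le>n. (if i = n then 2 * s - 1 else s * x i) \<noteq> 0"
proof (rule ccontr)
  assume "\<not> ?thesis"
  then have *: "(if i = n then 2 * s - 1 else s * x i) = 0" if "i \<le> n" for i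
    using that by blast
  have s: "s = 1/2" using *[of n] by simp
  have "x i = 0" if "i < n" for i using *[of i] that s by auto
  then have "x = north n \<or> x = south n" using nsphere_last_zero[OF assms(1)] by blast
  then have "x n = 1 \<or> x n = -1" by (auto simp: north_def south_def)
  moreover have "(x n - \<nu>) / (1 - \<nu>) = 1/2" using assms(4) s by (auto simp: max_def split: if_splits)
  ultimately show False using assms(2,3) by (auto simp: field_simps)
qed

lemma continuous_map_sphere_collapse:
  assumes "-1 \<le> \<nu>" "\<nu> < 1"
  shows "continuous_map (nsphere n) (nsphere n) (sphere_collapse n \<nu>)"
  unfolding sphere_collapse_def Let_def
proof (rule continuous_map_sphere_normalize)
  fix i
  have "1 - \<nu> \<noteq> 0" using assms by simp
  then show "continuous_map (nsphere n) euclideanreal (\<lambda>x. if i = n then 2 * max 0 ((x n - \<nu>) / (1 - \<nu>)) - 1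
      else max 0 ((x n - \<nu>) / (1 - \<nu>)) * x i)"
    by (cases "i = n") (auto intro!: continuous_intros continuous_map_nsphere_projection)
qed (use sphere_collapse_nonzero assms in blast)

lemma sphere_collapse_coord:
  assumes "x \<in> topspace (nsphere n)" "-1 \<le> \<nu>" "\<nu> < 1"
  obtains c s where "c > 0" "s = max 0 ((x n - \<nu>) / (1 - \<nu>))" "sphere_collapse n \<nu> x n = c * (2 * s - 1)"
    "\<And>i. i < n \<Longrightarrow> sphere_collapse n \<nu> x i = c * s * x i"
proof -
  define s where "s = max 0 ((x n - \<nu>) / (1 - \<nu>))"
  define y where "y = (\<lambda>i. if i = n then 2 * s - 1 else s * x i)"
  obtain i where "i \<le> n" "y i \<noteq> 0" using sphere_collapse_nonzero[OF assms s_def] unfolding y_def by blast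
  then have "(\<Sum>j\<le>n. (y j)\<^sup>2) > 0"
    by (intro sum_pos2[of _ i]) auto
  moreover have "sphere_collapse n \<nu> x = sphere_normalize n y"
    unfolding sphere_collapse_def Let_def y_def s_def ..
  ultimately show thesis
    by (intro that[of "1 / sqrt (\<Sum>j\<le>n. (y j)\<^sup>2)" s]) (auto simp: sphere_normalize_def y_def s_def)
qed

lemma sphere_collapse_eq_north:
  assumes "x \<in> topspace (nsphere n)" "-1 \<le> \<nu>" "\<nu> < 1" "sphere_collapse n \<nu> x = north n"
  shows "x = north n"
proof -
  obtain c s where cs: "c > 0" "s = max 0 ((x n - \<nu>) / (1 - \<nu>))" "sphere_collapse n \<nu> x n = c * (2 * s - 1)"
    "\<And>i. i < n \<Longrightarrow> sphere_collapse n \<nu> x i = c * s * x i"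
    using sphere_collapse_coord[OF assms(1-3)] by metis
  have "c * (2 * s - 1) = 1" using cs(3) assms(4) by (simp add: north_def)
  then have s: "s > 0" using cs(1) by (smt (verit) mult_nonneg_nonpos)
  then have "x i = 0" if "i < n" for i using cs(4)[OF that] assms(4) cs(1) that by (simp add: north_def)
  then have "x = north n \<or> x = south n" using nsphere_last_zero[OF assms(1)] by blast
  moreover have "x \<noteq> south n" using s cs(2) assms(2,3) by (auto simp: south_def max_def field_simps split: if_splits)
  ultimately show ?thesis by blast
qed

text \<open>
  The horizontal part is only multiplied by a nonnegative number, so a point can be sent to its
  antipode only if it is a pole; but both poles are fixed.
\<close>

lemma homotopic_sphere_collapse_id:
  assumes "-1 \<le> \<nu>" "\<nu> < 1"
  shows "homotopic_with (\<lambda>h. True) (nsphere n) (nsphere n) (sphere_collapse n \<nu>) id"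
proof (rule homotopic_never_antipodal)
  fix x assume x: "x \<in> topspace (nsphere n)"
  show "\<exists>i\<le>n. sphere_collapse n \<nu> x i \<noteq> - id x i"
  proof (rule ccontr)
    assume "\<not> ?thesis"
    then have eq: "sphere_collapse n \<nu> x i = - x i" if "i \<le> n" for i using that by auto
    obtain c s where cs: "c > 0" "s = max 0 ((x n - \<nu>) / (1 - \<nu>))" "sphere_collapse n \<nu> x n = c * (2 * s - 1)"
      "\<And>i. i < n \<Longrightarrow> sphere_collapse n \<nu> x i = c * s * x i"
      using sphere_collapse_coord[OF x assms] by metis
    have "x i = 0" if "i < n" for i
    proof -
      have "(c * s + 1) * x i = 0" using cs(4)[OF that] eq[of i] that by (simp add: algebra_simps)
      moreover have "c * s \<ge> 0" using cs(1,2) by simp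
      ultimately show ?thesis by auto
    qed
    then have "x = north n \<or> x = south n" using nsphere_last_zero[OF x] by blast
    then show False
    proof
      assume "x = north n"
      then have "x n = 1" by (simp add: north_def)
      then have "s = 1" using cs(2) assms by simp
      then show False using cs(1,3) eq[of n] \<open>x n = 1\<close> by simp
    next
      assume "x = south n"
      then have xn: "x n = -1" by (simp add: south_def)
      then have "sphere_collapse n \<nu> x n = -1" using sphere_collapse_south[of x n \<nu>] assms by (simp add: south_def)
      then show False using eq[of n] xn by simp
    qed
  qed
qed (auto simp: continuous_map_sphere_collapse assms)

text \<open>
  The pair \<open>(a, b)\<close> maps the sphere to the wedge, and \<open>c\<close> is this map followed by the folding
  map. By \<open>fat_wedge_homology_generated\<close> the fundamental class goes to the sum of its images
  under \<open>a\<close> and \<open>b\<close>. Folding is continuous on the thickened wedge after the lower half-sphere has been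
  collapsed, and this collapse does not change degrees.
\<close>

lemma Brouwer_degree2_wedge_sum:
  assumes n: "n \<ge> 2"
    and a: "continuous_map (nsphere n) (nsphere n) a" and b: "continuous_map (nsphere n) (nsphere n) b"
    and c: "continuous_map (nsphere n) (nsphere n) c"
    and abc: "\<And>x. x \<in> topspace (nsphere n) \<Longrightarrow> a x = south n \<and> c x = b x \<or> b x = south n \<and> c x = a x"
  shows "Brouwer_degree2 n c = Brouwer_degree2 n a + Brouwer_degree2 n b"
proof -
  let ?E = "fat_wedge n" and ?p = "int n" and ?S = "nsphere n"
  let ?i = "\<lambda>u. (u, south n)" and ?j = "\<lambda>v. (south n, v)"
  define e where "e = sphere_collapse n 0"
  \<comment> \<open>Where both components lie in the lower half-sphere, both branches give the south pole.\<close>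
  define fold where "fold = (\<lambda>z. if fst z n \<le> 0 then e (snd z) else e (fst z))"
  let ?F = "\<lambda>x. (a x, b x)"
  have e: "continuous_map ?S ?S e" unfolding e_def by (rule continuous_map_sphere_collapse) auto
  have es: "e x = south n" if "x n \<le> 0" for x using that unfolding e_def by (intro sphere_collapse_south) auto
  have fE: "continuous_map ?E ?S fst" and sE: "continuous_map ?E ?S snd"
    unfolding fat_wedge_def
    by (auto intro: continuous_map_from_subtopology continuous_map_fst continuous_map_snd)
  have cfold: "continuous_map ?E ?S fold"
    unfolding fold_def
  proof (rule continuous_map_cases_le)
    show "continuous_map ?E euclideanreal (\<lambda>x. fst x n)"
      by (rule continuous_map_nsphere_coord[OF fE])
    show "continuous_map (subtopology ?E {x \<in> topspace ?E. fst x n \<le> 0}) ?S (\<lambda>z. e (snd z))"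
      using continuous_map_compose[OF sE e] by (auto simp: o_def intro: continuous_map_from_subtopology)
    show "continuous_map (subtopology ?E {x \<in> topspace ?E. 0 \<le> fst x n}) ?S (\<lambda>z. e (fst z))"
      using continuous_map_compose[OF fE e] by (auto simp: o_def intro: continuous_map_from_subtopology)
    fix z assume "z \<in> topspace ?E" "fst z n = 0"
    then show "e (snd z) = e (fst z)" by (auto simp: fat_wedge_def es)
  qed auto
  have sn: "south n n = -1" by (simp add: south_def)
  have cF: "continuous_map ?S ?E ?F"
    unfolding fat_wedge_def continuous_map_in_subtopology
    using a b abc sn by (fastforce intro!: continuous_map_pairedI)
  have ci: "continuous_map ?S ?E ?i" and cj: "continuous_map ?S ?E ?j"
    unfolding fat_wedge_def continuous_map_in_subtopology
    using south_in_nsphere by (auto simp: south_def intro!: continuous_map_pairedI)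
  have e_id: "hom_induced ?p ?S {} ?S {} e y = y" if "y \<in> carrier (homology_group ?p ?S)" for y
    using homology_homotopy_empty[OF homotopic_sphere_collapse_id[of 0 n]] hom_induced_id[OF that] by (simp add: e_def)
  show ?thesis
  proof (rule Brouwer_degree2_unique[OF c])
    fix x assume x: "x \<in> carrier (reduced_homology_group ?p ?S)"
    have un: "reduced_homology_group ?p ?S = homology_group ?p ?S"
      using n by (simp add: un_reduced_homology_group)
    have x': "x \<in> carrier (homology_group ?p ?S)" using x un by simp
    define z where "z = hom_induced ?p ?S {} ?E {} ?F x"
    have z: "z \<in> carrier (homology_group ?p ?E)" unfolding z_def by (rule hom_induced_carrier)
    interpret H: group_hom "homology_group ?p ?E" "homology_group ?p ?S" "hom_induced ?p ?E {} ?S {} fold"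
      by (simp add: group_hom_def group_hom_axioms_def hom_induced_hom)
    have compE: "hom_induced ?p ?E {} ?S {} g (hom_induced ?p ?S {} ?E {} f y) = hom_induced ?p ?S {} ?S {} (g \<circ> f) y"
      if "continuous_map ?S ?E f" "continuous_map ?E ?S g" for f g y
      by (simp only: hom_induced_compose_empty[OF that] comp_apply)
    have za: "hom_induced ?p ?E {} ?S {} fst z = hom_induced ?p ?S {} ?S {} a x"
      unfolding z_def compE[OF cF fE] by (simp add: o_def)
    have zb: "hom_induced ?p ?E {} ?S {} snd z = hom_induced ?p ?S {} ?S {} b x"
      unfolding z_def compE[OF cF sE] by (simp add: o_def)
    have fold_i: "hom_induced ?p ?E {} ?S {} fold (hom_induced ?p ?S {} ?E {} ?i y) = y"
      if y: "y \<in> carrier (homology_group ?p ?S)" for y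
    proof -
      have "hom_induced ?p ?S {} ?S {} (fold \<circ> ?i) = hom_induced ?p ?S {} ?S {} e"
        by (rule hom_induced_eq) (auto simp: fold_def es sn)
      then show ?thesis using compE[OF ci cfold] e_id[OF y] by simp
    qed
    have fold_j: "hom_induced ?p ?E {} ?S {} fold (hom_induced ?p ?S {} ?E {} ?j y) = y"
      if y: "y \<in> carrier (homology_group ?p ?S)" for y
    proof -
      have "hom_induced ?p ?S {} ?S {} (fold \<circ> ?j) = hom_induced ?p ?S {} ?S {} e"
        by (rule hom_induced_eq) (auto simp: fold_def es sn)
      then show ?thesis using compE[OF cj cfold] e_id[OF y] by simp
    qed
    have "hom_induced ?p ?E {} ?S {} fold z = hom_induced ?p ?S {} ?S {} a x \<otimes>\<^bsub>homology_group ?p ?S\<^esub> hom_induced ?p ?S {} ?S {} b x"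
      by (subst fat_wedge_homology_generated[OF n z]) (simp add: hom_induced_carrier fold_i fold_j za zb)
    also have "hom_induced ?p ?E {} ?S {} fold z = hom_induced ?p ?S {} ?S {} c x"
    proof -
      have "hom_induced ?p ?S {} ?S {} (fold \<circ> ?F) = hom_induced ?p ?S {} ?S {} (e \<circ> c)"
        by (rule hom_induced_eq) (use abc in \<open>force simp: fold_def es sn\<close>)
      then show ?thesis unfolding z_def compE[OF cF cfold]
        using hom_induced_compose_empty[OF c e, of ?p] e_id[OF hom_induced_carrier] by simp
    qed
    finally have eq: "hom_induced ?p ?S {} ?S {} c x =
       hom_induced ?p ?S {} ?S {} a x \<otimes>\<^bsub>homology_group ?p ?S\<^esub> hom_induced ?p ?S {} ?S {} b x" .
    interpret S: group "homology_group ?p ?S" by simp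
    show "hom_induced ?p ?S {} ?S {} c x = x [^]\<^bsub>reduced_homology_group ?p ?S\<^esub> (Brouwer_degree2 n a + Brouwer_degree2 n b)"
      by (subst eq) (simp only: Brouwer_degree2[OF x] un group.int_pow_mult[OF group_relative_homology_group x'])
  qed
qed

section \<open>The degree of a compactly supported map from Euclidean space to the sphere\<close>

text \<open>
  Projection from the south pole, scaled so that the equator has norm 1.
\<close>

definition stereographic :: "nat \<Rightarrow> (nat \<Rightarrow> real) \<Rightarrow> nat \<Rightarrow> real" where
  "stereographic n s = (\<lambda>i. if i < n then s i / (1 + s n) else 0)"

text \<open>
  The one-point compactification of \<open>g\<close> under the identification of \<open>Rn n\<close> with the sphere without
  its south pole. It is continuous when \<open>g\<close> is the base point far away.
\<close>

definition sphere_extension :: "nat \<Rightarrow> ((nat \<Rightarrow> real) \<Rightarrow> nat \<Rightarrow> real) \<Rightarrow> (nat \<Rightarrow> real) \<Rightarrow> nat \<Rightarrow> real" where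
  "sphere_extension n g s = (if s = south n then south n else g (stereographic n s))"

definition compactly_supported :: "nat \<Rightarrow> ((nat \<Rightarrow> real) \<Rightarrow> nat \<Rightarrow> real) \<Rightarrow> bool" where
  "compactly_supported n g \<longleftrightarrow> continuous_map (Euclidean_space n) (nsphere n) g \<and>
     (\<exists>R. \<forall>x\<in>topspace (Euclidean_space n). (\<exists>i<n. R < \<bar>x i\<bar>) \<longrightarrow> g x = south n)"

definition cs_degree :: "nat \<Rightarrow> ((nat \<Rightarrow> real) \<Rightarrow> nat \<Rightarrow> real) \<Rightarrow> int" where
  "cs_degree n g = Brouwer_degree2 n (sphere_extension n g)"

lemma stereographic_in: "stereographic n s \<in> topspace (Euclidean_space n)"
  by (simp add: stereographic_def topspace_Euclidean_space)

lemma nsphere_last_gt: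
  assumes "s \<in> topspace (nsphere n)" "s \<noteq> south n" shows "s n > -1"
  using nsphere_abs_le_1[OF assms(1), of n] nsphere_eq_south_iff[OF assms(1)] assms(2) by auto

lemma sum_stereographic:
  assumes "s \<in> topspace (nsphere n)" "s \<noteq> south n"
  shows "(\<Sum>i<n. (stereographic n s i)\<^sup>2) = (1 - s n) / (1 + s n)"
proof -
  have "s n > -1" by (rule nsphere_last_gt[OF assms])
  have "(\<Sum>i<n. (s i)\<^sup>2) = 1 - (s n)\<^sup>2"
    using assms(1) by (simp add: topspace_nsphere flip: lessThan_Suc_atMost)
  moreover have "(\<Sum>i<n. (stereographic n s i)\<^sup>2) = (\<Sum>i<n. (s i)\<^sup>2) / (1 + s n)\<^sup>2"
    by (simp add: stereographic_def power_divide sum_divide_distrib)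
  ultimately have "(\<Sum>i<n. (stereographic n s i)\<^sup>2) = ((1 - s n) * (1 + s n)) / ((1 + s n) * (1 + s n))"
    by (simp add: power2_eq_square algebra_simps)
  then show ?thesis using \<open>s n > -1\<close> by simp
qed

text \<open>
  The height bound comes from \<open>sum_stereographic\<close>: near the south pole the squared norm of the
  projection exceeds \<open>n R^2\<close>, and then some coordinate exceeds \<open>R\<close>.
\<close>

lemma stereographic_large_near_south:
  assumes "s \<in> topspace (nsphere n)" "s \<noteq> south n" "s n \<le> -1 + 1 / (real n * R\<^sup>2 + 1)"
  shows "\<exists>i<n. R < \<bar>stereographic n s i\<bar>"
proof (rule ccontr)
  assume "\<not> ?thesis"
  then have "(stereographic n s i)\<^sup>2 \<le> R\<^sup>2" if "i < n" for i
    using that by (metis abs_le_square_iff abs_ge_self not_le order_trans)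
  then have "(\<Sum>i<n. (stereographic n s i)\<^sup>2) \<le> (\<Sum>i<n. R\<^sup>2)" by (intro sum_mono) auto
  then have le: "(1 - s n) / (1 + s n) \<le> real n * R\<^sup>2" using sum_stereographic[OF assms(1,2)] by simp
  have gt: "s n > -1" by (rule nsphere_last_gt[OF assms(1,2)])
  define D where "D = real n * R\<^sup>2 + 1"
  have D: "D \<ge> 1" unfolding D_def by simp
  have "(1 + s n) * D \<le> 1" using assms(3) D unfolding D_def[symmetric] by (simp add: field_simps)
  moreover have "1 - s n \<le> (D - 1) * (1 + s n)" using le gt unfolding D_def by (simp add: field_simps)
  ultimately show False using gt by (simp add: algebra_simps)
qed

text \<open>
  Near the south pole the extension is constant, since the projection is large there; away from
  it the projection is continuous. The parameter space \<open>T\<close> serves for homotopies.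
\<close>

lemma continuous_map_sphere_extension_param:
  assumes G: "continuous_map (prod_topology T (Euclidean_space n)) (nsphere n) G"
    and R: "\<And>t x. t \<in> topspace T \<Longrightarrow> x \<in> topspace (Euclidean_space n) \<Longrightarrow> \<exists>i<n. R < \<bar>x i\<bar> \<Longrightarrow> G (t, x) = south n"
  shows "continuous_map (prod_topology T (nsphere n)) (nsphere n)
     (\<lambda>z. sphere_extension n (\<lambda>x. G (fst z, x)) (snd z))"
proof -
  define \<eta> where "\<eta> = -1 + 1 / (real n * R\<^sup>2 + 1)"
  have "real n * R\<^sup>2 + 1 > 0" by (simp add: add_nonneg_pos)
  then have \<eta>: "\<eta> > -1" unfolding \<eta>_def by simp
  let ?P = "prod_topology T (nsphere n)"
  have c: "continuous_map ?P euclideanreal (\<lambda>z. snd z i)" for i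
    by (rule continuous_map_nsphere_coord[OF continuous_map_snd])
  have "continuous_map ?P (nsphere n) (\<lambda>z. if snd z n \<le> \<eta> then south n else G (fst z, stereographic n (snd z)))"
  proof (rule continuous_map_cases_le[OF c])
    let ?P' = "subtopology ?P {x \<in> topspace ?P. \<eta> \<le> snd x n}"
    have "continuous_map ?P' (Euclidean_space n) (\<lambda>z i. if i < n then snd z i / (1 + snd z n) else 0)"
      unfolding continuous_map_componentwise_Euclidean_space
      by (intro allI impI continuous_intros continuous_map_from_subtopology c) (use \<eta> in auto)
    then have "continuous_map ?P' (Euclidean_space n) (\<lambda>z. stereographic n (snd z))"
      by (simp add: stereographic_def)
    then have "continuous_map ?P' (prod_topology T (Euclidean_space n)) (\<lambda>z. (fst z, stereographic n (snd z)))"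
      by (intro continuous_map_pairedI) (auto intro: continuous_map_from_subtopology continuous_map_fst)
    from continuous_map_compose[OF this G]
    show "continuous_map ?P' (nsphere n) (\<lambda>z. G (fst z, stereographic n (snd z)))" by (simp add: o_def)
    fix z assume z: "z \<in> topspace ?P" "snd z n = \<eta>"
    then have "snd z \<noteq> south n" using \<eta> by (auto simp: south_def)
    then show "south n = G (fst z, stereographic n (snd z))"
      using stereographic_large_near_south[of "snd z" n R] z R[OF _ stereographic_in]
      unfolding \<eta>_def by auto
  qed (use south_in_nsphere in auto)
  then show ?thesis
  proof (rule continuous_map_eq)
    fix z assume z: "z \<in> topspace ?P"
    show "(if snd z n \<le> \<eta> then south n else G (fst z, stereographic n (snd z))) =
       sphere_extension n (\<lambda>x. G (fst z, x)) (snd z)"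
    proof (cases "snd z = south n")
      case True
      then show ?thesis using \<eta> by (simp add: sphere_extension_def south_def)
    next
      case False
      then show ?thesis
        using stereographic_large_near_south[of "snd z" n R] z R[OF _ stereographic_in, of "fst z" "snd z"]
        unfolding \<eta>_def by (auto simp: sphere_extension_def)
    qed
  qed
qed

text \<open>
  The bound \<open>R\<close> has to be uniform in \<open>t\<close>; otherwise the homotopy need not extend to infinity.
\<close>

lemma compactly_supported_homotopy:
  assumes G: "continuous_map (prod_topology (top_of_set {0..1}) (Euclidean_space n)) (nsphere n) G"
    and R: "\<And>t x. 0 \<le> t \<Longrightarrow> t \<le> 1 \<Longrightarrow> x \<in> topspace (Euclidean_space n) \<Longrightarrow> \<exists>i<n. R < \<bar>x i\<bar> \<Longrightarrow> G (t::real, x) = south n"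
  shows "compactly_supported n (\<lambda>x. G (0, x))" "compactly_supported n (\<lambda>x. G (1, x))"
    "cs_degree n (\<lambda>x. G (0, x)) = cs_degree n (\<lambda>x. G (1, x))"
proof -
  have "continuous_map (Euclidean_space n) (prod_topology (top_of_set {0..1::real}) (Euclidean_space n)) (\<lambda>x. (t, x))"
    if "t \<in> {0..1}" for t using that by (auto intro: continuous_map_pairedI)
  from continuous_map_compose[OF this G, unfolded o_def]
  show "compactly_supported n (\<lambda>x. G (0, x))" "compactly_supported n (\<lambda>x. G (1, x))"
    unfolding compactly_supported_def
    by (auto intro!: exI[of _ R] R)
  have "homotopic_with (\<lambda>h. True) (nsphere n) (nsphere n)
      (sphere_extension n (\<lambda>x. G (0, x))) (sphere_extension n (\<lambda>x. G (1, x)))"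
    using continuous_map_sphere_extension_param[where R = R, OF G] R
    by (subst homotopic_with) (simp, intro exI[of _ "\<lambda>z. sphere_extension n (\<lambda>x. G (fst z, x)) (snd z)"], simp)
  then show "cs_degree n (\<lambda>x. G (0, x)) = cs_degree n (\<lambda>x. G (1, x))"
    unfolding cs_degree_def by (rule Brouwer_degree2_homotopic)
qed

lemma continuous_map_sphere_extension:
  assumes "compactly_supported n g"
  shows "continuous_map (nsphere n) (nsphere n) (sphere_extension n g)"
proof -
  obtain R where g: "continuous_map (Euclidean_space n) (nsphere n) g"
    and R: "\<forall>x\<in>topspace (Euclidean_space n). (\<exists>i<n. R < \<bar>x i\<bar>) \<longrightarrow> g x = south n"
    using assms unfolding compactly_supported_def by blast
  let ?T = "top_of_set {0::real}"
  have "continuous_map (prod_topology ?T (Euclidean_space n)) (nsphere n) (g \<circ> snd)"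
    by (rule continuous_map_compose[OF continuous_map_snd g])
  then have "continuous_map (prod_topology ?T (nsphere n)) (nsphere n)
     (\<lambda>z. sphere_extension n (\<lambda>x. (g \<circ> snd) (fst z, x)) (snd z))"
    by (rule continuous_map_sphere_extension_param[where R = R]) (use R in auto)
  note G = this
  have P: "continuous_map (nsphere n) (prod_topology ?T (nsphere n)) (\<lambda>s. (0, s))"
    by (auto intro: continuous_map_pairedI)
  show ?thesis
    using continuous_map_compose[OF P G] by (simp add: o_def)
qed

lemma cs_degree_add:
  assumes "n \<ge> 2" "compactly_supported n a" "compactly_supported n b" "compactly_supported n c"
    and "\<And>x. x \<in> topspace (Euclidean_space n) \<Longrightarrow> a x = south n \<and> c x = b x \<or> b x = south n \<and> c x = a x"
  shows "cs_degree n c = cs_degree n a + cs_degree n b"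
  unfolding cs_degree_def
  by (rule Brouwer_degree2_wedge_sum[OF assms(1)])
     (use assms continuous_map_sphere_extension stereographic_in in \<open>auto simp: sphere_extension_def\<close>)

lemma cs_degree_not_north:
  assumes "compactly_supported n g" "\<And>x. x \<in> topspace (Euclidean_space n) \<Longrightarrow> g x \<noteq> north n"
  shows "cs_degree n g = 0"
proof -
  have "south n n \<noteq> north n n" by (simp add: north_def south_def)
  then have "north n \<notin> sphere_extension n g ` topspace (nsphere n)"
    using assms(2)[OF stereographic_in] by (auto simp: sphere_extension_def split: if_splits) metis+
  then show ?thesis
    unfolding cs_degree_def
    using north_in_nsphere by (intro Brouwer_degree2_nonsurjective continuous_map_sphere_extension assms) blast
qed

text \<open>
  The straight-line homotopy from the identity to \<open>f\<close> moves points by at most \<open>M\<close>, so composing it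
  with \<open>g\<close> gives a homotopy of uniformly bounded support.
\<close>

lemma cs_degree_compose_displacement:
  assumes g: "compactly_supported n g"
    and f: "continuous_map (Euclidean_space n) (Euclidean_space n) f"
    and M: "\<And>x i. x \<in> topspace (Euclidean_space n) \<Longrightarrow> i < n \<Longrightarrow> \<bar>f x i - x i\<bar> \<le> M"
  shows "cs_degree n (\<lambda>x. g (f x)) = cs_degree n g" "compactly_supported n (\<lambda>x. g (f x))"
proof -
  obtain R where gc: "continuous_map (Euclidean_space n) (nsphere n) g"
    and R: "\<forall>x\<in>topspace (Euclidean_space n). (\<exists>i<n. R < \<bar>x i\<bar>) \<longrightarrow> g x = south n"
    using g unfolding compactly_supported_def by blast
  let ?P = "prod_topology (top_of_set {0..1::real}) (Euclidean_space n)"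
  let ?H = "\<lambda>z i. if i < n then snd z i + fst z * (f (snd z) i - snd z i) else 0"
  let ?G = "\<lambda>z. g (?H z)"
  have c: "continuous_map (Euclidean_space n) euclideanreal (\<lambda>x. x i)" for i
    unfolding Euclidean_space_def
    by (intro continuous_map_from_subtopology continuous_map_product_projection) auto
  have cs: "continuous_map ?P euclideanreal (\<lambda>z. snd z i)" for i
    using continuous_map_compose[OF continuous_map_snd c, unfolded o_def] .
  have cf: "continuous_map ?P euclideanreal (\<lambda>z. f (snd z) i)" for i
    using continuous_map_compose[OF continuous_map_compose[OF continuous_map_snd f] c, unfolded o_def] .
  have ct: "continuous_map ?P euclideanreal fst"
    using continuous_map_fst continuous_map_into_fulltopology by blast
  have "continuous_map ?P (Euclidean_space n) ?H"
    unfolding continuous_map_componentwise_Euclidean_space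
    by (intro allI impI continuous_intros cs cf ct)
  from continuous_map_compose[OF this gc]
  have G: "continuous_map ?P (nsphere n) ?G" by (simp add: o_def)
  have supp: "?G (t, x) = south n" if t: "0 \<le> t" "t \<le> 1" and x: "x \<in> topspace (Euclidean_space n)" "\<exists>i<n. R + M < \<bar>x i\<bar>" for t x
  proof -
    obtain i where i: "i < n" "R + M < \<bar>x i\<bar>" using x(2) by blast
    have "\<bar>t * (f x i - x i)\<bar> \<le> 1 * M"
      unfolding abs_mult using t M[OF x(1) i(1)] by (intro mult_mono) auto
    then have "\<exists>i<n. R < \<bar>?H (t, x) i\<bar>" using i by (intro exI[of _ i]) auto
    moreover have "?H (t, x) \<in> topspace (Euclidean_space n)" by (simp add: topspace_Euclidean_space)
    ultimately show ?thesis using bspec[OF R, of "?H (t, x)"] by blast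
  qed
  have z: "g (\<lambda>i. if i < n then x i + 0 * (f x i - x i) else 0) = g x"
       "g (\<lambda>i. if i < n then x i + 1 * (f x i - x i) else 0) = g (f x)"
    if x: "x \<in> topspace (Euclidean_space n)" for x
  proof -
    have "f x \<in> topspace (Euclidean_space n)" using f x by (auto simp: continuous_map_def)
    then have "(\<lambda>i. if i < n then x i + 0 * (f x i - x i) else 0) = x"
       "(\<lambda>i. if i < n then x i + 1 * (f x i - x i) else 0) = f x"
      using x by (auto simp: topspace_Euclidean_space fun_eq_iff)
    then show "g (\<lambda>i. if i < n then x i + 0 * (f x i - x i) else 0) = g x"
       "g (\<lambda>i. if i < n then x i + 1 * (f x i - x i) else 0) = g (f x)" by simp_all
  qed
  have ext: "cs_degree n (\<lambda>x. h x) = cs_degree n h'" if "\<And>x. x \<in> topspace (Euclidean_space n) \<Longrightarrow> h x = h' x" for h h'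
    unfolding cs_degree_def
    by (rule Brouwer_degree2_eq) (use that stereographic_in in \<open>auto simp: sphere_extension_def\<close>)
  have "cs_degree n (\<lambda>x. g (f x)) = cs_degree n (\<lambda>x. ?G (1, x))"
    by (rule ext) (simp only: fst_conv snd_conv z)
  also have "\<dots> = cs_degree n (\<lambda>x. ?G (0, x))"
    by (rule compactly_supported_homotopy(3)[OF G supp, symmetric])
  also have "\<dots> = cs_degree n g"
    by (rule ext) (simp only: fst_conv snd_conv z)
  finally show "cs_degree n (\<lambda>x. g (f x)) = cs_degree n g" .
  have "continuous_map (Euclidean_space n) (nsphere n) (\<lambda>x. g (f x))"
    using continuous_map_compose[OF f gc] by (simp add: o_def)
  moreover have "g (f x) = south n" if "x \<in> topspace (Euclidean_space n)" "\<exists>i<n. R + M < \<bar>x i\<bar>" for x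
    using supp[of 1 x] z(2)[of x] that by (simp only: fst_conv snd_conv zero_le_one order_refl)
  ultimately show "compactly_supported n (\<lambda>x. g (f x))"
    unfolding compactly_supported_def by blast
qed

lemma cs_degree_collapse:
  assumes g: "compactly_supported n g" and \<nu>: "-1 \<le> \<nu>" "\<nu> < 1"
  shows "compactly_supported n (\<lambda>x. sphere_collapse n \<nu> (g x))"
    "cs_degree n (\<lambda>x. sphere_collapse n \<nu> (g x)) = cs_degree n g"
proof -
  let ?e = "sphere_collapse n \<nu>"
  have s: "?e (south n) = south n"
    by (rule sphere_collapse_south) (use \<nu> in \<open>auto simp: south_def\<close>)
  note e = continuous_map_sphere_collapse[OF \<nu>, of n]
  show "compactly_supported n (\<lambda>x. ?e (g x))"
    using g s continuous_map_compose[OF _ e] unfolding compactly_supported_def o_def by force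
  have "sphere_extension n (\<lambda>x. ?e (g x)) = ?e \<circ> sphere_extension n g"
    using s by (auto simp: sphere_extension_def)
  moreover have "Brouwer_degree2 n ?e = 1"
    using Brouwer_degree2_homotopic[OF homotopic_sphere_collapse_id[OF \<nu>]] by simp
  ultimately show "cs_degree n (\<lambda>x. ?e (g x)) = cs_degree n g"
    unfolding cs_degree_def
    using Brouwer_degree2_compose[OF continuous_map_sphere_extension[OF g] e] by simp
qed

text \<open>
  The inverse of the stereographic projection followed by the collapse of the lower half-sphere: a
  map that is the south pole outside the unit ball and takes the value north only at the origin.
\<close>

definition bump :: "nat \<Rightarrow> (nat \<Rightarrow> real) \<Rightarrow> nat \<Rightarrow> real" where
  "bump n y = sphere_collapse n 0 (sphere_normalize n
     (\<lambda>i. if i < n then 2 * y i else 1 - (\<Sum>j<n. (y j)\<^sup>2)))"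

lemma bump_aux: "\<exists>i\<le>n::nat. (if i < n then 2 * y i else 1 - (\<Sum>j<n. (y j)\<^sup>2)) \<noteq> (0::real)"
proof (rule ccontr)
  assume "\<not> ?thesis"
  then have *: "(if i < n then 2 * y i else 1 - (\<Sum>j<n. (y j)\<^sup>2)) = 0" if "i \<le> n" for i
    using that by blast
  have "y i = 0" if "i < n" for i using *[of i] that by simp
  then have "(\<Sum>j<n. (y j)\<^sup>2) = 0" by simp
  then show False using *[of n] by simp
qed

lemma continuous_map_bump:
  assumes "\<And>i. i < n \<Longrightarrow> continuous_map X euclideanreal (\<lambda>x. f x i)"
  shows "continuous_map X (nsphere n) (\<lambda>x. bump n (f x))"
proof -
  have "continuous_map X (nsphere n) (\<lambda>x. sphere_normalize n
     (\<lambda>i. if i < n then 2 * f x i else 1 - (\<Sum>j<n. (f x j)\<^sup>2)))"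
  proof (rule continuous_map_sphere_normalize)
    fix i show "continuous_map X euclideanreal (\<lambda>x. if i < n then 2 * f x i else 1 - (\<Sum>j<n. (f x j)\<^sup>2))"
      using assms by (cases "i < n") (auto intro!: continuous_intros)
  qed (rule bump_aux)
  from continuous_map_compose[OF this continuous_map_sphere_collapse[of 0]]
  show ?thesis by (simp add: o_def bump_def)
qed

lemma bump_far:
  assumes "i < n" "\<bar>y i\<bar> \<ge> 1" shows "bump n y = south n"
proof -
  have "1 \<le> (y i)\<^sup>2" using assms(2) by (simp add: abs_le_square_iff[of 1, simplified])
  also have "\<dots> \<le> (\<Sum>j<n. (y j)\<^sup>2)" using assms(1) by (intro member_le_sum) auto
  finally have "1 - (\<Sum>j<n. (y j)\<^sup>2) \<le> 0" by simp
  then show ?thesis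
    unfolding bump_def
    by (intro sphere_collapse_south) (auto simp: sphere_normalize_def intro!: divide_nonpos_nonneg sum_nonneg)
qed

lemma bump_eq_north:
  assumes "bump n y = north n" "i < n" shows "y i = 0"
proof -
  let ?w = "\<lambda>i. if i < n then 2 * y i else 1 - (\<Sum>j<n. (y j)\<^sup>2)"
  obtain j where j: "j \<le> n" "?w j \<noteq> 0" using bump_aux[of n y] by blast
  have "sphere_normalize n ?w \<in> topspace (nsphere n)"
    by (rule sphere_normalize_in[where x = ?w, OF j])
  then have "sphere_normalize n ?w = north n"
    by (rule sphere_collapse_eq_north[of _ n 0]) (use assms(1) in \<open>simp_all add: bump_def\<close>)
  then have "sphere_normalize n ?w i = 0" using assms(2) by (simp add: north_def)
  moreover have "(\<Sum>j\<le>n. (?w j)\<^sup>2) > 0" by (rule sum_pos2[of _ j]) (use j in simp_all)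
  ultimately have "?w i = 0"
    using assms(2) by (simp add: sphere_normalize_def split: if_splits)
  then show ?thesis using assms(2) by simp
qed

lemma sphere_normalize_scale:
  assumes "c > 0" shows "sphere_normalize n (\<lambda>i. c * x i) = sphere_normalize n x"
  using assms by (auto simp: sphere_normalize_def power_mult_distrib real_sqrt_mult fun_eq_iff simp flip: sum_distrib_left)

text \<open>
  The extension of \<open>bump n\<close> to the sphere is the collapse of the lower half-sphere itself.
\<close>

lemma cs_degree_bump: "cs_degree n (bump n) = 1"
proof -
  have "sphere_extension n (bump n) s = sphere_collapse n 0 s" if s: "s \<in> topspace (nsphere n)" for s
  proof (cases "s = south n")
    case True
    then show ?thesis by (simp add: sphere_extension_def sphere_collapse_south south_def)
  next
    case False
    have gt: "s n > -1" by (rule nsphere_last_gt[OF s False])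
    have "1 - (1 - s n) / (1 + s n) = 2 / (1 + s n) * s n" using gt by (simp add: field_simps)
    then have "sphere_normalize n (\<lambda>i. if i < n then 2 * stereographic n s i else 1 - (\<Sum>j<n. (stereographic n s j)\<^sup>2)) i
        = sphere_normalize n (\<lambda>i. 2 / (1 + s n) * s i) i" for i
      using sum_stereographic[OF s False]
      unfolding sphere_normalize_def stereographic_def
      by (auto intro!: arg_cong2[where f = "(/)"] arg_cong[where f = sqrt] sum.cong)
    then have "sphere_normalize n (\<lambda>i. if i < n then 2 * stereographic n s i else 1 - (\<Sum>j<n. (stereographic n s j)\<^sup>2))
        = sphere_normalize n (\<lambda>i. 2 / (1 + s n) * s i)" by blast
    also have "\<dots> = s" using gt s by (subst sphere_normalize_scale) (auto simp: sphere_normalize_id)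
    finally show ?thesis using False by (simp add: sphere_extension_def bump_def)
  qed
  then have "cs_degree n (bump n) = Brouwer_degree2 n (sphere_collapse n 0)"
    unfolding cs_degree_def by (rule Brouwer_degree2_eq)
  also have "\<dots> = 1"
    using Brouwer_degree2_homotopic[OF homotopic_sphere_collapse_id[of 0 n]] by simp
  finally show ?thesis .
qed

section \<open>Perturbing a map off the origin along the frontier of a cube\<close>

lemma card_PiE_fixed_coordinate:
  assumes "finite I" "finite B" "i \<in> I"
  shows "card {s \<in> I \<rightarrow>\<^sub>E B. s i = v} \<le> card B ^ (card I - 1)"
proof -
  have "{s \<in> I \<rightarrow>\<^sub>E B. s i = v} \<subseteq> (\<lambda>s. s(i := v)) ` ((I - {i}) \<rightarrow>\<^sub>E B)"
  proof
    fix s assume s: "s \<in> {s \<in> I \<rightarrow>\<^sub>E B. s i = v}"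
    then have "s = (s(i := undefined))(i := v)" by auto
    moreover have "s(i := undefined) \<in> (I - {i}) \<rightarrow>\<^sub>E B"
      using s by (auto simp: PiE_iff extensional_def)
    ultimately show "s \<in> (\<lambda>s. s(i := v)) ` ((I - {i}) \<rightarrow>\<^sub>E B)" by blast
  qed
  then have "card {s \<in> I \<rightarrow>\<^sub>E B. s i = v} \<le> card ((I - {i}) \<rightarrow>\<^sub>E B)"
    by (rule surj_card_le[rotated]) (use assms in \<open>auto intro: finite_PiE\<close>)
  also have "\<dots> = card B ^ (card I - 1)"
    using assms by (simp add: card_PiE)
  finally show ?thesis .
qed

lemma same_floor_close:
  fixes x y :: real
  assumes "nat \<lfloor>x\<rfloor> = nat \<lfloor>y\<rfloor>" "0 \<le> x" "0 \<le> y"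
  shows "\<bar>x - y\<bar> \<le> 1"
proof -
  have "\<lfloor>x\<rfloor> = \<lfloor>y\<rfloor>" using assms by (metis eq_nat_nat_iff zero_le_floor)
  then show ?thesis by linarith
qed

text \<open>
  A dimension count by the pigeonhole principle. Subdivide the cube into \<open>N^n\<close> cells; the frontier
  meets about \<open>2 n N^(n-1)\<close> of them, and \<open>P\<close> maps each to a set so small that it contains at most one
  point of the grid of mesh \<open>\<epsilon>/M\<close>. If \<open>N\<close> is a fixed multiple of \<open>M\<close> and \<open>M\<close> is large, the \<open>M^n\<close> grid
  points cannot all be hit.
\<close>

lemma lipschitz_image_of_cube_frontier_avoids_point:
  fixes P :: "(nat \<Rightarrow> real) \<Rightarrow> nat \<Rightarrow> real" and a :: "nat \<Rightarrow> real"
  assumes n: "n \<ge> 1" and r: "r > 0" and L: "L \<ge> 0" and \<epsilon>: "\<epsilon> > 0"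
    and F: "\<And>x. x \<in> F \<Longrightarrow> (\<forall>i<n. \<bar>x i - a i\<bar> \<le> r) \<and> (\<exists>i<n. \<bar>x i - a i\<bar> = r)"
    and P: "\<And>x y d i. x \<in> F \<Longrightarrow> y \<in> F \<Longrightarrow> (\<forall>j<n. \<bar>x j - y j\<bar> \<le> d) \<Longrightarrow> i < n \<Longrightarrow> \<bar>P x i - P y i\<bar> \<le> L * d"
  obtains c where "\<And>i. i < n \<Longrightarrow> 0 \<le> c i \<and> c i \<le> \<epsilon>" "\<And>x. x \<in> F \<Longrightarrow> \<exists>i<n. P x i \<noteq> c i"
proof -
  \<comment> \<open>\<open>Q\<close> makes images of cells smaller than the grid mesh \<open>\<epsilon>/M\<close>; \<open>M\<close> then beats the cell count.\<close>
  obtain Q :: nat where Q: "real Q > 2 * r * L / \<epsilon>" using reals_Archimedean2 by blast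
  define M where "M = 2 * n * (Q + 1) ^ (n - 1) + 1"
  define N where "N = M * Q"
  have Q0: "Q > 0"
  proof -
    have "2 * r * L / \<epsilon> \<ge> 0" using r L \<epsilon> by simp
    then show ?thesis using Q by (metis le_less_trans of_nat_0_less_iff)
  qed
  have M0: "M > 0" by (simp add: M_def)
  have N0: "N > 0" using Q0 M0 by (simp add: N_def)
  let ?C = "{..<n} \<rightarrow>\<^sub>E {..<M}"
  define pt where "pt = (\<lambda>(t::nat\<Rightarrow>nat) i. \<epsilon> * real (t i) / real M)"
  define cell where "cell = (\<lambda>x. \<lambda>i\<in>{..<n}. nat \<lfloor>(x i - a i + r) / (2 * r) * real N\<rfloor>)"
  define Z where "Z = (\<Union>i<n. {s \<in> {..<n} \<rightarrow>\<^sub>E {..N}. s i = 0} \<union> {s \<in> {..<n} \<rightarrow>\<^sub>E {..N}. s i = N})"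
  have cardZ: "card Z \<le> 2 * n * (N + 1) ^ (n - 1)"
  proof -
    have "card Z \<le> (\<Sum>i<n. card ({s \<in> {..<n} \<rightarrow>\<^sub>E {..N}. s i = 0} \<union> {s \<in> {..<n} \<rightarrow>\<^sub>E {..N}. s i = N}))"
      unfolding Z_def by (rule card_UN_le) simp
    also have "\<dots> \<le> (\<Sum>i<n. 2 * (N + 1) ^ (n - 1))"
    proof (rule sum_mono)
      fix i assume i: "i \<in> {..<n}"
      have "card {s \<in> {..<n} \<rightarrow>\<^sub>E {..N}. s i = v} \<le> (N + 1) ^ (n - 1)" for v
        using card_PiE_fixed_coordinate[of "{..<n}" "{..N}" i v] i by simp
      from add_mono[OF this[of 0] this[of N]]
      show "card ({s \<in> {..<n} \<rightarrow>\<^sub>E {..N}. s i = 0} \<union> {s \<in> {..<n} \<rightarrow>\<^sub>E {..N}. s i = N}) \<le> 2 * (N + 1) ^ (n - 1)"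
        by (intro order_trans[OF card_Un_le]) simp
    qed
    finally show ?thesis by (simp add: mult.assoc mult.left_commute)
  qed
  have "\<exists>t\<in>?C. \<forall>x\<in>F. \<exists>i<n. P x i \<noteq> pt t i"
  proof (rule ccontr)
    assume "\<not> ?thesis"
    then have "\<forall>t\<in>?C. \<exists>x\<in>F. \<forall>i<n. P x i = pt t i" by blast
    then obtain w where w: "\<And>t. t \<in> ?C \<Longrightarrow> w t \<in> F" "\<And>t i. t \<in> ?C \<Longrightarrow> i < n \<Longrightarrow> P (w t) i = pt t i"
      by metis
    have nn: "0 \<le> (x i - a i + r) / (2 * r) * real N" if "x \<in> F" "i < n" for x i
      using F[OF that(1)] that(2) r by (auto intro!: mult_nonneg_nonneg divide_nonneg_pos simp: abs_le_iff)
    have inj: "inj_on (\<lambda>t. cell (w t)) ?C"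
    proof (rule inj_onI)
      fix t t' assume t: "t \<in> ?C" "t' \<in> ?C" and eq: "cell (w t) = cell (w t')"
      have close: "\<bar>w t j - w t' j\<bar> \<le> 2 * r / real N" if j: "j < n" for j
      proof -
        have "nat \<lfloor>(w t j - a j + r) / (2 * r) * real N\<rfloor> = nat \<lfloor>(w t' j - a j + r) / (2 * r) * real N\<rfloor>"
          using fun_cong[OF eq, of j] j by (simp add: cell_def)
        from same_floor_close[OF this nn[OF w(1)[OF t(1)] j] nn[OF w(1)[OF t(2)] j]]
        have "\<bar>(w t j - a j + r) / (2 * r) * real N - (w t' j - a j + r) / (2 * r) * real N\<bar> \<le> 1" .
        also have "(w t j - a j + r) / (2 * r) * real N - (w t' j - a j + r) / (2 * r) * real N
           = (w t j - w t' j) * (real N / (2 * r))"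
          by (simp add: diff_divide_distrib add_divide_distrib algebra_simps)
        finally have "\<bar>(w t j - w t' j) * (real N / (2 * r))\<bar> \<le> 1" .
        then have "\<bar>w t j - w t' j\<bar> * (real N / (2 * r)) \<le> 1"
          using r by (simp add: abs_mult)
        then show ?thesis using r N0 by (simp add: field_simps)
      qed
      show "t = t'"
      proof (rule PiE_ext[OF t])
        fix i assume "i \<in> {..<n}"
        then have i: "i < n" by simp
        have "\<bar>P (w t) i - P (w t') i\<bar> \<le> L * (2 * r / real N)"
          by (rule P[OF w(1)[OF t(1)] w(1)[OF t(2)] _ i]) (use close in blast)
        moreover have "L * (2 * r / real N) < \<epsilon> / real M"
          using Q Q0 M0 \<epsilon> by (simp add: N_def field_simps)
        moreover have "P (w t) i - P (w t') i = \<epsilon> / real M * (real (t i) - real (t' i))"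
          using w(2)[OF t(1) i] w(2)[OF t(2) i] by (simp add: pt_def diff_divide_distrib right_diff_distrib)
        ultimately have "\<epsilon> / real M * \<bar>real (t i) - real (t' i)\<bar> < \<epsilon> / real M * 1"
          using \<epsilon> M0 by (simp add: abs_mult)
        then have "\<bar>real (t i) - real (t' i)\<bar> < 1"
          using \<epsilon> M0 by (subst (asm) mult_less_cancel_left_pos) auto
        then show "t i = t' i" by linarith
      qed
    qed
    have sub: "(\<lambda>t. cell (w t)) ` ?C \<subseteq> Z"
    proof clarify
      fix t assume t: "t \<in> ?C"
      let ?x = "w t"
      have x: "?x \<in> F" using w t by blast
      have "cell ?x \<in> {..<n} \<rightarrow>\<^sub>E {..N}"
      proof -
        have "nat \<lfloor>(?x j - a j + r) / (2 * r) * real N\<rfloor> \<le> N" if j: "j < n" for j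
        proof -
          have "\<bar>?x j - a j\<bar> \<le> r" using F[OF x] j by blast
          then have "(?x j - a j + r) / (2 * r) \<le> 1" using r by (simp add: abs_le_iff)
          then have "(?x j - a j + r) / (2 * r) * real N \<le> real N"
            by (metis mult_right_mono mult_1 of_nat_0_le_iff)
          then show ?thesis by linarith
        qed
        then show ?thesis by (auto simp: cell_def)
      qed
      moreover obtain i where i: "i < n" "\<bar>?x i - a i\<bar> = r" using F[OF x] by blast
      then have "?x i - a i = r \<or> ?x i - a i = -r" by linarith
      then have "cell ?x i = 0 \<or> cell ?x i = N"
        using i r by (auto simp: cell_def)
      ultimately show "cell ?x \<in> Z" unfolding Z_def using i by blast
    qed
    have "Z \<subseteq> {..<n} \<rightarrow>\<^sub>E {..N}" unfolding Z_def by blast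
    then have "finite Z" by (rule finite_subset) (simp add: finite_PiE)
    then have "card ?C \<le> card Z" using card_inj_on_le[OF inj sub] by blast
    then have "M ^ n \<le> 2 * n * (N + 1) ^ (n - 1)" using cardZ by (simp add: card_PiE)
    also have "\<dots> \<le> 2 * n * (M * (Q + 1)) ^ (n - 1)"
      using M0 by (intro mult_left_mono power_mono) (auto simp: N_def)
    also have "\<dots> = (M - 1) * M ^ (n - 1)"
      unfolding power_mult_distrib by (simp add: M_def)
    also have "\<dots> < M * M ^ (n - 1)" using M0 by simp
    also have "\<dots> = M ^ n" using n by (metis Suc_diff_1 less_le_trans power_Suc zero_less_one)
    finally show False by simp
  qed
  then obtain t where t: "t \<in> ?C" "\<forall>x\<in>F. \<exists>i<n. P x i \<noteq> pt t i" by blast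
  show thesis
  proof (rule that[of "pt t"])
    fix i assume i: "i < n"
    then have "t i \<le> M" using t(1) by (force simp: PiE_iff)
    then have "real (t i) / real M \<le> 1" using M0 by simp
    then have "\<epsilon> * (real (t i) / real M) \<le> \<epsilon> * 1" using \<epsilon> by (intro mult_left_mono) auto
    then show "0 \<le> pt t i \<and> pt t i \<le> \<epsilon>" using \<epsilon> by (simp add: pt_def)
  qed (use t(2) in blast)
qed

text \<open>
  The functions that are Lipschitz for the maximum distance form an algebra that separates points,
  so the Stone-Weierstrass theorem applies.
\<close>

lemma lipschitz_approximation:
  fixes u :: "(nat \<Rightarrow> real) \<Rightarrow> real" and K :: "(nat \<Rightarrow> real) set"
  assumes K: "compact K" and sep: "\<And>x y. x \<in> K \<Longrightarrow> y \<in> K \<Longrightarrow> x \<noteq> y \<Longrightarrow> \<exists>i<n. x i \<noteq> y i"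
    and u: "continuous_on K u" and \<epsilon>: "\<epsilon> > 0"
  obtains v L where "continuous_on K v" "L \<ge> 0" "\<And>x. x \<in> K \<Longrightarrow> \<bar>v x - u x\<bar> < \<epsilon>"
    "\<And>x y d. x \<in> K \<Longrightarrow> y \<in> K \<Longrightarrow> (\<forall>j<n. \<bar>x j - y j\<bar> \<le> d) \<Longrightarrow> \<bar>v x - v y\<bar> \<le> L * d"
proof -
  define lip where "lip = (\<lambda>(f::(nat \<Rightarrow> real) \<Rightarrow> real) L. \<forall>x\<in>K. \<forall>y\<in>K. \<forall>d\<ge>0. (\<forall>j<n. \<bar>x j - y j\<bar> \<le> d) \<longrightarrow> \<bar>f x - f y\<bar> \<le> L * d)"
  define R where "R = {f. continuous_on K f \<and> (\<exists>L\<ge>0. lip f L)}"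
  interpret function_ring_on R K
  proof
    show "compact K" by (rule K)
    show "continuous_on K f" if "f \<in> R" for f using that by (simp add: R_def)
    show "(\<lambda>x. f x + g x) \<in> R" if "f \<in> R" "g \<in> R" for f g
    proof -
      have "\<exists>L\<ge>0. lip f L" "\<exists>L\<ge>0. lip g L" using that by (simp_all add: R_def)
      then obtain L L' where L1: "L \<ge> 0" "lip f L" and L2: "L' \<ge> 0" "lip g L'" by metis
      note L = L1 L2
      have "lip (\<lambda>x. f x + g x) (L + L')"
        unfolding lip_def
      proof (intro ballI allI impI)
        fix x y d assume "x \<in> K" "y \<in> K" "d \<ge> 0" "\<forall>j<n. \<bar>x j - y j\<bar> \<le> d"
        then have "\<bar>f x - f y\<bar> \<le> L * d" "\<bar>g x - g y\<bar> \<le> L' * d" using L unfolding lip_def by blast+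
        then show "\<bar>f x + g x - (f y + g y)\<bar> \<le> (L + L') * d" by (simp add: algebra_simps)
      qed
      then show ?thesis using that L by (auto simp: R_def intro!: continuous_intros exI[of _ "L + L'"])
    qed
    show "(\<lambda>x. f x * g x) \<in> R" if "f \<in> R" "g \<in> R" for f g
    proof -
      have "\<exists>L\<ge>0. lip f L" "\<exists>L\<ge>0. lip g L" using that by (simp_all add: R_def)
      then obtain L L' where L1: "L \<ge> 0" "lip f L" and L2: "L' \<ge> 0" "lip g L'" by metis
      note L = L1 L2
      have cf: "continuous_on K f" and cg: "continuous_on K g" using that by (auto simp: R_def)
      have "bounded (f ` K)" "bounded (g ` K)"
        by (auto intro!: compact_imp_bounded compact_continuous_image K cf cg)
      then obtain A B where AB: "\<And>x. x \<in> K \<Longrightarrow> \<bar>f x\<bar> \<le> A" "\<And>x. x \<in> K \<Longrightarrow> \<bar>g x\<bar> \<le> B"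
        by (auto simp: bounded_iff)
      have "lip (\<lambda>x. f x * g x) (\<bar>A\<bar> * L' + \<bar>B\<bar> * L)"
        unfolding lip_def
      proof (intro ballI allI impI)
        fix x y d assume xy: "x \<in> K" "y \<in> K" "d \<ge> 0" "\<forall>j<n. \<bar>x j - y j\<bar> \<le> d"
        then have l: "\<bar>f x - f y\<bar> \<le> L * d" "\<bar>g x - g y\<bar> \<le> L' * d" using L unfolding lip_def by blast+
        have "f x * g x - f y * g y = f x * (g x - g y) + (f x - f y) * g y" by (simp add: algebra_simps)
        also have "\<bar>\<dots>\<bar> \<le> \<bar>f x\<bar> * \<bar>g x - g y\<bar> + \<bar>f x - f y\<bar> * \<bar>g y\<bar>"
          by (metis abs_mult abs_triangle_ineq)
        also have "\<dots> \<le> \<bar>A\<bar> * (L' * d) + (L * d) * \<bar>B\<bar>"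
          using AB(1)[OF xy(1)] AB(2)[OF xy(2)] l by (intro add_mono mult_mono) auto
        finally show "\<bar>f x * g x - f y * g y\<bar> \<le> (\<bar>A\<bar> * L' + \<bar>B\<bar> * L) * d" by (simp add: algebra_simps)
      qed
      then show ?thesis using L cf cg by (auto simp: R_def intro!: continuous_intros exI[of _ "\<bar>A\<bar> * L' + \<bar>B\<bar> * L"])
    qed
    show "(\<lambda>_. c) \<in> R" for c
      by (auto simp: R_def lip_def intro!: exI[of _ 0])
    show "\<exists>f\<in>R. f x \<noteq> f y" if "x \<in> K" "y \<in> K" "x \<noteq> y" for x y
    proof -
      from sep[OF that] obtain i where i: "i < n" "x i \<noteq> y i" by blast
      have "continuous_on K (\<lambda>x::nat \<Rightarrow> real. x i)"
        by (rule continuous_on_subset[OF continuous_on_product_coordinates]) simp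
      moreover have "lip (\<lambda>x. x i) 1"
        unfolding lip_def mult_1 by (intro ballI allI impI) (use i(1) in blast)
      ultimately have "(\<lambda>x. x i) \<in> R"
        unfolding R_def by (metis (mono_tags, lifting) mem_Collect_eq zero_le_one)
      then show ?thesis using i(2) by (intro bexI[of _ "\<lambda>x. x i"])
    qed
  qed
  obtain v where v: "v \<in> R" "\<And>x. x \<in> K \<Longrightarrow> \<bar>u x - v x\<bar> < \<epsilon>"
    using Stone_Weierstrass_basic[OF u \<epsilon>] by blast
  then obtain L where L: "L \<ge> 0" "lip v L" and c: "continuous_on K v" by (auto simp: R_def)
  show thesis
  proof (cases "n = 0")
    case True
    then have "\<And>x y. x \<in> K \<Longrightarrow> y \<in> K \<Longrightarrow> x = y" using sep by blast
    then show ?thesis using that[of v 0] c v(2) by (metis abs_minus_commute abs_zero cancel_comm_monoid_add_class.diff_cancel mult_zero_left order_refl)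
  next
    case False
    show ?thesis
    proof (rule that[OF c L(1)])
      show "\<bar>v x - u x\<bar> < \<epsilon>" if "x \<in> K" for x using v(2)[OF that] by linarith
      fix x y d assume xy: "x \<in> K" "y \<in> K" "\<forall>j<n. \<bar>x j - y j\<bar> \<le> d"
      then have "d \<ge> 0" using False by (metis abs_ge_zero not_gr_zero order_trans)
      then show "\<bar>v x - v y\<bar> \<le> L * d" using L(2) xy unfolding lip_def by blast
    qed
  qed
qed

text \<open>
  Approximate \<open>u\<close> by a Lipschitz map and subtract a small vector that this approximation does not
  attain on the frontier.
\<close>

lemma perturb_nonzero_on_cube_frontier:
  fixes u :: "(nat \<Rightarrow> real) \<Rightarrow> nat \<Rightarrow> real" and K :: "(nat \<Rightarrow> real) set"
  assumes n: "n \<ge> 1" and r: "r > 0" and \<epsilon>: "\<epsilon> > 0"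
    and K: "compact K" "K \<subseteq> topspace (Euclidean_space n)"
    and u: "\<And>i. i < n \<Longrightarrow> continuous_on K (\<lambda>x. u x i)"
  obtains v where "\<And>i. i < n \<Longrightarrow> continuous_on K (\<lambda>x. v x i)"
    "\<And>x i. x \<in> K \<Longrightarrow> i < n \<Longrightarrow> \<bar>v x i - u x i\<bar> < \<epsilon>"
    "\<And>x. x \<in> K \<Longrightarrow> \<forall>i<n. \<bar>x i - a i\<bar> \<le> r \<Longrightarrow> \<exists>i<n. \<bar>x i - a i\<bar> = r \<Longrightarrow> \<exists>i<n. v x i \<noteq> 0"
proof -
  have sep: "\<exists>i<n. x i \<noteq> y i" if "x \<in> K" "y \<in> K" "x \<noteq> y" for x y
    using that K(2) by (auto simp: topspace_Euclidean_space fun_eq_iff subset_iff) (metis not_le)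
  have "\<exists>v L. continuous_on K v \<and> L \<ge> 0 \<and> (\<forall>x\<in>K. \<bar>v x - u x i\<bar> < \<epsilon> / 2) \<and>
     (\<forall>x y d. x \<in> K \<longrightarrow> y \<in> K \<longrightarrow> (\<forall>j<n. \<bar>x j - y j\<bar> \<le> d) \<longrightarrow> \<bar>v x - v y\<bar> \<le> L * d)" if "i < n" for i
  proof -
    obtain v L where "continuous_on K v" "L \<ge> 0" "\<And>x. x \<in> K \<Longrightarrow> \<bar>v x - u x i\<bar> < \<epsilon> / 2"
      "\<And>x y d. x \<in> K \<Longrightarrow> y \<in> K \<Longrightarrow> (\<forall>j<n. \<bar>x j - y j\<bar> \<le> d) \<Longrightarrow> \<bar>v x - v y\<bar> \<le> L * d"
      by (rule lipschitz_approximation[OF K(1) sep u[OF \<open>i < n\<close>], of "\<epsilon>/2"]) (use \<epsilon> in auto)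
    then show ?thesis by blast
  qed
  then obtain P L where P: "\<And>i. i < n \<Longrightarrow> continuous_on K (P i)" "\<And>i. i < n \<Longrightarrow> L i \<ge> (0::real)"
    "\<And>i x. i < n \<Longrightarrow> x \<in> K \<Longrightarrow> \<bar>P i x - u x i\<bar> < \<epsilon> / 2"
    "\<And>i x y d. i < n \<Longrightarrow> x \<in> K \<Longrightarrow> y \<in> K \<Longrightarrow> (\<forall>j<n. \<bar>x j - y j\<bar> \<le> d) \<Longrightarrow> \<bar>P i x - P i y\<bar> \<le> L i * d"
    by metis
  define \<Lambda> where "\<Lambda> = (\<Sum>i<n. L i)"
  have \<Lambda>: "\<Lambda> \<ge> 0" "\<And>i. i < n \<Longrightarrow> L i \<le> \<Lambda>"
    unfolding \<Lambda>_def using P(2) by (auto intro!: sum_nonneg member_le_sum)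
  let ?F = "{x \<in> K. (\<forall>i<n. \<bar>x i - a i\<bar> \<le> r) \<and> (\<exists>i<n. \<bar>x i - a i\<bar> = r)}"
  obtain c where c: "\<And>i. i < n \<Longrightarrow> 0 \<le> c i \<and> c i \<le> \<epsilon> / 2" "\<And>x. x \<in> ?F \<Longrightarrow> \<exists>i<n. P i x \<noteq> c i"
  proof (rule lipschitz_image_of_cube_frontier_avoids_point[OF n r \<Lambda>(1), of "\<epsilon>/2" ?F a "\<lambda>x i. P i x"])
    fix x y d i assume x: "x \<in> ?F" "y \<in> ?F" "\<forall>j<n. \<bar>x j - y j\<bar> \<le> d" and i: "i < n"
    then have "d \<ge> 0" by (meson abs_ge_zero order_trans)
    have "\<bar>P i x - P i y\<bar> \<le> L i * d" using P(4) x i by blast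
    also have "\<dots> \<le> \<Lambda> * d" using \<Lambda>(2)[OF i] \<open>d \<ge> 0\<close> by (rule mult_right_mono)
    finally show "\<bar>P i x - P i y\<bar> \<le> \<Lambda> * d" .
  qed (use \<epsilon> in auto)
  show thesis
  proof (rule that[of "\<lambda>x i. P i x - c i"])
    show "continuous_on K (\<lambda>x. P i x - c i)" if "i < n" for i
      using P(1)[OF that] by (intro continuous_intros)
    show "\<bar>P i x - c i - u x i\<bar> < \<epsilon>" if "x \<in> K" "i < n" for x i
      using P(3)[OF that(2,1)] c(1)[OF that(2)] by (auto simp: abs_less_iff abs_if split: if_splits)
    show "\<exists>i<n. P i x - c i \<noteq> 0" if "x \<in> K" "\<forall>i<n. \<bar>x i - a i\<bar> \<le> r" "\<exists>i<n. \<bar>x i - a i\<bar> = r" for x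
      using c(2)[of x] that by auto
  qed
qed

section \<open>Newman's theorem for bounded displacement\<close>

abbreviation Rn :: "nat \<Rightarrow> (nat \<Rightarrow> real) set" where
  "Rn n \<equiv> topspace (Euclidean_space n)"

lemma Rn_iff: "x \<in> Rn n \<longleftrightarrow> (\<forall>i\<ge>n. x i = 0)"
  by (simp add: topspace_Euclidean_space)

lemma Rn_eqI: "x \<in> Rn n \<Longrightarrow> y \<in> Rn n \<Longrightarrow> (\<And>i. i < n \<Longrightarrow> x i = y i) \<Longrightarrow> x = y"
  by (metis Rn_iff ext not_le)

lemma Euclidean_space_eq_top_of_set: "Euclidean_space n = top_of_set (Rn n)"
  by (simp add: Euclidean_space_def euclidean_product_topology topspace_Euclidean_space)

lemma nsphere_eq_top_of_set: "nsphere n = top_of_set (topspace (nsphere n))"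
proof -
  have "nsphere n = top_of_set {x. (\<Sum>i\<le>n. x i ^ 2) = 1 \<and> (\<forall>i>n. x i = 0)}"
    by (subst nsphere) (simp only: euclidean_product_topology)
  moreover from this have "topspace (nsphere n) = {x. (\<Sum>i\<le>n. x i ^ 2) = 1 \<and> (\<forall>i>n. x i = 0)}"
    by (simp only: topspace_euclidean_subtopology)
  ultimately show ?thesis by (simp only:)
qed

lemma continuous_map_top_of_set:
  "continuous_map (top_of_set S) (top_of_set T) f \<longleftrightarrow> continuous_on S f \<and> f \<in> S \<rightarrow> T"
  by (simp add: continuous_map_in_subtopology)

lemma continuous_map_Rn_Rn: "continuous_map (Euclidean_space n) (Euclidean_space m) f \<longleftrightarrow>
    continuous_on (Rn n) f \<and> f \<in> Rn n \<rightarrow> Rn m"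
  by (subst (1 2) Euclidean_space_eq_top_of_set) (rule continuous_map_top_of_set)

lemma continuous_map_Rn_sphere: "continuous_map (Euclidean_space n) (nsphere m) f \<longleftrightarrow>
    continuous_on (Rn n) f \<and> f \<in> Rn n \<rightarrow> topspace (nsphere m)"
  by (subst Euclidean_space_eq_top_of_set, subst nsphere_eq_top_of_set) (rule continuous_map_top_of_set)

lemma continuous_on_coord: "continuous_on S f \<Longrightarrow> continuous_on S (\<lambda>x. f x (i::nat) :: real)"
  by (rule continuous_on_product_then_coordinatewise)

lemma continuous_on_coordI: "(\<And>i. continuous_on S (\<lambda>x. f x (i::nat) :: real)) \<Longrightarrow> continuous_on S f"
  by (rule continuous_on_coordinatewise_then_product)

lemma closed_Rn: "closed (Rn n)"
  using closedin_Euclidean_space[of n] by (simp add: euclidean_product_topology)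

definition cube :: "nat \<Rightarrow> (nat \<Rightarrow> real) \<Rightarrow> real \<Rightarrow> (nat \<Rightarrow> real) set" where
  "cube n a r = {x \<in> Rn n. \<forall>i<n. \<bar>x i - a i\<bar> \<le> r}"

definition open_cube :: "nat \<Rightarrow> (nat \<Rightarrow> real) \<Rightarrow> real \<Rightarrow> (nat \<Rightarrow> real) set" where
  "open_cube n a r = {x \<in> Rn n. \<forall>i<n. \<bar>x i - a i\<bar> < r}"

lemma compact_cube: "compact (cube n a r)"
proof -
  let ?S = "\<lambda>i. if i < n then {a i - r..a i + r} else {0}"
  have "cube n a r = PiE UNIV ?S"
  proof (intro equalityI subsetI)
    fix x assume x: "x \<in> PiE UNIV ?S"
    have "x i \<in> (if i < n then {a i - r..a i + r} else {0})" for i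
      using PiE_mem[OF x, of i] by simp
    then have "\<bar>x i - a i\<bar> \<le> r" if "i < n" for i using that by (metis (mono_tags, lifting) abs_diff_le_iff atLeastAtMost_iff add.commute)
    moreover have "x i = 0" if "i \<ge> n" for i
      using PiE_mem[OF x, of i] that by simp
    ultimately show "x \<in> cube n a r" by (simp add: cube_def Rn_iff)
  qed (auto simp: cube_def Rn_iff abs_le_iff algebra_simps)
  moreover have "compactin (product_topology (\<lambda>i. euclideanreal) UNIV) (PiE UNIV ?S)"
    by (subst compactin_PiE) auto
  ultimately show ?thesis by (simp add: euclidean_product_topology)
qed

lemma open_cube_eq: "open_cube n a r = Rn n \<inter> {x. \<forall>i<n. \<bar>x i - a i\<bar> < r}"
  by (auto simp: open_cube_def)

lemma open_cube_ambient: "open {x :: nat \<Rightarrow> real. \<forall>i<n. \<bar>x i - a i\<bar> < r}"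
proof -
  have "{x :: nat \<Rightarrow> real. \<forall>i<n. \<bar>x i - a i\<bar> < r} = (\<Inter>i\<in>{..<n}. {x. \<bar>x i - a i\<bar> < r})" by auto
  moreover have "open {x :: nat \<Rightarrow> real. \<bar>x i - a i\<bar> < r}" for i
    by (intro open_Collect_less continuous_intros continuous_on_product_coordinates)
  ultimately show ?thesis by (simp add: open_INT)
qed

lemma open_contains_cube:
  assumes "open U" "x \<in> U" "x \<in> Rn n"
  obtains r where "r > 0" "cube n x r \<subseteq> U"
proof -
  have "openin (product_topology (\<lambda>i. euclidean) UNIV) U"
    using assms(1) by (simp add: euclidean_product_topology)
  from product_topology_open_contains_basis[OF this assms(2)]
  obtain X where X: "x \<in> PiE UNIV X" "\<And>i. open (X i)" "PiE UNIV X \<subseteq> U" by auto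
  have "\<exists>e>0. \<forall>y. \<bar>y - x i\<bar> \<le> e \<longrightarrow> y \<in> X i" for i
  proof -
    have "x i \<in> X i" using X(1) by auto
    with X(2)[of i] obtain e where "e > 0" "cball (x i) e \<subseteq> X i" by (meson open_contains_cball)
    then show ?thesis by (intro exI[of _ e]) (auto simp: dist_real_def abs_minus_commute)
  qed
  then obtain e where e: "\<And>i. e i > 0" "\<And>i y. \<bar>y - x i\<bar> \<le> e i \<Longrightarrow> y \<in> X i" by metis
  define r where "r = Min (insert 1 (e ` {..<n}))"
  have r: "r > 0" "\<And>i. i < n \<Longrightarrow> r \<le> e i"
    unfolding r_def using e(1) by (auto simp: Min_gr_iff)
  have "cube n x r \<subseteq> U"
  proof
    fix y assume y: "y \<in> cube n x r"
    have "y i \<in> X i" for i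
    proof (cases "i < n")
      case True
      then show ?thesis using y r(2)[OF True] by (intro e(2)) (auto simp: cube_def)
    next
      case False
      then have "y i = x i" using y assms(3) by (auto simp: cube_def Rn_iff)
      then show ?thesis using e(2)[of "y i" i] e(1)[of i] by simp
    qed
    then show "y \<in> U" using X(3) by auto
  qed
  then show thesis using that r(1) by blast
qed

lemma compactly_supported_iff:
  "compactly_supported n g \<longleftrightarrow> continuous_on (Rn n) g \<and> (\<forall>x\<in>Rn n. g x \<in> topspace (nsphere n)) \<and>
     (\<exists>R. \<forall>x\<in>Rn n. (\<exists>i<n. R < \<bar>x i\<bar>) \<longrightarrow> g x = south n)"
  unfolding compactly_supported_def continuous_map_Rn_sphere by (auto simp: Pi_iff)

text \<open>
  Outside \<open>U\<close> the last coordinate is never 1. Far away it is -1, and on the remaining compact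
  set it attains a maximum.
\<close>

lemma compactly_supported_last_coord_bound:
  assumes g: "compactly_supported n g" and U: "open U"
    and north: "\<And>x. x \<in> Rn n \<Longrightarrow> g x = north n \<Longrightarrow> x \<in> U"
  obtains \<nu> where "-1 \<le> \<nu>" "\<nu> < 1" "\<And>x. x \<in> Rn n \<Longrightarrow> x \<notin> U \<Longrightarrow> g x n \<le> \<nu>"
proof -
  obtain R where gc: "continuous_on (Rn n) g" and gS: "\<And>x. x \<in> Rn n \<Longrightarrow> g x \<in> topspace (nsphere n)"
    and R: "\<And>x. x \<in> Rn n \<Longrightarrow> \<exists>i<n. R < \<bar>x i\<bar> \<Longrightarrow> g x = south n"
    using g unfolding compactly_supported_iff by blast
  let ?Q = "cube n (\<lambda>i. 0) R - U"
  have Q: "compact ?Q" using compact_cube U by (intro compact_diff)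
  have far: "g x n = -1" if "x \<in> Rn n" "x \<notin> cube n (\<lambda>i. 0) R" for x
    using R[OF that(1)] that by (force simp: cube_def south_def)
  show thesis
  proof (cases "?Q = {}")
    case True
    then have "g x n \<le> -1" if "x \<in> Rn n" "x \<notin> U" for x using far[OF that(1)] that(2) by force
    then show ?thesis using that[of "-1"] by auto
  next
    case False
    have "continuous_on ?Q (\<lambda>x. g x n)"
      by (rule continuous_on_coord, rule continuous_on_subset[OF gc]) (auto simp: cube_def)
    then obtain q where q: "q \<in> ?Q" "\<And>x. x \<in> ?Q \<Longrightarrow> g x n \<le> g q n"
      using continuous_attains_sup[OF Q False] by blast
    have qR: "q \<in> Rn n" using q(1) by (auto simp: cube_def)
    have "g q n \<noteq> 1" using nsphere_eq_north_iff[OF gS[OF qR]] north[OF qR] q(1) by auto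
    then have "g q n < 1" "-1 \<le> g q n" using nsphere_abs_le_1[OF gS[OF qR], of n] by auto
    moreover have "g x n \<le> g q n" if "x \<in> Rn n" "x \<notin> U" for x
      using far[OF that(1)] q(2)[of x] that(2) \<open>-1 \<le> g q n\<close> by (cases "x \<in> cube n (\<lambda>i. 0) R") auto
    ultimately show ?thesis using that by blast
  qed
qed

text \<open>
  The perturbation moves only the first \<open>n\<close> coordinates. Where the sum of \<open>g x\<close> and a multiple of
  \<open>w x\<close> vanished, \<open>g x\<close> would lie on the equator and have norm less than 1, by the choice of \<open>\<epsilon>\<close>.
\<close>

lemma compactly_supported_perturb:
  assumes g: "compactly_supported n g" and n\<epsilon>: "real n * \<epsilon>\<^sup>2 < 1"
    and wc: "\<And>i. i < n \<Longrightarrow> continuous_on (Rn n) (\<lambda>x. w x i)"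
    and w\<epsilon>: "\<And>x i. x \<in> Rn n \<Longrightarrow> i < n \<Longrightarrow> \<bar>w x i\<bar> \<le> \<epsilon>"
    and wR: "\<And>x i. x \<in> Rn n \<Longrightarrow> \<exists>i<n. R < \<bar>x i\<bar> \<Longrightarrow> i < n \<Longrightarrow> w x i = 0"
  shows "compactly_supported n (\<lambda>x. sphere_normalize n (\<lambda>i. g x i + (if i < n then w x i else 0)))"
    "cs_degree n (\<lambda>x. sphere_normalize n (\<lambda>i. g x i + (if i < n then w x i else 0))) = cs_degree n g"
proof -
  obtain R' where gc: "continuous_on (Rn n) g" and gS: "\<And>x. x \<in> Rn n \<Longrightarrow> g x \<in> topspace (nsphere n)"
    and R': "\<And>x. x \<in> Rn n \<Longrightarrow> \<exists>i<n. R' < \<bar>x i\<bar> \<Longrightarrow> g x = south n"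
    using g unfolding compactly_supported_iff by blast
  let ?P = "prod_topology (top_of_set {0..1::real}) (Euclidean_space n)"
  let ?G = "\<lambda>z. sphere_normalize n (\<lambda>i. g (snd z) i + fst z * (if i < n then w (snd z) i else 0))"
  have ct: "continuous_map ?P euclideanreal fst"
    using continuous_map_fst continuous_map_into_fulltopology by blast
  have cE: "continuous_map (Euclidean_space n) euclideanreal h" if "continuous_on (Rn n) h" for h
    using that by (subst Euclidean_space_eq_top_of_set) simp
  have cg: "continuous_map ?P euclideanreal (\<lambda>z. g (snd z) i)" for i
    using continuous_map_compose[OF continuous_map_snd cE[OF continuous_on_coord[OF gc]], unfolded o_def] .
  have cw: "continuous_map ?P euclideanreal (\<lambda>z. if i < n then w (snd z) i else 0)" for i
    using continuous_map_compose[OF continuous_map_snd cE[OF wc], unfolded o_def] by (cases "i < n") auto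
  have G: "continuous_map ?P (nsphere n) ?G"
  proof (rule continuous_map_sphere_normalize)
    fix z assume "z \<in> topspace ?P"
    then obtain t x where z: "z = (t, x)" "0 \<le> t" "t \<le> 1" "x \<in> Rn n" by auto
    show "\<exists>i\<le>n. g (snd z) i + fst z * (if i < n then w (snd z) i else 0) \<noteq> 0"
    proof (rule ccontr)
      assume "\<not> ?thesis"
      then have eq: "g x i + t * (if i < n then w x i else 0) = 0" if "i \<le> n" for i using that z by auto
      have "g x n = 0" using eq[of n] by simp
      moreover have "(g x i)\<^sup>2 \<le> \<epsilon>\<^sup>2" if "i < n" for i
      proof -
        have "g x i = - (t * w x i)" using eq[of i] that by simp
        moreover have "t * \<bar>w x i\<bar> \<le> 1 * \<epsilon>" using z w\<epsilon>[OF z(4) that] by (intro mult_mono) auto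
        ultimately have "\<bar>g x i\<bar> \<le> \<epsilon>" using z by (simp add: abs_mult)
        then show ?thesis by (metis abs_le_square_iff abs_ge_self order_trans)
      qed
      then have "(\<Sum>i<n. (g x i)\<^sup>2) \<le> (\<Sum>i<n. \<epsilon>\<^sup>2)" by (intro sum_mono) auto
      ultimately have "(\<Sum>i\<le>n. (g x i)\<^sup>2) < 1" using n\<epsilon> by (simp flip: lessThan_Suc_atMost)
      then show False using gS[OF z(4)] by (simp add: topspace_nsphere)
    qed
  qed (intro continuous_intros cg ct cw)
  have supp: "?G (t, x) = south n" if "0 \<le> t" "t \<le> 1" "x \<in> Rn n" "\<exists>i<n. max R R' < \<bar>x i\<bar>" for t x
  proof -
    have 1: "\<exists>i<n. R < \<bar>x i\<bar>" "\<exists>i<n. R' < \<bar>x i\<bar>" using that(4) by auto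
    have eq: "(\<lambda>i. g x i + t * (if i < n then w x i else 0)) = south n"
      using R'[OF that(3) 1(2)] wR[OF that(3) 1(1)] by (auto simp: fun_eq_iff)
    show ?thesis by (simp only: fst_conv snd_conv eq sphere_normalize_id south_in_nsphere)
  qed
  have ext: "compactly_supported n h' \<and> cs_degree n h = cs_degree n h'"
    if "compactly_supported n h" "\<And>x. x \<in> Rn n \<Longrightarrow> h x = h' x" for h h'
  proof
    show "compactly_supported n h'"
      using that continuous_on_cong[of "Rn n" "Rn n" h h'] unfolding compactly_supported_iff by auto
    show "cs_degree n h = cs_degree n h'"
      unfolding cs_degree_def
      by (rule Brouwer_degree2_eq) (use that stereographic_in in \<open>auto simp: sphere_extension_def\<close>)
  qed
  note H = compactly_supported_homotopy[OF G supp]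
  have "?G (0, x) = g x" if "x \<in> Rn n" for x using gS[OF that] by (simp add: sphere_normalize_id)
  note e0 = ext[OF H(1) this]
  show "compactly_supported n (\<lambda>x. sphere_normalize n (\<lambda>i. g x i + (if i < n then w x i else 0)))"
    using H(2) by (simp only: fst_conv snd_conv mult_1)
  have "cs_degree n (\<lambda>x. ?G (1, x)) = cs_degree n g"
    by (rule trans[OF H(3)[symmetric] conjunct2[OF e0]])
  then show "cs_degree n (\<lambda>x. sphere_normalize n (\<lambda>i. g x i + (if i < n then w x i else 0))) = cs_degree n g"
    by (simp only: fst_conv snd_conv mult_1)
qed

text \<open>
  The displacement bound keeps the iterates of \<open>f\<close> properly homotopic to the identity, so that
  composing with them preserves degrees.
\<close>

locale periodic_displacement =
  fixes n p :: nat and f :: "(nat \<Rightarrow> real) \<Rightarrow> nat \<Rightarrow> real" and M :: real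
  assumes n2: "n \<ge> 2" and p0: "p > 0"
    and f_cont: "continuous_on (Rn n) f" and f_Rn: "\<And>x. x \<in> Rn n \<Longrightarrow> f x \<in> Rn n"
    and f_period: "\<And>x. x \<in> Rn n \<Longrightarrow> (f ^^ p) x = x"
    and f_disp: "\<And>x i. x \<in> Rn n \<Longrightarrow> i < n \<Longrightarrow> \<bar>f x i - x i\<bar> \<le> M"
begin

lemma iter_Rn: "x \<in> Rn n \<Longrightarrow> (f ^^ j) x \<in> Rn n"
  by (induction j) (auto intro: f_Rn)

lemma iter_cont: "continuous_on (Rn n) (f ^^ j)"
proof (induction j)
  case (Suc j)
  have "continuous_on (Rn n) (\<lambda>x. f ((f ^^ j) x))"
    by (rule continuous_on_compose2[OF f_cont Suc]) (auto intro: iter_Rn)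
  then show ?case by (simp add: o_def)
qed (auto simp: continuous_on_id id_def)

lemma iter_disp: "x \<in> Rn n \<Longrightarrow> i < n \<Longrightarrow> \<bar>(f ^^ j) x i - x i\<bar> \<le> real j * M"
proof (induction j)
  case (Suc j)
  have "\<bar>f ((f ^^ j) x) i - (f ^^ j) x i\<bar> \<le> M" using Suc iter_Rn f_disp by blast
  then show ?case using Suc by (simp add: algebra_simps)
qed simp

lemma M_nonneg: "M \<ge> 0"
proof -
  have "\<bar>f (\<lambda>i. 0) 0 - 0\<bar> \<le> M" using f_disp[of "\<lambda>i. 0" 0] n2 by (simp add: Rn_iff)
  then show ?thesis by linarith
qed

lemma ex_iter_shift:
  assumes "x \<in> Rn n" shows "(\<exists>j<p. (f ^^ j) (f x) \<in> S) \<longleftrightarrow> (\<exists>j<p. (f ^^ j) x \<in> S)"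
proof
  assume "\<exists>j<p. (f ^^ j) (f x) \<in> S"
  then obtain j where j: "j < p" "(f ^^ Suc j) x \<in> S" by (auto simp: funpow_swap1)
  then show "\<exists>j<p. (f ^^ j) x \<in> S"
    using f_period[OF assms] p0 by (cases "Suc j = p") (metis funpow_0, metis Suc_lessI)
next
  assume "\<exists>j<p. (f ^^ j) x \<in> S"
  then obtain j where j: "j < p" "(f ^^ j) x \<in> S" by blast
  show "\<exists>j<p. (f ^^ j) (f x) \<in> S"
  proof (cases j)
    case 0
    then have "(f ^^ (p - 1)) (f x) = x"
      using f_period[OF assms] p0 by (metis Suc_diff_1 comp_apply funpow_Suc_right)
    then show ?thesis using j 0 p0 by (intro exI[of _ "p - 1"]) auto
  next
    case (Suc k)
    then have "(f ^^ k) (f x) \<in> S" using j(2) by (simp add: funpow_swap1)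
    then show ?thesis using j(1) Suc by (intro exI[of _ k]) auto
  qed
qed

lemma sum_iter_shift:
  fixes \<phi> :: "(nat \<Rightarrow> real) \<Rightarrow> real"
  assumes "x \<in> Rn n" shows "(\<Sum>j<p. \<phi> ((f ^^ j) (f x))) = (\<Sum>j<p. \<phi> ((f ^^ j) x))"
proof -
  have "(\<Sum>j<p. \<phi> ((f ^^ j) (f x))) = (\<Sum>j<p. \<phi> ((f ^^ Suc j) x))" by (simp add: funpow_swap1)
  also have "\<dots> + \<phi> ((f ^^ 0) x) = (\<Sum>j<Suc p. \<phi> ((f ^^ j) x))"
    by (subst sum.lessThan_Suc_shift) simp
  also have "\<dots> = (\<Sum>j<p. \<phi> ((f ^^ j) x)) + \<phi> ((f ^^ 0) x)" using f_period[OF assms] by simp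
  finally show ?thesis by simp
qed

lemma compactly_supported_cases:
  assumes g: "compactly_supported n g" and A: "closed A" and B: "closed B" and cover: "Rn n \<subseteq> A \<union> B"
    and ov: "\<And>x. x \<in> Rn n \<Longrightarrow> x \<in> A \<Longrightarrow> x \<in> B \<Longrightarrow> g x = south n"
    and PA: "\<And>x. x \<in> Rn n \<Longrightarrow> P x \<Longrightarrow> x \<in> A" and PB: "\<And>x. x \<in> Rn n \<Longrightarrow> \<not> P x \<Longrightarrow> x \<in> B"
  shows "compactly_supported n (\<lambda>x. if P x then g x else south n)"
proof -
  have gc: "continuous_on (Rn n) g" using g unfolding compactly_supported_iff by blast
  have "continuous_on ((Rn n \<inter> A) \<union> (Rn n \<inter> B)) (\<lambda>x. if P x then g x else south n)"
    by (rule continuous_on_cases)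
       (use A B ov PA PB closed_Rn in \<open>auto intro: continuous_on_subset[OF gc]\<close>)
  moreover have "(Rn n \<inter> A) \<union> (Rn n \<inter> B) = Rn n" using cover by blast
  ultimately have c: "continuous_on (Rn n) (\<lambda>x. if P x then g x else south n)" by simp
  obtain R where "\<forall>x\<in>Rn n. (\<exists>i<n. R < \<bar>x i\<bar>) \<longrightarrow> g x = south n"
    using g unfolding compactly_supported_iff by blast
  then have "\<forall>x\<in>Rn n. (\<exists>i<n. R < \<bar>x i\<bar>) \<longrightarrow> (if P x then g x else south n) = south n" by auto
  moreover have "\<forall>x\<in>Rn n. (if P x then g x else south n) \<in> topspace (nsphere n)"
    using g south_in_nsphere unfolding compactly_supported_iff by auto
  ultimately show ?thesis using c unfolding compactly_supported_iff by blast
qed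

lemma closed_iter_vimage: "closed S \<Longrightarrow> closed {x \<in> Rn n. (f ^^ j) x \<in> S}"
  using continuous_on_closed_vimage[OF closed_Rn, of n "f ^^ j"] iter_cont
  by (simp add: vimage_def Int_def conj_commute)

lemma closed_complement_iter_cube: "closed {x \<in> Rn n. (f ^^ j) x \<notin> open_cube n a r}"
proof -
  have "closed (- {x :: nat \<Rightarrow> real. \<forall>i<n. \<bar>x i - a i\<bar> < r})" using open_cube_ambient by (simp add: closed_Compl)
  from closed_iter_vimage[OF this, of j] show ?thesis
    by (rule back_subst[of closed]) (auto simp: open_cube_eq iter_Rn)
qed

text \<open>
  The \<open>p\<close> preimages of the cube are disjoint, so \<open>g\<close> is the wedge sum of its restrictions to them
  and of \<open>rest p\<close>; the restrictions are continuous since \<open>g\<close> is the base point on the frontiers.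
  By invariance the restrictions differ by composition with iterates of \<open>f\<close>, so they all have
  the same degree.
\<close>

lemma degree_remove_orbit_of_cube:
  assumes g: "compactly_supported n g" and gf: "\<And>x. x \<in> Rn n \<Longrightarrow> g (f x) = g x"
    and front: "\<And>x j. x \<in> Rn n \<Longrightarrow> j < p \<Longrightarrow> (f ^^ j) x \<in> cube n a r \<Longrightarrow> (f ^^ j) x \<notin> open_cube n a r \<Longrightarrow> g x = south n"
    and disj: "\<And>x i j. x \<in> Rn n \<Longrightarrow> i < p \<Longrightarrow> j < p \<Longrightarrow> (f ^^ i) x \<in> cube n a r \<Longrightarrow> (f ^^ j) x \<in> cube n a r \<Longrightarrow> i = j"
  defines "rest \<equiv> \<lambda>k x. if \<forall>j<k. (f ^^ j) x \<notin> cube n a r then g x else south n"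
  shows "compactly_supported n (rest p)" "int p dvd cs_degree n g - cs_degree n (rest p)"
proof -
  define piece where "piece = (\<lambda>j x. if (f ^^ j) x \<in> open_cube n a r then g x else south n)"
  have oc: "open_cube n a r \<subseteq> cube n a r" by (auto simp: open_cube_def cube_def)
  have giter: "g ((f ^^ j) x) = g x" if "x \<in> Rn n" for x j
    by (induction j) (use that gf iter_Rn in auto)
  have piece_cs: "compactly_supported n (piece j)" if j: "j < p" for j
    unfolding piece_def
  proof (rule compactly_supported_cases[OF g])
    show "closed {x \<in> Rn n. (f ^^ j) x \<in> cube n a r}"
      by (rule closed_iter_vimage[OF compact_imp_closed[OF compact_cube]])
    show "closed {x \<in> Rn n. (f ^^ j) x \<notin> open_cube n a r}" by (rule closed_complement_iter_cube)
  qed (use oc front[OF _ j] in auto)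
  have rest_cs: "compactly_supported n (rest k)" if k: "k \<le> p" for k
    unfolding rest_def
  proof (rule compactly_supported_cases[OF g])
    have "closed (\<Inter>j\<in>{..<k}. {x \<in> Rn n. (f ^^ j) x \<notin> open_cube n a r})"
      by (intro closed_INT ballI closed_complement_iter_cube)
    then show "closed (Rn n \<inter> (\<Inter>j\<in>{..<k}. {x \<in> Rn n. (f ^^ j) x \<notin> open_cube n a r}))"
      by (intro closed_Int closed_Rn)
    show "closed (\<Union>j\<in>{..<k}. {x \<in> Rn n. (f ^^ j) x \<in> cube n a r})"
      by (intro closed_UN finite_lessThan ballI closed_iter_vimage compact_imp_closed[OF compact_cube])
    fix x assume x: "x \<in> Rn n" "x \<in> Rn n \<inter> (\<Inter>j\<in>{..<k}. {x \<in> Rn n. (f ^^ j) x \<notin> open_cube n a r})"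
      "x \<in> (\<Union>j\<in>{..<k}. {x \<in> Rn n. (f ^^ j) x \<in> cube n a r})"
    then obtain j where "j < k" "(f ^^ j) x \<in> cube n a r" "(f ^^ j) x \<notin> open_cube n a r" by auto
    then show "g x = south n" using front[OF x(1), of j] k by simp
  qed (use oc in auto)
  have piece_deg: "cs_degree n (piece j) = cs_degree n (piece 0)" if j: "j < p" for j
  proof -
    have "cs_degree n (\<lambda>x. piece 0 ((f ^^ j) x)) = cs_degree n (piece 0)"
      by (rule cs_degree_compose_displacement(1)[OF piece_cs[OF p0], where M = "real j * M"])
         (use iter_disp iter_cont iter_Rn in \<open>auto simp: continuous_map_Rn_Rn\<close>)
    moreover have "cs_degree n (\<lambda>x. piece 0 ((f ^^ j) x)) = cs_degree n (piece j)"
      unfolding cs_degree_def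
      by (rule Brouwer_degree2_eq)
         (use stereographic_in giter in \<open>auto simp: sphere_extension_def piece_def\<close>)
    ultimately show ?thesis by simp
  qed
  have step: "cs_degree n (rest k) = cs_degree n (rest (Suc k)) + cs_degree n (piece k)" if k: "k < p" for k
  proof (rule cs_degree_add[OF n2])
    fix x assume x: "x \<in> Rn n"
    consider "(f ^^ k) x \<in> cube n a r" | "(f ^^ k) x \<notin> cube n a r" by blast
    then show "rest (Suc k) x = south n \<and> rest k x = piece k x \<or> piece k x = south n \<and> rest k x = rest (Suc k) x"
    proof cases
      case 1
      have "(f ^^ j) x \<notin> cube n a r" if "j < k" for j
        using disj[OF x, of j k] 1 that k by auto
      then have "rest k x = g x" by (simp add: rest_def)
      moreover have "rest (Suc k) x = south n" using 1 by (auto simp: rest_def)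
      moreover have "piece k x = g x" using front[OF x k 1] by (auto simp: piece_def)
      ultimately show ?thesis by simp
    next
      case 2
      then have "rest (Suc k) x = rest k x" by (auto simp: rest_def less_Suc_eq)
      moreover have "piece k x = south n" using 2 oc by (auto simp: piece_def)
      ultimately show ?thesis by simp
    qed
  qed (use k rest_cs piece_cs in auto)
  have "cs_degree n (rest 0) = cs_degree n (rest k) + int k * cs_degree n (piece 0)" if "k \<le> p" for k
    using that
  proof (induction k)
    case (Suc k)
    then show ?case using step[of k] piece_deg[of k] by (simp add: algebra_simps)
  qed simp
  moreover have "rest 0 = g" by (simp add: rest_def)
  ultimately have "cs_degree n g = cs_degree n (rest p) + int p * cs_degree n (piece 0)" by (metis order_refl)
  then show "int p dvd cs_degree n g - cs_degree n (rest p)" by simp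
  show "compactly_supported n (rest p)" by (rule rest_cs) simp
qed

lemma orbit_sum_continuous:
  fixes \<phi> :: "(nat \<Rightarrow> real) \<Rightarrow> real"
  assumes "continuous_on (Rn n) \<phi>"
  shows "continuous_on (Rn n) (\<lambda>x. \<Sum>j<p. \<phi> ((f ^^ j) x))"
proof (intro continuous_on_sum)
  fix j show "continuous_on (Rn n) (\<lambda>x. \<phi> ((f ^^ j) x))"
    by (rule continuous_on_compose2[OF assms iter_cont]) (auto intro: iter_Rn)
qed

text \<open>
  Perturb \<open>g\<close> inside one cube by \<open>perturb_nonzero_on_cube_frontier\<close>, with a cutoff that vanishes
  outside the cube of twice the radius, and carry the perturbation along the orbit by summing over
  all iterates of \<open>f\<close>. As the images of the larger cube are disjoint, at most one summand is nonzero
  at each point. The bound on \<open>g\<close> where \<open>g'\<close> is north says that preimages of the north pole are not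
  created far from the old ones.
\<close>

lemma perturb_off_orbit_of_frontier:
  assumes g: "compactly_supported n g" and gf: "\<And>x. x \<in> Rn n \<Longrightarrow> g (f x) = g x"
    and r: "r > 0" and \<epsilon>: "\<epsilon> > 0" "real n * \<epsilon>\<^sup>2 < 1"
    and disj: "\<And>x i j. x \<in> Rn n \<Longrightarrow> i < p \<Longrightarrow> j < p \<Longrightarrow> (f ^^ i) x \<in> cube n a (2 * r) \<Longrightarrow> (f ^^ j) x \<in> cube n a (2 * r) \<Longrightarrow> i = j"
  obtains g' where "compactly_supported n g'" "cs_degree n g' = cs_degree n g"
    "\<And>x. x \<in> Rn n \<Longrightarrow> g' (f x) = g' x"
    "\<And>x. x \<in> Rn n \<Longrightarrow> g' x = north n \<Longrightarrow> g x n > 0 \<and> (\<forall>i<n. \<bar>g x i\<bar> \<le> \<epsilon>)"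
    "\<And>x j. x \<in> Rn n \<Longrightarrow> j < p \<Longrightarrow> (f ^^ j) x \<in> cube n a r \<Longrightarrow> (f ^^ j) x \<notin> open_cube n a r \<Longrightarrow> g' x \<noteq> north n"
proof -
  let ?K = "cube n a (2 * r)"
  have KR: "?K \<subseteq> Rn n" by (auto simp: cube_def)
  have gc: "continuous_on (Rn n) g" and gS: "\<And>x. x \<in> Rn n \<Longrightarrow> g x \<in> topspace (nsphere n)"
    using g unfolding compactly_supported_iff by blast+
  have giter: "g ((f ^^ j) x) = g x" if "x \<in> Rn n" for x j
    by (induction j) (use that gf iter_Rn in auto)
  have n1: "n \<ge> 1" using n2 by simp
  obtain v where vc: "\<And>i. i < n \<Longrightarrow> continuous_on ?K (\<lambda>x. v x i)"
    and v\<epsilon>: "\<And>x i. x \<in> ?K \<Longrightarrow> i < n \<Longrightarrow> \<bar>v x i - g x i\<bar> < \<epsilon>"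
    and vf: "\<And>x. x \<in> ?K \<Longrightarrow> \<forall>i<n. \<bar>x i - a i\<bar> \<le> r \<Longrightarrow> \<exists>i<n. \<bar>x i - a i\<bar> = r \<Longrightarrow> \<exists>i<n. v x i \<noteq> 0"
    by (rule perturb_nonzero_on_cube_frontier[OF n1 r \<epsilon>(1) compact_cube KR, of g a])
       (use continuous_on_coord[OF continuous_on_subset[OF gc KR]] in blast)+
  define cutoff where "cutoff = (\<lambda>x::nat\<Rightarrow>real. \<Prod>i<n. max 0 (min 1 (2 - \<bar>x i - a i\<bar> / r)))"
  have cut01: "0 \<le> cutoff x" "cutoff x \<le> 1" for x
    unfolding cutoff_def by (auto intro!: prod_nonneg prod_le_1)
  have cut1: "cutoff x = 1" if "\<forall>i<n. \<bar>x i - a i\<bar> \<le> r" for x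
  proof -
    have "max 0 (min 1 (2 - \<bar>x i - a i\<bar> / r)) = 1" if "i < n" for i
    proof -
      have "\<bar>x i - a i\<bar> / r \<le> 1" using \<open>\<forall>i<n. \<bar>x i - a i\<bar> \<le> r\<close> that r by simp
      then show ?thesis by simp
    qed
    then show ?thesis unfolding cutoff_def by (intro prod.neutral) auto
  qed
  have cut0: "cutoff x = 0" if i: "i < n" "\<bar>x i - a i\<bar> \<ge> 2 * r" for x i
  proof -
    have "\<bar>x i - a i\<bar> / r \<ge> 2" using i r by (simp add: field_simps)
    then have "max 0 (min 1 (2 - \<bar>x i - a i\<bar> / r)) = 0" by simp
    then show ?thesis unfolding cutoff_def using i by (intro prod_zero) auto
  qed
  have cutc: "continuous_on S cutoff" for S
    unfolding cutoff_def
    by (intro continuous_intros continuous_on_subset[OF continuous_on_product_coordinates]) (use r in auto)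
  define w0 where "w0 = (\<lambda>x i. if x \<in> ?K then cutoff x * (v x i - g x i) else 0)"
  have w0c: "continuous_on (Rn n) (\<lambda>x. w0 x i)" if i: "i < n" for i
  proof -
    let ?B = "Rn n \<inter> - {x. \<forall>i<n. \<bar>x i - a i\<bar> < 2 * r}"
    have "closed ?B" using closed_Rn open_cube_ambient by (intro closed_Int) (auto simp: closed_Compl)
    then have "continuous_on (?K \<union> ?B) (\<lambda>x. w0 x i)"
      unfolding w0_def
    proof (intro continuous_on_cases compact_imp_closed[OF compact_cube])
      show "continuous_on ?K (\<lambda>x. cutoff x * (v x i - g x i))"
        by (intro continuous_intros cutc vc[OF i] continuous_on_coord[OF continuous_on_subset[OF gc KR]])
      show "\<forall>x. x \<in> ?K \<and> x \<notin> ?K \<or> x \<in> ?B \<and> x \<in> ?K \<longrightarrow> cutoff x * (v x i - g x i) = 0"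
        using cut0 by (auto simp: not_less)
    qed auto
    moreover have "?K \<union> ?B = Rn n" using KR by (auto simp: cube_def not_less)
    ultimately show ?thesis by simp
  qed
  have w0\<epsilon>: "\<bar>w0 x i\<bar> \<le> \<epsilon>" if "i < n" for x i
  proof (cases "x \<in> ?K")
    case True
    have "\<bar>cutoff x\<bar> * \<bar>v x i - g x i\<bar> \<le> 1 * \<epsilon>"
      using cut01[of x] v\<epsilon>[OF True that] by (intro mult_mono) auto
    then show ?thesis using True by (simp add: w0_def abs_mult)
  qed (use \<epsilon> in \<open>simp add: w0_def\<close>)
  define w where "w = (\<lambda>x i. \<Sum>j<p. w0 ((f ^^ j) x) i)"
  have w_one: "w x i = w0 ((f ^^ j) x) i" if "x \<in> Rn n" "j < p" "(f ^^ j) x \<in> ?K" for x i j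
  proof -
    have "w0 ((f ^^ k) x) i = 0" if k: "k < p" "k \<noteq> j" for k
    proof -
      have "(f ^^ k) x \<notin> ?K"
        using disj[OF \<open>x \<in> Rn n\<close> k(1) \<open>j < p\<close> _ \<open>(f ^^ j) x \<in> ?K\<close>] k(2) by blast
      then show ?thesis by (simp add: w0_def)
    qed
    then have "(\<Sum>k\<in>{..<p} - {j}. w0 ((f ^^ k) x) i) = 0" by (intro sum.neutral) auto
    then show ?thesis unfolding w_def using \<open>j < p\<close> by (subst sum.remove[of _ j]) auto
  qed
  have w_zero: "w x i = 0" if "\<forall>j<p. (f ^^ j) x \<notin> ?K" for x i
    unfolding w_def using that by (intro sum.neutral) (auto simp: w0_def)
  have wc: "continuous_on (Rn n) (\<lambda>x. w x i)" if "i < n" for i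
    unfolding w_def by (rule orbit_sum_continuous[OF w0c[OF that]])
  have w\<epsilon>: "\<bar>w x i\<bar> \<le> \<epsilon>" if "x \<in> Rn n" "i < n" for x i
  proof (cases "\<exists>j<p. (f ^^ j) x \<in> ?K")
    case True
    then obtain j where j: "j < p" "(f ^^ j) x \<in> ?K" by blast
    then show ?thesis using w_one[OF that(1) j] w0\<epsilon>[OF that(2)] by simp
  next
    case False
    then have "w x i = 0" by (intro w_zero) blast
    then show ?thesis using \<epsilon> by simp
  qed
  have wf: "w (f x) i = w x i" if "x \<in> Rn n" for x i
    unfolding w_def using sum_iter_shift[OF that, of "\<lambda>x. w0 x i"] by simp
  define R where "R = (\<Sum>i<n. \<bar>a i\<bar>) + 2 * r + real p * M"
  have wR: "w x i = 0" if x: "x \<in> Rn n" "\<exists>i<n. R < \<bar>x i\<bar>" for x i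
  proof (rule w_zero, intro allI impI notI)
    fix j assume j: "j < p" "(f ^^ j) x \<in> ?K"
    obtain i where i: "i < n" "R < \<bar>x i\<bar>" using x(2) by blast
    have "\<bar>(f ^^ j) x i - a i\<bar> \<le> 2 * r" using j(2) i(1) by (auto simp: cube_def)
    moreover have "\<bar>(f ^^ j) x i - x i\<bar> \<le> real j * M" by (rule iter_disp[OF x(1) i(1)])
    moreover have "real j * M \<le> real p * M" using j M_nonneg by (intro mult_right_mono) auto
    moreover have "\<bar>a i\<bar> \<le> (\<Sum>i<n. \<bar>a i\<bar>)" using i(1) by (intro member_le_sum) auto
    ultimately show False using i(2) unfolding R_def by linarith
  qed
  define h where "h = (\<lambda>x i. g x i + (if i < n then w x i else 0))"
  define g' where "g' = (\<lambda>x. sphere_normalize n (h x))"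
  have hpos: "(\<Sum>j\<le>n. (h x j)\<^sup>2) > 0" if x: "x \<in> Rn n" for x
  proof -
    have "compactly_supported n (\<lambda>x. sphere_normalize n (h x))"
      unfolding h_def by (rule compactly_supported_perturb(1)[OF g \<epsilon>(2) wc w\<epsilon> wR]; assumption)
    then have "sphere_normalize n (h x) \<in> topspace (nsphere n)"
      using x unfolding compactly_supported_iff by blast
    then have "\<not> (\<Sum>j\<le>n. (h x j)\<^sup>2) \<le> 0"
    proof (rule contrapos_pn)
      assume "(\<Sum>j\<le>n. (h x j)\<^sup>2) \<le> 0"
      then have "(\<Sum>j\<le>n. (h x j)\<^sup>2) = 0" by (intro antisym sum_nonneg) auto
      then show "sphere_normalize n (h x) \<notin> topspace (nsphere n)"
        by (simp add: sphere_normalize_def topspace_nsphere)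
    qed
    then show ?thesis by simp
  qed
  have gn: "h x n > 0 \<and> (\<forall>i<n. h x i = 0)" if x: "x \<in> Rn n" "g' x = north n" for x
  proof -
    have eq: "h x i / sqrt (\<Sum>j\<le>n. (h x j)\<^sup>2) = north n i" if "i \<le> n" for i
      using fun_cong[OF x(2), of i] that by (simp add: g'_def sphere_normalize_def)
    have sq: "sqrt (\<Sum>j\<le>n. (h x j)\<^sup>2) > 0" using hpos[OF x(1)] by simp
    have "h x i = 0" if "i < n" for i using eq[of i] that sq by (simp add: north_def)
    moreover have "h x n = sqrt (\<Sum>j\<le>n. (h x j)\<^sup>2)" using eq[of n] sq by (simp add: north_def field_simps)
    ultimately show ?thesis using sq by simp
  qed
  show thesis
  proof (rule that[of g'])
    show "compactly_supported n g'" "cs_degree n g' = cs_degree n g"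
      unfolding g'_def h_def
      by (rule compactly_supported_perturb[OF g \<epsilon>(2) wc w\<epsilon> wR]; assumption)+
    show "g' (f x) = g' x" if "x \<in> Rn n" for x
      unfolding g'_def h_def using gf[OF that] wf[OF that] by (simp cong: if_cong)
    show "g x n > 0 \<and> (\<forall>i<n. \<bar>g x i\<bar> \<le> \<epsilon>)" if "x \<in> Rn n" "g' x = north n" for x
    proof (intro conjI allI impI)
      show "g x n > 0" using gn[OF that] by (simp add: h_def)
      fix i assume i: "i < n"
      then have "g x i = - w x i" using gn[OF that] by (simp add: h_def eq_neg_iff_add_eq_0)
      then show "\<bar>g x i\<bar> \<le> \<epsilon>" using w\<epsilon>[OF that(1) i] by simp
    qed
    show "g' x \<noteq> north n" if x: "x \<in> Rn n" "j < p" "(f ^^ j) x \<in> cube n a r" "(f ^^ j) x \<notin> open_cube n a r" for x j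
    proof
      assume N: "g' x = north n"
      let ?y = "(f ^^ j) x"
      have y: "\<forall>i<n. \<bar>?y i - a i\<bar> \<le> r" "\<exists>i<n. \<bar>?y i - a i\<bar> = r"
        using x(3,4) by (auto simp: cube_def open_cube_def) (metis antisym_conv2)
      have "\<bar>?y i - a i\<bar> \<le> 2 * r" if "i < n" for i
        using y(1)[rule_format, OF that] r by linarith
      then have yK: "?y \<in> ?K" using x(3) by (simp add: cube_def)
      then obtain i where i: "i < n" "v ?y i \<noteq> 0" using vf[OF yK y] by blast
      have "h x i = v ?y i"
        using i(1) w_one[OF x(1,2) yK, of i] yK cut1[OF y(1)] giter[OF x(1), of j]
        by (simp add: h_def w0_def)
      then show False using gn[OF x(1) N] i by simp
    qed
  qed
qed

text \<open>
  Induction on the number of cubes. The perturbed map is still north only inside the given cubes and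
  no longer on the orbit of the frontier of the cube \<open>a\<close>; a collapse then makes it the base point
  there. Removing the orbit of this cube costs a multiple of \<open>p\<close>, and what remains is north only
  inside the other cubes.
\<close>

lemma period_dvd_degree:
  assumes "finite J" "compactly_supported n g" "\<And>x. x \<in> Rn n \<Longrightarrow> g (f x) = g x"
    "\<And>a. a \<in> J \<Longrightarrow> r a > 0"
    "\<And>a x i j. a \<in> J \<Longrightarrow> x \<in> Rn n \<Longrightarrow> i < p \<Longrightarrow> j < p \<Longrightarrow>
       (f ^^ i) x \<in> cube n a (2 * r a) \<Longrightarrow> (f ^^ j) x \<in> cube n a (2 * r a) \<Longrightarrow> i = j"
    "\<And>x. x \<in> Rn n \<Longrightarrow> g x = north n \<Longrightarrow> \<exists>a\<in>J. \<exists>j<p. (f ^^ j) x \<in> open_cube n a (r a)"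
  shows "int p dvd cs_degree n g"
  using assms
proof (induction J arbitrary: g rule: finite_induct)
  case empty
  then have "cs_degree n g = 0" by (intro cs_degree_not_north) auto
  then show ?case by simp
next
  case (insert a J)
  note g = insert.prems(1) and gf = insert.prems(2) and rp = insert.prems(3) and disj = insert.prems(4) and nor = insert.prems(5)
  have gS: "\<And>x. x \<in> Rn n \<Longrightarrow> g x \<in> topspace (nsphere n)"
    using g unfolding compactly_supported_iff by blast
  have sub: "cube n a (r a) \<subseteq> cube n a (2 * r a)" using rp[of a] by (auto simp: cube_def)
  let ?U = "- (\<Inter>b\<in>insert a J. \<Inter>j\<in>{..<p}. {x \<in> Rn n. (f ^^ j) x \<notin> open_cube n b (r b)})"
  have "open ?U"
    by (intro open_Compl closed_INT ballI closed_complement_iter_cube)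
  moreover have "x \<in> ?U" if "x \<in> Rn n" "g x = north n" for x using nor[OF that] by auto
  ultimately obtain \<nu> where \<nu>: "-1 \<le> \<nu>" "\<nu> < 1" "\<And>x. x \<in> Rn n \<Longrightarrow> x \<notin> ?U \<Longrightarrow> g x n \<le> \<nu>"
    using compactly_supported_last_coord_bound[OF g, of ?U] by blast
  define \<mu> where "\<mu> = max \<nu> 0"
  have \<mu>: "0 \<le> \<mu>" "\<mu> < 1" "\<nu> \<le> \<mu>" using \<nu> by (auto simp: \<mu>_def)
  have "1 - \<mu>\<^sup>2 > 0" using \<mu> power_strict_mono[of \<mu> 1 2] by simp
  \<comment> \<open>With this \<open>\<epsilon>\<close>, a point whose first \<open>n\<close> coordinates are at most \<open>\<epsilon>\<close> has height above \<open>\<mu>\<close> or below \<open>-\<mu>\<close>.\<close>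
  define \<epsilon> where "\<epsilon> = sqrt ((1 - \<mu>\<^sup>2) / (2 * real n))"
  have \<epsilon>0: "\<epsilon> > 0" unfolding \<epsilon>_def using \<open>1 - \<mu>\<^sup>2 > 0\<close> n2 by simp
  have "real n * \<epsilon>\<^sup>2 = (1 - \<mu>\<^sup>2) / 2" unfolding \<epsilon>_def using \<open>1 - \<mu>\<^sup>2 > 0\<close> n2 by simp
  then have n\<epsilon>: "real n * \<epsilon>\<^sup>2 < 1 - \<mu>\<^sup>2" using \<open>1 - \<mu>\<^sup>2 > 0\<close> by simp
  moreover have "1 - \<mu>\<^sup>2 \<le> 1" by simp
  ultimately have n\<epsilon>1: "real n * \<epsilon>\<^sup>2 < 1" by linarith
  obtain g' where g': "compactly_supported n g'" "cs_degree n g' = cs_degree n g"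
    "\<And>x. x \<in> Rn n \<Longrightarrow> g' (f x) = g' x"
    and g'n: "\<And>x. x \<in> Rn n \<Longrightarrow> g' x = north n \<Longrightarrow> g x n > 0 \<and> (\<forall>i<n. \<bar>g x i\<bar> \<le> \<epsilon>)"
    and g'f: "\<And>x j. x \<in> Rn n \<Longrightarrow> j < p \<Longrightarrow> (f ^^ j) x \<in> cube n a (r a) \<Longrightarrow> (f ^^ j) x \<notin> open_cube n a (r a) \<Longrightarrow> g' x \<noteq> north n"
  proof (rule perturb_off_orbit_of_frontier[OF g _ rp[OF insertI1] \<epsilon>0 n\<epsilon>1, of a], goal_cases)
    case (1 x)
    show ?case by (rule gf[OF 1(2)])
  next
    case (2 x i j)
    show ?case by (rule disj[OF insertI1 2(2-)])
  next
    case (3 g')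
    show ?case by (rule that[OF 3(2-)])
  qed
  have nor': "\<exists>b\<in>insert a J. \<exists>j<p. (f ^^ j) x \<in> open_cube n b (r b)" if x: "x \<in> Rn n" "g' x = north n" for x
  proof -
    have "(\<Sum>i<n. (g x i)\<^sup>2) \<le> (\<Sum>i<n. \<epsilon>\<^sup>2)"
    proof (rule sum_mono)
      fix i assume "i \<in> {..<n}"
      then have "\<bar>g x i\<bar> \<le> \<bar>\<epsilon>\<bar>" using g'n[OF x] \<epsilon>0 by auto
      then show "(g x i)\<^sup>2 \<le> \<epsilon>\<^sup>2" by (simp only: abs_le_square_iff)
    qed
    then have "(g x n)\<^sup>2 > \<mu>\<^sup>2"
      using gS[OF x(1)] n\<epsilon> by (simp add: topspace_nsphere flip: lessThan_Suc_atMost)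
    then have "g x n > \<mu>" using g'n[OF x] by (simp add: power2_less_imp_less)
    then have "x \<in> ?U" using \<nu>(3)[OF x(1)] \<mu>(3) by force
    then show ?thesis using x(1) by auto
  qed
  let ?Fr = "\<Union>j\<in>{..<p}. {x \<in> Rn n. (f ^^ j) x \<in> cube n a (r a)} \<inter> {x \<in> Rn n. (f ^^ j) x \<notin> open_cube n a (r a)}"
  have "open (- ?Fr)"
    by (intro open_Compl closed_UN finite_lessThan ballI closed_Int closed_complement_iter_cube closed_iter_vimage
      compact_imp_closed[OF compact_cube])
  moreover have "x \<in> - ?Fr" if "x \<in> Rn n" "g' x = north n" for x using g'f that by auto
  ultimately obtain \<nu>' where \<nu>': "-1 \<le> \<nu>'" "\<nu>' < 1" "\<And>x. x \<in> Rn n \<Longrightarrow> x \<notin> - ?Fr \<Longrightarrow> g' x n \<le> \<nu>'"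
    using compactly_supported_last_coord_bound[OF g'(1), of "- ?Fr"] by blast
  define g'' where "g'' = (\<lambda>x. sphere_collapse n \<nu>' (g' x))"
  have g'': "compactly_supported n g''" "cs_degree n g'' = cs_degree n g"
    unfolding g''_def using cs_degree_collapse[OF g'(1) \<nu>'(1,2)] g'(2) by auto
  have g''f: "g'' (f x) = g'' x" if "x \<in> Rn n" for x using g'(3)[OF that] by (simp add: g''_def)
  have front: "g'' x = south n" if "x \<in> Rn n" "j < p" "(f ^^ j) x \<in> cube n a (r a)" "(f ^^ j) x \<notin> open_cube n a (r a)" for x j
  proof -
    have "g' x n \<le> \<nu>'" by (rule \<nu>'(3)) (use that in auto)
    then show ?thesis unfolding g''_def by (rule sphere_collapse_south[OF _ \<nu>'(2)])
  qed
  have g''n: "g' x = north n" if "x \<in> Rn n" "g'' x = north n" for x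
  proof (rule sphere_collapse_eq_north[OF _ \<nu>'(1,2)])
    show "g' x \<in> topspace (nsphere n)" using g'(1) that(1) unfolding compactly_supported_iff by blast
    show "sphere_collapse n \<nu>' (g' x) = north n" using that(2) by (simp add: g''_def)
  qed
  let ?rest = "\<lambda>x. if \<forall>j<p. (f ^^ j) x \<notin> cube n a (r a) then g'' x else south n"
  have disj': "i = j" if "x \<in> Rn n" "i < p" "j < p" "(f ^^ i) x \<in> cube n a (r a)" "(f ^^ j) x \<in> cube n a (r a)" for x i j
    using disj[of a x i j] that sub by blast
  have rest: "compactly_supported n ?rest" "int p dvd cs_degree n g'' - cs_degree n ?rest"
    using degree_remove_orbit_of_cube[OF g''(1) g''f front disj'] by auto
  have "int p dvd cs_degree n ?rest"
  proof (rule insert.IH[OF rest(1)])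
    fix x assume x: "x \<in> Rn n"
    show "?rest (f x) = ?rest x"
      using ex_iter_shift[OF x, of "cube n a (r a)"] g''f[OF x] by auto
  next
    fix x assume x: "x \<in> Rn n" and "?rest x = north n"
    then have *: "\<forall>j<p. (f ^^ j) x \<notin> cube n a (r a)" "g'' x = north n"
      by (auto simp: north_def south_def fun_eq_iff split: if_splits)
    then obtain b j where b: "b \<in> insert a J" "j < p" "(f ^^ j) x \<in> open_cube n b (r b)"
      using nor'[OF x g''n[OF x]] by blast
    moreover have "b \<noteq> a" using *(1) b by (force simp: open_cube_def cube_def)
    ultimately show "\<exists>a\<in>J. \<exists>j<p. (f ^^ j) x \<in> open_cube n a (r a)" by blast
  next
    fix b assume "b \<in> J"
    then show "r b > 0" by (intro rp insertI2)
  next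
    fix b x i j
    assume "b \<in> J" "x \<in> Rn n" "i < p" "j < p" "(f ^^ i) x \<in> cube n b (2 * r b)" "(f ^^ j) x \<in> cube n b (2 * r b)"
    then show "i = j" by (intro disj[of b x i j] insertI2)
  qed
  from dvd_add[OF rest(2) this] have "int p dvd cs_degree n g''" by (simp only: diff_add_cancel)
  then show ?case by (simp only: g''(2))
qed

end

text \<open>
  If \<open>f^j\<close> and \<open>f^p\<close> fix \<open>x\<close> for coprime \<open>j\<close> and \<open>p\<close>, so does \<open>f\<close>.
\<close>

lemma prime_iterate_free:
  fixes f :: "'a \<Rightarrow> 'a"
  assumes "prime (p::nat)" "(f ^^ p) x = x" "f x \<noteq> x" "0 < j" "j < p"
  shows "(f ^^ j) x \<noteq> x"
proof
  assume jx: "(f ^^ j) x = x"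
  have pow: "(f ^^ (k * m)) x = x" if "(f ^^ k) x = x" for k m
    by (induction m) (use that in \<open>simp_all add: funpow_add\<close>)
  have "coprime j p"
    using assms(1,4,5) by (metis coprime_commute nat_dvd_not_less prime_imp_coprime)
  then obtain k where "[j * k = Suc 0] (mod p)" using cong_solve_coprime_nat by blast
  then have "[j * k = 1] (mod p)" by simp
  moreover have "j * k \<ge> 1"
  proof (rule ccontr)
    assume "\<not> ?thesis"
    then have "j * k = 0" by linarith
    then have "[0 = 1] (mod p)" using \<open>[j * k = 1] (mod p)\<close> by (simp only:)
    then show False using assms(1) prime_gt_1_nat[of p] by (simp add: cong_def)
  qed
  ultimately obtain m where "j * k = 1 + p * m"
    using cong_le_nat[of 1 "j * k" p] by (auto simp: cong_sym_eq mult.commute)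
  then have "(f ^^ (1 + p * m)) x = x" using pow[OF jx, of k] by simp
  then have "f x = x" using pow[OF assms(2), of m] by simp
  then show False using assms(3) by simp
qed

text \<open>
  The average \<open>h\<close> of the iterates is \<open>f\<close>-invariant and the identity on fixed points; so a point
  \<open>x0\<close> that is moved has only moved points in its preimage under \<open>h\<close>, and their orbits are free since
  \<open>p\<close> is prime. Thus \<open>p\<close> divides the degree of \<open>g\<close>, which is a bump around \<open>x0\<close> composed with
  \<open>h\<close>. But this degree is 1, as \<open>h\<close> is at bounded distance from the identity.
\<close>

lemma (in periodic_displacement) prime_period_imp_identity:
  assumes p: "prime p" and x0: "x0 \<in> Rn n"
  shows "f x0 = x0"
proof (rule ccontr)
  assume ne: "f x0 \<noteq> x0"
  define h where "h = (\<lambda>x i. (\<Sum>j<p. (f ^^ j) x i) / real p)"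
  define g where "g = (\<lambda>x. bump n (\<lambda>i. h x i - x0 i))"
  have hc: "continuous_on (Rn n) (\<lambda>x. h x i)" for i
    unfolding h_def using p0
    by (intro continuous_intros orbit_sum_continuous[where \<phi> = "\<lambda>x. x i"] continuous_on_subset[OF continuous_on_product_coordinates]) auto
  have hf: "h (f x) = h x" if "x \<in> Rn n" for x
    unfolding h_def using sum_iter_shift[OF that, where \<phi> = "\<lambda>x. x _"] by simp
  have hdisp: "\<bar>h x i - x i\<bar> \<le> real p * M" if "x \<in> Rn n" "i < n" for x i
  proof -
    have "h x i - x i = (\<Sum>j<p. (f ^^ j) x i - x i) / real p"
      using p0 by (simp add: h_def sum_subtractf diff_divide_distrib)
    also have "\<bar>\<dots>\<bar> \<le> (\<Sum>j<p. \<bar>(f ^^ j) x i - x i\<bar>) / real p"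
      by (simp add: divide_right_mono sum_abs)
    also have "\<dots> \<le> (\<Sum>j<p. real p * M) / real p"
    proof (intro divide_right_mono sum_mono)
      fix j assume "j \<in> {..<p}"
      then have "real j * M \<le> real p * M" using M_nonneg by (intro mult_right_mono) auto
      then show "\<bar>(f ^^ j) x i - x i\<bar> \<le> real p * M" using iter_disp[OF that, of j] by linarith
    qed simp
    also have "\<dots> = real p * M" using p0 by simp
    finally show ?thesis .
  qed
  have hfix: "h x = x" if "f x = x" for x
  proof -
    have "(f ^^ j) x = x" for j by (induction j) (use that in auto)
    then show ?thesis using p0 by (simp add: h_def)
  qed
  have hRn: "h x \<in> Rn n" if "x \<in> Rn n" for x
    using iter_Rn[OF that] by (auto simp: Rn_iff h_def)
  \<comment> \<open>The straight-line homotopy from \<open>h - x0\<close> to the identity shows that \<open>g\<close> has degree 1.\<close>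
  let ?P = "prod_topology (top_of_set {0..1::real}) (Euclidean_space n)"
  let ?G = "\<lambda>z. bump n (\<lambda>i. (1 - fst z) * (h (snd z) i - x0 i) + fst z * snd z i)"
  have cE: "continuous_map (Euclidean_space n) euclideanreal h" if "continuous_on (Rn n) h" for h
    using that by (subst Euclidean_space_eq_top_of_set) simp
  have c1: "continuous_map ?P euclideanreal (\<lambda>z. h (snd z) i)" for i
    using continuous_map_compose[OF continuous_map_snd cE[OF hc], unfolded o_def] .
  have "continuous_on (Rn n) (\<lambda>x. x i)" for i
    by (rule continuous_on_subset[OF continuous_on_product_coordinates]) simp
  from continuous_map_compose[OF continuous_map_snd cE[OF this], unfolded o_def]
  have c2: "continuous_map ?P euclideanreal (\<lambda>z. snd z i)" for i .
  have c3: "continuous_map ?P euclideanreal fst"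
    using continuous_map_fst continuous_map_into_fulltopology by blast
  have G: "continuous_map ?P (nsphere n) ?G"
    by (intro continuous_map_bump continuous_intros c1 c2 c3)
  define R where "R = real p * M + (\<Sum>i<n. \<bar>x0 i\<bar>) + 1"
  have supp: "?G (t, x) = south n" if t: "0 \<le> t" "t \<le> 1" and x: "x \<in> Rn n" "\<exists>i<n. R < \<bar>x i\<bar>" for t x
  proof -
    obtain i where i: "i < n" "R < \<bar>x i\<bar>" using x(2) by blast
    have "\<bar>x0 i\<bar> \<le> (\<Sum>i<n. \<bar>x0 i\<bar>)" using i(1) by (intro member_le_sum) auto
    then have "\<bar>h x i - x0 i - x i\<bar> \<le> R - 1" using hdisp[OF x(1) i(1)] unfolding R_def by linarith
    then have "\<bar>1 - t\<bar> * \<bar>h x i - x0 i - x i\<bar> \<le> 1 * (R - 1)" using t by (intro mult_mono) auto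
    then have "\<bar>(1 - t) * (h x i - x0 i - x i)\<bar> \<le> R - 1" by (simp add: abs_mult)
    moreover have "(1 - t) * (h x i - x0 i) + t * x i = x i + (1 - t) * (h x i - x0 i - x i)"
      by (simp add: algebra_simps)
    ultimately have "\<bar>(1 - t) * (h x i - x0 i) + t * x i\<bar> \<ge> 1" using i(2) by linarith
    then show ?thesis by (intro bump_far[OF i(1)]) simp
  qed
  note H = compactly_supported_homotopy[OF G supp]
  have G0: "(\<lambda>x. ?G (0, x)) = g" and G1: "(\<lambda>x. ?G (1, x)) = bump n"
    by (simp_all add: g_def fun_eq_iff)
  have g: "compactly_supported n g" by (rule H(1)[unfolded G0])
  have deg: "cs_degree n g = 1" using H(3)[unfolded G0 G1] cs_degree_bump by (rule trans)
  \<comment> \<open>The preimage \<open>Z\<close> of the north pole consists of points of free orbits.\<close>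
  define Z where "Z = {x \<in> Rn n. g x = north n}"
  have Zne: "f x \<noteq> x" if "x \<in> Z" for x
  proof
    assume fx: "f x = x"
    have x: "x \<in> Rn n" "g x = north n" using that by (auto simp: Z_def)
    have "h x i = x0 i" if "i < n" for i
      using bump_eq_north[OF x(2)[unfolded g_def] that] by simp
    then have "h x = x0" by (intro Rn_eqI[OF hRn[OF x(1)] x0])
    then show False using hfix[OF fx] fx ne by simp
  qed
  have free: "\<exists>r>0. \<forall>j y. 0 < j \<longrightarrow> j < p \<longrightarrow> y \<in> cube n x (2 * r) \<longrightarrow> (f ^^ j) y \<notin> cube n x (2 * r)" if x: "x \<in> Z" for x
  proof -
    have xR: "x \<in> Rn n" using x by (simp add: Z_def)
    have "\<exists>r>0. \<forall>y. y \<in> cube n x r \<longrightarrow> (f ^^ j) y \<notin> cube n x r" if j: "0 < j" "j < p" for j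
    proof -
      have "(f ^^ j) x \<noteq> x"
        by (rule prime_iterate_free[OF p f_period[OF xR] Zne[OF x] j])
      then obtain i where i: "i < n" "(f ^^ j) x i \<noteq> x i"
        using Rn_eqI[OF iter_Rn[OF xR] xR, of j] by blast
      define d where "d = \<bar>(f ^^ j) x i - x i\<bar>"
      have d: "d > 0" using i(2) by (simp add: d_def)
      have cont: "continuous_on (Rn n) (\<lambda>y. \<bar>(f ^^ j) y i - y i\<bar>)"
        by (intro continuous_intros continuous_on_coord[OF iter_cont] continuous_on_subset[OF continuous_on_product_coordinates]) auto
      have "openin (top_of_set (Rn n)) (Rn n \<inter> (\<lambda>y. \<bar>(f ^^ j) y i - y i\<bar>) -` {d/2<..})"
        by (rule continuous_openin_preimage_gen[OF cont]) simp
      then obtain U where U: "open U" "Rn n \<inter> (\<lambda>y. \<bar>(f ^^ j) y i - y i\<bar>) -` {d/2<..} = Rn n \<inter> U"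
        unfolding openin_open by blast
      have "x \<in> U" using U(2) xR d unfolding d_def by auto
      then obtain r where r: "r > 0" "cube n x r \<subseteq> U" using open_contains_cube[OF U(1) _ xR] by blast
      have "(f ^^ j) y \<notin> cube n x (min r (d/4))" if y: "y \<in> cube n x (min r (d/4))" for y
      proof
        assume fy: "(f ^^ j) y \<in> cube n x (min r (d/4))"
        have "y \<in> cube n x r" using y by (auto simp: cube_def)
        then have "y \<in> Rn n \<inter> U" using r(2) by (auto simp: cube_def)
        then have "\<bar>(f ^^ j) y i - y i\<bar> > d / 2" using U(2) by auto
        moreover have "\<bar>y i - x i\<bar> \<le> d/4" "\<bar>(f ^^ j) y i - x i\<bar> \<le> d/4"
          using y fy i(1) by (auto simp: cube_def)
        ultimately show False by linarith
      qed
      then show ?thesis using r(1) d by (intro exI[of _ "min r (d/4)"]) auto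
    qed
    then obtain \<rho> where \<rho>: "\<And>j. 0 < j \<Longrightarrow> j < p \<Longrightarrow> \<rho> j > 0"
      "\<And>j y. 0 < j \<Longrightarrow> j < p \<Longrightarrow> y \<in> cube n x (\<rho> j) \<Longrightarrow> (f ^^ j) y \<notin> cube n x (\<rho> j)" by metis
    define r where "r = Min (insert 1 (\<rho> ` {0<..<p})) / 2"
    have r: "r > 0" "\<And>j. 0 < j \<Longrightarrow> j < p \<Longrightarrow> 2 * r \<le> \<rho> j"
      unfolding r_def using \<rho>(1) by (auto simp: Min_gr_iff)
    have mono: "cube n x (2 * r) \<subseteq> cube n x (\<rho> j)" if "0 < j" "j < p" for j
      using r(2)[OF that] by (auto simp: cube_def intro: order_trans)
    show ?thesis using r(1) \<rho>(2) mono by (intro exI[of _ r]) blast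
  qed
  then obtain r where r: "\<And>x. x \<in> Z \<Longrightarrow> r x > 0"
    "\<And>x j y. x \<in> Z \<Longrightarrow> 0 < j \<Longrightarrow> j < p \<Longrightarrow> y \<in> cube n x (2 * r x) \<Longrightarrow> (f ^^ j) y \<notin> cube n x (2 * r x)"
    by metis
  have cZ: "compact Z"
  proof -
    obtain R where R: "\<And>x. x \<in> Rn n \<Longrightarrow> \<exists>i<n. R < \<bar>x i\<bar> \<Longrightarrow> g x = south n"
      and gc: "continuous_on (Rn n) g"
      using g unfolding compactly_supported_iff by blast
    have "closed (g -` {north n} \<inter> Rn n)"
      using continuous_on_closed_vimage[OF closed_Rn, of n g] gc closed_singleton by blast
    then have "closed {x \<in> Rn n. g x \<in> {north n}}"
      by (simp add: vimage_def Int_def conj_commute)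
    then have "compact (cube n (\<lambda>i. 0) R \<inter> {x \<in> Rn n. g x \<in> {north n}})"
      by (intro compact_Int_closed compact_cube)
    moreover have "x \<in> cube n (\<lambda>i. 0) R" if "x \<in> Rn n" "g x = north n" for x
    proof (rule ccontr)
      assume "x \<notin> cube n (\<lambda>i. 0) R"
      then have "\<exists>i<n. R < \<bar>x i\<bar>" using that(1) by (auto simp: cube_def not_le)
      then have "north n = south n" using R[OF that(1)] that(2) by simp
      from fun_cong[OF this, of n] show False by (simp add: north_def south_def)
    qed
    then have "cube n (\<lambda>i. 0) R \<inter> {x \<in> Rn n. g x \<in> {north n}} = Z" unfolding Z_def by auto
    ultimately show ?thesis by simp
  qed
  have ZZ: "Z \<subseteq> (\<Union>x\<in>Z. {y. \<forall>i<n. \<bar>y i - x i\<bar> < r x})" using r(1) by auto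
  obtain J where J: "J \<subseteq> Z" "finite J" "Z \<subseteq> (\<Union>x\<in>J. {y. \<forall>i<n. \<bar>y i - x i\<bar> < r x})"
    by (rule compactE_image[OF cZ open_cube_ambient ZZ])
  have iter_add: "(f ^^ (j - i)) ((f ^^ i) x) = (f ^^ j) x" if "i \<le> j" for i j x
    using that by (metis comp_apply funpow_add le_add_diff_inverse2)
  have "int p dvd cs_degree n g"
  proof (rule period_dvd_degree[OF J(2) g])
    show "g (f x) = g x" if "x \<in> Rn n" for x using hf[OF that] by (simp add: g_def)
    show "r a > 0" if "a \<in> J" for a using that J(1) r(1) by blast
    show "i = j" if a: "a \<in> J" "x \<in> Rn n" "i < p" "j < p"
      "(f ^^ i) x \<in> cube n a (2 * r a)" "(f ^^ j) x \<in> cube n a (2 * r a)" for a x i j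
    proof (rule ccontr)
      assume "i \<noteq> j"
      then consider "i < j" | "j < i" by linarith
      then show False
      proof cases
        case 1
        then have "(f ^^ (j - i)) ((f ^^ i) x) \<notin> cube n a (2 * r a)"
          using a J(1) by (intro r(2)) auto
        then show False using a iter_add[of i j x] 1 by simp
      next
        case 2
        then have "(f ^^ (i - j)) ((f ^^ j) x) \<notin> cube n a (2 * r a)"
          using a J(1) by (intro r(2)) auto
        then show False using a iter_add[of j i x] 2 by simp
      qed
    qed
    show "\<exists>a\<in>J. \<exists>j<p. (f ^^ j) x \<in> open_cube n a (r a)" if x: "x \<in> Rn n" "g x = north n" for x
    proof -
      have "x \<in> Z" using x by (simp add: Z_def)
      then obtain a where "a \<in> J" "\<forall>i<n. \<bar>x i - a i\<bar> < r a" using J(3) by blast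
      then show ?thesis using p0 x(1) by (intro bexI[of _ a] exI[of _ 0]) (auto simp: open_cube_def)
    qed
  qed
  then have "int p dvd 1" using deg by simp
  then show False using prime_gt_1_nat[OF p] by simp
qed

text \<open>
  If \<open>p\<close> is a prime factor of the period \<open>s\<close>, then the power \<open>f^(s/p)\<close> has period \<open>p\<close>, hence is the
  identity, and \<open>f\<close> has the smaller period \<open>s/p\<close>.
\<close>

theorem periodic_bounded_displacement_imp_identity:
  assumes n: "n \<ge> 2" and f: "continuous_on (Rn n) f" "\<And>x. x \<in> Rn n \<Longrightarrow> f x \<in> Rn n"
    and disp: "\<And>x i. x \<in> Rn n \<Longrightarrow> i < n \<Longrightarrow> \<bar>f x i - x i\<bar> \<le> M"
    and s: "s > 0" "\<And>x. x \<in> Rn n \<Longrightarrow> (f ^^ s) x = x" and x: "x \<in> Rn n"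
  shows "f x = x"
  using f disp s x
proof (induction s arbitrary: f M x rule: less_induct)
  case (less s)
  show ?case
  proof (cases "s = 1")
    case True
    then show ?thesis using less.prems(5)[OF less.prems(6)] by simp
  next
    case False
    then obtain p where p: "prime p" "p dvd s" using prime_factor_nat by blast
    then obtain m where m: "s = m * p" by (metis dvd_def mult.commute)
    have m0: "m > 0" "m < s" using m less.prems(4) prime_gt_1_nat[OF p(1)] by auto
    have im: "(f ^^ j) y \<in> Rn n" if "y \<in> Rn n" for y j
      by (induction j) (use that less.prems(2) in auto)
    have ic: "continuous_on (Rn n) (f ^^ j)" for j
    proof (induction j)
      case (Suc j)
      have "continuous_on (Rn n) (\<lambda>x. f ((f ^^ j) x))"
        by (rule continuous_on_compose2[OF less.prems(1) Suc]) (auto intro: im)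
      then show ?case by (simp add: o_def)
    qed (auto simp: continuous_on_id id_def)
    have idisp: "\<bar>(f ^^ j) y i - y i\<bar> \<le> real j * M" if "y \<in> Rn n" "i < n" for y i j
    proof (induction j)
      case (Suc j)
      have "\<bar>f ((f ^^ j) y) i - (f ^^ j) y i\<bar> \<le> M" using less.prems(3) im that by blast
      then show ?case using Suc by (simp add: algebra_simps)
    qed simp
    interpret P: periodic_displacement n p "f ^^ m" "real m * M"
    proof
      show "((f ^^ m) ^^ p) y = y" if "y \<in> Rn n" for y
        using less.prems(5)[OF that] by (simp add: m funpow_mult mult.commute)
    qed (use n prime_gt_0_nat[OF p(1)] ic im idisp in auto)
    have "(f ^^ m) y = y" if "y \<in> Rn n" for y
      by (rule P.prime_period_imp_identity[OF p(1) that])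
    then show ?thesis
      using less.IH[OF m0(2) less.prems(1) less.prems(2) less.prems(3) m0(1)] less.prems(6) by blast
  qed
qed

section \<open>Quotients of Euclidean space and lifting\<close>

definition int_shift :: "nat \<Rightarrow> (nat \<Rightarrow> int) \<Rightarrow> (nat \<Rightarrow> real) \<Rightarrow> nat \<Rightarrow> real" where
  "int_shift n z x = (\<lambda>i. if i < n then x i + of_int (z i) else 0)"

lemma int_shift_Rn [simp]: "int_shift n z x \<in> Rn n"
  by (simp add: int_shift_def Rn_iff)

lemma continuous_on_RnI:
  assumes "\<And>x e. x \<in> Rn n \<Longrightarrow> e > 0 \<Longrightarrow> \<exists>d>0. \<forall>y\<in>Rn n. (\<forall>i<n. \<bar>y i - x i\<bar> \<le> d) \<longrightarrow> \<bar>h y - h x\<bar> < (e::real)"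
  shows "continuous_on (Rn n) h"
  unfolding continuous_on_topological
proof (intro ballI allI impI)
  fix x B assume x: "x \<in> Rn n" and B: "open B" "h x \<in> B"
  then obtain e where e: "e > 0" "ball (h x) e \<subseteq> B" by (meson open_contains_ball)
  then obtain d where d: "d > 0" "\<forall>y\<in>Rn n. (\<forall>i<n. \<bar>y i - x i\<bar> \<le> d) \<longrightarrow> \<bar>h y - h x\<bar> < e"
    using assms[OF x] by blast
  let ?A = "{y :: nat \<Rightarrow> real. \<forall>i<n. \<bar>y i - x i\<bar> < d}"
  have "\<forall>y\<in>Rn n. y \<in> ?A \<longrightarrow> h y \<in> B"
    using d(2) e(2) by (auto simp: ball_def dist_real_def subset_iff abs_minus_commute less_imp_le)
  then show "\<exists>A. open A \<and> x \<in> A \<and> (\<forall>y\<in>Rn n. y \<in> A \<longrightarrow> h y \<in> B)"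
    using d(1) open_cube_ambient by (intro exI[of _ ?A]) auto
qed

text \<open>
  The quotient of \<open>\<real>^n\<close> by a discrete group containing the integer translations. The elements of
  \<open>\<Gamma>\<close> preserve every coordinate distance, as they consist of translations and sign changes, and
  points of the same orbit differ by at least 1/2 in some coordinate. Group axioms for \<open>\<Gamma>\<close> are
  consequences: being related by \<open>\<Gamma>\<close> is the kernel relation of \<open>q\<close>.
\<close>

locale flat_quotient =
  fixes n :: nat and Y :: "'b topology" and q :: "(nat \<Rightarrow> real) \<Rightarrow> 'b"
    and \<Gamma> :: "((nat \<Rightarrow> real) \<Rightarrow> nat \<Rightarrow> real) set"
  assumes q_cont: "continuous_map (Euclidean_space n) Y q"
    and q_open: "open_map (Euclidean_space n) Y q"
    and q_onto: "q ` Rn n = topspace Y"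
    and q_eq: "\<And>x y. x \<in> Rn n \<Longrightarrow> y \<in> Rn n \<Longrightarrow> q x = q y \<longleftrightarrow> (\<exists>\<gamma>\<in>\<Gamma>. y = \<gamma> x)"
    and \<Gamma>_Rn: "\<And>\<gamma> x. \<gamma> \<in> \<Gamma> \<Longrightarrow> x \<in> Rn n \<Longrightarrow> \<gamma> x \<in> Rn n"
    and \<Gamma>_iso: "\<And>\<gamma> x y i. \<gamma> \<in> \<Gamma> \<Longrightarrow> x \<in> Rn n \<Longrightarrow> y \<in> Rn n \<Longrightarrow> i < n \<Longrightarrow> \<bar>\<gamma> x i - \<gamma> y i\<bar> = \<bar>x i - y i\<bar>"
    and \<Gamma>_sep: "\<And>\<gamma> x. \<gamma> \<in> \<Gamma> \<Longrightarrow> x \<in> Rn n \<Longrightarrow> \<forall>i<n. \<bar>\<gamma> x i - x i\<bar> < 1/2 \<Longrightarrow> \<gamma> x = x"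
    and int_shift_\<Gamma>: "\<And>z. int_shift n z \<in> \<Gamma>"
begin

lemma q_in: "x \<in> Rn n \<Longrightarrow> q x \<in> topspace Y"
  using q_onto by blast

lemma q_shift: "x \<in> Rn n \<Longrightarrow> q (int_shift n z x) = q x"
  using q_eq[of x "int_shift n z x"] int_shift_\<Gamma> by auto

lemma same_fibre_close_eq:
  assumes "x \<in> Rn n" "y \<in> Rn n" "q x = q y" "\<And>i. i < n \<Longrightarrow> \<bar>x i - y i\<bar> < 1/2"
  shows "x = y"
proof -
  obtain \<gamma> where "\<gamma> \<in> \<Gamma>" "y = \<gamma> x" using assms q_eq by blast
  then show ?thesis using \<Gamma>_sep[of \<gamma> x] assms by (simp add: abs_minus_commute)
qed

definition is_lift :: "('b \<Rightarrow> 'b) \<Rightarrow> ((nat \<Rightarrow> real) \<Rightarrow> nat \<Rightarrow> real) \<Rightarrow> bool" where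
  "is_lift \<phi> f \<longleftrightarrow> continuous_on (Rn n) f \<and> (\<forall>x\<in>Rn n. f x \<in> Rn n \<and> q (f x) = \<phi> (q x))"

text \<open>
  Along the segment from \<open>a\<close> to \<open>x\<close> the distance of the two lifts is continuous, starts at 0 and
  cannot take values strictly between 0 and 1/2.
\<close>

lemma lifts_agree:
  assumes f: "continuous_on (Rn n) f" "\<And>x. x \<in> Rn n \<Longrightarrow> f x \<in> Rn n"
    and g: "continuous_on (Rn n) g" "\<And>x. x \<in> Rn n \<Longrightarrow> g x \<in> Rn n"
    and eq: "\<And>x. x \<in> Rn n \<Longrightarrow> q (f x) = q (g x)"
    and a: "a \<in> Rn n" "f a = g a" and x: "x \<in> Rn n"
  shows "f x = g x"
proof (rule ccontr)
  assume ne: "f x \<noteq> g x"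
  define c where "c = (\<lambda>t i. a i + t * (x i - a i))"
  have cR: "c t \<in> Rn n" for t using a(1) x by (simp add: c_def Rn_iff)
  define D where "D = (\<lambda>t. \<Sum>i<n. \<bar>f (c t) i - g (c t) i\<bar>)"
  have gap: "D t \<ge> 1/2" if "D t \<noteq> 0" for t
  proof -
    have "f (c t) \<noteq> g (c t)" using that by (auto simp: D_def)
    then have "\<not> (\<forall>i<n. \<bar>f (c t) i - g (c t) i\<bar> < 1/2)"
      using same_fibre_close_eq[OF f(2)[OF cR[of t]] g(2)[OF cR[of t]] eq[OF cR[of t]]] by metis
    then obtain i where i: "i < n" "\<not> \<bar>f (c t) i - g (c t) i\<bar> < 1/2" by auto
    have "\<bar>f (c t) i - g (c t) i\<bar> \<le> D t" unfolding D_def using i(1) by (intro member_le_sum) auto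
    then show ?thesis using i(2) by linarith
  qed
  have cc: "continuous_on {0..1} c"
    unfolding c_def by (intro continuous_on_coordI continuous_intros)
  have "continuous_on {0..1} (\<lambda>t. f (c t))" "continuous_on {0..1} (\<lambda>t. g (c t))"
    by (rule continuous_on_compose2[OF f(1) cc], use cR in blast, rule continuous_on_compose2[OF g(1) cc], use cR in blast)
  then have "continuous_on {0..1} D"
    unfolding D_def
    by (intro continuous_on_sum continuous_on_rabs continuous_on_diff) (erule continuous_on_coord)+
  moreover have D0: "D 0 = 0" using a(2) by (simp add: D_def c_def)
  moreover have "D 1 \<noteq> 0"
  proof
    assume "D 1 = 0"
    then have "\<bar>f x i - g x i\<bar> = 0" if "i < n" for i
      using that unfolding D_def c_def by (subst (asm) sum_nonneg_eq_0_iff) auto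
    then have "f x = g x" using f(2)[OF x] g(2)[OF x] by (intro Rn_eqI) auto
    then show False using ne by simp
  qed
  then have "D 1 \<ge> 1/2" by (rule gap)
  ultimately have "\<exists>t. 0 \<le> t \<and> t \<le> 1 \<and> D t = 1/4"
    by (intro IVT') auto
  then obtain t where "D t = 1/4" by blast
  then show False using gap[of t] by simp
qed

text \<open>
  Local lifting holds since \<open>q\<close> is open: a small ball around \<open>x\<close> is mapped by \<open>\<phi> \<circ> q\<close> into the
  image of a small ball, and \<open>\<Gamma>\<close> acts transitively on fibres by isometries. The
  radius can be chosen uniformly as integer translations bring every point into a compact cube.
\<close>

lemma uniform_local_lift:
  assumes \<phi>: "continuous_map Y Y \<phi>" and \<epsilon>: "\<epsilon> > 0"
  shows "\<exists>\<delta>>0. \<forall>x\<in>Rn n. \<forall>y\<in>Rn n. (\<forall>i<n. \<bar>y i - x i\<bar> \<le> \<delta>) \<longrightarrow>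
     (\<forall>e\<in>Rn n. q e = \<phi> (q x) \<longrightarrow> (\<exists>e'\<in>Rn n. q e' = \<phi> (q y) \<and> (\<forall>i<n. \<bar>e' i - e i\<bar> < \<epsilon>)))"
proof -
  define P where "P = (\<lambda>x \<rho>. \<forall>y\<in>cube n x (2 * \<rho>). \<forall>y'\<in>cube n x (2 * \<rho>).
     (\<forall>e\<in>Rn n. q e = \<phi> (q y) \<longrightarrow> (\<exists>e'\<in>Rn n. q e' = \<phi> (q y') \<and> (\<forall>i<n. \<bar>e' i - e i\<bar> < \<epsilon>))))"
  have "\<forall>x\<in>Rn n. \<exists>\<rho>. \<rho> > 0 \<and> P x \<rho>"
  proof
    fix x assume x: "x \<in> Rn n"
    have "\<phi> (q x) \<in> topspace Y" using \<phi> q_in[OF x] by (auto simp: continuous_map_def)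
    then obtain b where b: "q b = \<phi> (q x)" "b \<in> Rn n" unfolding q_onto[symmetric] by (metis imageE)
    have "openin (top_of_set (Rn n)) (open_cube n b (\<epsilon>/2))"
      unfolding open_cube_eq by (rule openin_open_Int[OF open_cube_ambient])
    then have "openin (Euclidean_space n) (open_cube n b (\<epsilon>/2))"
      by (simp only: Euclidean_space_eq_top_of_set[symmetric])
    then have "openin Y (q ` open_cube n b (\<epsilon>/2))" using q_open by (auto simp: open_map_def)
    moreover have "continuous_map (Euclidean_space n) Y (\<phi> \<circ> q)" by (rule continuous_map_compose[OF q_cont \<phi>])
    ultimately have "openin (Euclidean_space n) {y \<in> Rn n. (\<phi> \<circ> q) y \<in> q ` open_cube n b (\<epsilon>/2)}"
      by (rule openin_continuous_map_preimage[rotated])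
    then have "openin (top_of_set (Rn n)) {y \<in> Rn n. (\<phi> \<circ> q) y \<in> q ` open_cube n b (\<epsilon>/2)}"
      by (simp only: Euclidean_space_eq_top_of_set[symmetric])
    then obtain U where U: "open U" "{y \<in> Rn n. (\<phi> \<circ> q) y \<in> q ` open_cube n b (\<epsilon>/2)} = Rn n \<inter> U"
      unfolding openin_open by blast
    have "b \<in> open_cube n b (\<epsilon>/2)" using b(2) \<epsilon> by (simp add: open_cube_def)
    then have "x \<in> U" using U(2) x b(1)[symmetric] by auto
    then obtain \<rho> where \<rho>: "\<rho> > 0" "cube n x \<rho> \<subseteq> U" using open_contains_cube[OF U(1) _ x] by blast
    have fib: "\<exists>c\<in>open_cube n b (\<epsilon>/2). \<phi> (q y) = q c" if "y \<in> cube n x \<rho>" for y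
    proof -
      have "y \<in> Rn n \<inter> U" using that \<rho>(2) by (auto simp: cube_def)
      then show ?thesis unfolding U(2)[symmetric] by auto
    qed
    have "\<exists>e'\<in>Rn n. q e' = \<phi> (q y') \<and> (\<forall>i<n. \<bar>e' i - e i\<bar> < \<epsilon>)"
      if y: "y \<in> cube n x \<rho>" "y' \<in> cube n x \<rho>" and e: "e \<in> Rn n" "q e = \<phi> (q y)" for y y' e
    proof -
      from fib[OF y(1)] obtain c where c: "c \<in> open_cube n b (\<epsilon>/2)" "\<phi> (q y) = q c" by blast
      from fib[OF y(2)] obtain c' where c': "c' \<in> open_cube n b (\<epsilon>/2)" "\<phi> (q y') = q c'" by blast
      have cR: "c \<in> Rn n" "c' \<in> Rn n" using c c' by (auto simp: open_cube_def)
      have "q c = q e" using e c by simp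
      then obtain \<gamma> where \<gamma>: "\<gamma> \<in> \<Gamma>" "e = \<gamma> c" using q_eq[OF cR(1) e(1)] by blast
      have "q (\<gamma> c') = q c'" using q_eq[OF cR(2) \<Gamma>_Rn[OF \<gamma>(1) cR(2)]] \<gamma>(1) by auto
      moreover have "\<bar>\<gamma> c' i - e i\<bar> < \<epsilon>" if i: "i < n" for i
      proof -
        have "\<bar>c' i - b i\<bar> < \<epsilon>/2" "\<bar>c i - b i\<bar> < \<epsilon>/2" using c(1) c'(1) i by (auto simp: open_cube_def)
        then have "\<bar>c' i - c i\<bar> < \<epsilon>" by linarith
        then show ?thesis using \<Gamma>_iso[OF \<gamma>(1) cR(2,1) i] \<gamma>(2) by simp
      qed
      ultimately show ?thesis using \<Gamma>_Rn[OF \<gamma>(1) cR(2)] c'(2) by (intro bexI[of _ "\<gamma> c'"]) auto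
    qed
    then have "P x (\<rho>/2)" by (simp add: P_def)
    then show "\<exists>\<rho>. \<rho> > 0 \<and> P x \<rho>" using \<rho>(1) by (intro exI[of _ "\<rho>/2"]) simp
  qed
  then obtain \<rho> where \<rho>': "\<forall>x\<in>Rn n. \<rho> x > 0 \<and> P x (\<rho> x)" by (metis bchoice)
  have \<rho>: "\<And>x. x \<in> Rn n \<Longrightarrow> \<rho> x > 0"
    "\<And>x y y' e. x \<in> Rn n \<Longrightarrow> y \<in> cube n x (2 * \<rho> x) \<Longrightarrow> y' \<in> cube n x (2 * \<rho> x) \<Longrightarrow> e \<in> Rn n \<Longrightarrow> q e = \<phi> (q y) \<Longrightarrow>
       \<exists>e'\<in>Rn n. q e' = \<phi> (q y') \<and> (\<forall>i<n. \<bar>e' i - e i\<bar> < \<epsilon>)"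
    using \<rho>' by (auto simp: P_def)
  let ?C = "cube n (\<lambda>i. 0) 1"
  have CR: "?C \<subseteq> Rn n" by (auto simp: cube_def)
  have "?C \<subseteq> (\<Union>x\<in>?C. {y. \<forall>i<n. \<bar>y i - x i\<bar> < \<rho> x})"
  proof
    fix x assume x: "x \<in> ?C"
    then have "\<rho> x > 0" using \<rho>(1) CR by blast
    then show "x \<in> (\<Union>x\<in>?C. {y. \<forall>i<n. \<bar>y i - x i\<bar> < \<rho> x})" using x by (intro UN_I[of x]) auto
  qed
  then obtain J where J: "J \<subseteq> ?C" "finite J" "?C \<subseteq> (\<Union>x\<in>J. {y. \<forall>i<n. \<bar>y i - x i\<bar> < \<rho> x})"
    by (rule compactE_image[OF compact_cube open_cube_ambient])
  define \<delta> where "\<delta> = Min (insert 1 (\<rho> ` J))"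
  have \<delta>: "\<delta> > 0" "\<And>a. a \<in> J \<Longrightarrow> \<delta> \<le> \<rho> a"
    unfolding \<delta>_def using J(1,2) \<rho>(1) CR by (auto simp: Min_gr_iff subset_iff)
  show ?thesis
  proof (intro exI[of _ \<delta>] conjI \<delta>(1) ballI impI)
    fix x y e assume x: "x \<in> Rn n" and y: "y \<in> Rn n" and xy: "\<forall>i<n. \<bar>y i - x i\<bar> \<le> \<delta>"
      and e: "e \<in> Rn n" "q e = \<phi> (q x)"
    define z where "z = (\<lambda>i. - \<lfloor>x i\<rfloor>)"
    let ?x = "int_shift n z x" and ?y = "int_shift n z y"
    have "\<bar>?x i\<bar> \<le> 1" if "i < n" for i
      using that by (simp add: int_shift_def z_def) linarith
    then have "?x \<in> ?C" by (simp add: cube_def)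
    then obtain a where a: "a \<in> J" "\<forall>i<n. \<bar>?x i - a i\<bar> < \<rho> a" using J(3) by blast
    have aR: "a \<in> Rn n" using a(1) J(1) CR by blast
    have "\<bar>?x i - a i\<bar> \<le> 2 * \<rho> a \<and> \<bar>?y i - a i\<bar> \<le> 2 * \<rho> a" if i: "i < n" for i
    proof -
      have "\<bar>?x i - a i\<bar> < \<rho> a" using a(2) i by blast
      moreover have "\<bar>?y i - ?x i\<bar> \<le> \<rho> a" using xy i \<delta>(2)[OF a(1)] by (auto simp: int_shift_def intro: order_trans)
      ultimately show ?thesis by linarith
    qed
    then have "?x \<in> cube n a (2 * \<rho> a)" "?y \<in> cube n a (2 * \<rho> a)" by (auto simp: cube_def)
    from \<rho>(2)[OF aR this e(1)] e(2)
    show "\<exists>e'\<in>Rn n. q e' = \<phi> (q y) \<and> (\<forall>i<n. \<bar>e' i - e i\<bar> < \<epsilon>)"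
      using q_shift[OF x] q_shift[OF y] by simp
  qed
qed

text \<open>
  Extend the lift from the cube of radius \<open>k \<delta>\<close> to that of radius \<open>(k+1) \<delta>\<close>, using the point of the
  fibre over \<open>\<phi> (q x)\<close> that is close to the value already chosen at the nearest point of the smaller cube.
  Since clamping to a cube is a contraction, close points keep close values, and since close
  points of a fibre coincide, the extension agrees with the old lift on the smaller cube.
\<close>

lemma ex_lift:
  assumes \<phi>: "continuous_map Y Y \<phi>"
  shows "\<exists>f. is_lift \<phi> f"
proof -
  \<comment> \<open>Chains of up to four steps of size 1/16 stay below 1/2, where points of a fibre coincide.\<close>
  define near where "near = (\<lambda>(d::real) x y. \<forall>i<n. \<bar>y i - x i :: real\<bar> \<le> d)"
  have "\<exists>\<delta>>0. \<forall>x\<in>Rn n. \<forall>y\<in>Rn n. near \<delta> x y \<longrightarrow>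
     (\<forall>e\<in>Rn n. q e = \<phi> (q x) \<longrightarrow> (\<exists>e'\<in>Rn n. q e' = \<phi> (q y) \<and> (\<forall>i<n. \<bar>e' i - e i\<bar> < 1/16)))"
    unfolding near_def by (rule uniform_local_lift[OF \<phi>]) simp
  then obtain \<delta> where \<delta>: "\<delta> > 0"
    and step: "\<And>x y e. x \<in> Rn n \<Longrightarrow> y \<in> Rn n \<Longrightarrow> near \<delta> x y \<Longrightarrow> e \<in> Rn n \<Longrightarrow> q e = \<phi> (q x) \<Longrightarrow>
       \<exists>e'\<in>Rn n. q e' = \<phi> (q y) \<and> (\<forall>i<n. \<bar>e' i - e i\<bar> < 1/16)"
    by blast
  let ?B = "\<lambda>k::nat. cube n (\<lambda>i. 0) (real k * \<delta>)"
  have BR: "x \<in> Rn n" if "x \<in> ?B k" for x k using that by (simp add: cube_def)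
  define clamp where "clamp = (\<lambda>(k::nat) x (i::nat). max (- (real k * \<delta>)) (min (real k * \<delta>) (x i)) :: real)"
  have clampB: "clamp k x \<in> ?B k" if "x \<in> Rn n" for k x
    using that \<delta> by (auto simp: clamp_def cube_def Rn_iff min_def max_def mult_le_0_iff)
  have clamp_id: "clamp k x = x" if "x \<in> ?B k" for k x
  proof (rule Rn_eqI[OF BR[OF clampB[OF BR[OF that]]] BR[OF that]])
    fix i assume "i < n"
    then have "\<bar>x i\<bar> \<le> real k * \<delta>" using that by (simp add: cube_def)
    then show "clamp k x i = x i" unfolding clamp_def by linarith
  qed
  have clamp_near: "near \<delta> (clamp k x) x" if "x \<in> ?B (Suc k)" for k x
    unfolding near_def
  proof (intro allI impI)
    fix i assume "i < n"
    then have "\<bar>x i\<bar> \<le> real (Suc k) * \<delta>" using that by (simp add: cube_def)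
    then have "\<bar>x i\<bar> \<le> real k * \<delta> + \<delta>" by (simp add: algebra_simps)
    moreover have "real k * \<delta> \<ge> 0" using \<delta> by simp
    ultimately show "\<bar>x i - clamp k x i\<bar> \<le> \<delta>" using \<delta> by (auto simp: clamp_def min_def max_def)
  qed
  have clamp_contr: "near \<delta> (clamp k x) (clamp k y)" if "near \<delta> x y" for k x y
    unfolding near_def
  proof (intro allI impI)
    fix i assume "i < n"
    then have "\<bar>y i - x i\<bar> \<le> \<delta>" using that by (simp add: near_def)
    then show "\<bar>clamp k y i - clamp k x i\<bar> \<le> \<delta>" unfolding clamp_def by linarith
  qed
  have "\<phi> (q (\<lambda>i. 0)) \<in> topspace Y"
    using \<phi> q_in[of "\<lambda>i. 0"] by (auto simp: continuous_map_def Rn_iff)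
  then obtain e0 where e0: "e0 \<in> Rn n" "q e0 = \<phi> (q (\<lambda>i. 0))" using q_onto by (metis imageE)
  define G where "G = rec_nat (\<lambda>x. e0) (\<lambda>k g x. SOME e. e \<in> Rn n \<and> q e = \<phi> (q x) \<and> (\<forall>i<n. \<bar>e i - g (clamp k x) i\<bar> < 1/16))"
  have G0: "G 0 = (\<lambda>x. e0)" by (simp add: G_def)
  have GSuc: "G (Suc k) x = (SOME e. e \<in> Rn n \<and> q e = \<phi> (q x) \<and> (\<forall>i<n. \<bar>e i - G k (clamp k x) i\<bar> < 1/16))" for k x
    by (simp add: G_def)
  have inv: "(\<forall>x\<in>?B k. G k x \<in> Rn n \<and> q (G k x) = \<phi> (q x)) \<and>
     (\<forall>x\<in>?B k. \<forall>y\<in>?B k. near \<delta> x y \<longrightarrow> (\<forall>i<n. \<bar>G k y i - G k x i\<bar> < 1/16))" for k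
  proof (induction k)
    case 0
    have "x = (\<lambda>i. 0)" if "x \<in> ?B 0" for x
      using that by (intro Rn_eqI[of _ n]) (auto simp: cube_def Rn_iff)
    then show ?case using e0 by (auto simp: G0)
  next
    case (Suc k)
    have ex: "G (Suc k) x \<in> Rn n \<and> q (G (Suc k) x) = \<phi> (q x) \<and> (\<forall>i<n. \<bar>G (Suc k) x i - G k (clamp k x) i\<bar> < 1/16)"
      if x: "x \<in> ?B (Suc k)" for x
    proof -
      have c: "clamp k x \<in> ?B k" by (rule clampB[OF BR[OF x]])
      have "G k (clamp k x) \<in> Rn n" "q (G k (clamp k x)) = \<phi> (q (clamp k x))" using Suc c by blast+
      from step[OF BR[OF c] BR[OF x] clamp_near[OF x] this]
      have "\<exists>e. e \<in> Rn n \<and> q e = \<phi> (q x) \<and> (\<forall>i<n. \<bar>e i - G k (clamp k x) i\<bar> < 1/16)" by blast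
      from someI_ex[OF this] show ?thesis unfolding GSuc .
    qed
    moreover have "\<bar>G (Suc k) y i - G (Suc k) x i\<bar> < 1/16"
      if x: "x \<in> ?B (Suc k)" and y: "y \<in> ?B (Suc k)" and xy: "near \<delta> x y" and i: "i < n" for x y i
    proof -
      have "G (Suc k) x \<in> Rn n" "q (G (Suc k) x) = \<phi> (q x)" using ex[OF x] by blast+
      from step[OF BR[OF x] BR[OF y] xy this]
      obtain e where e: "e \<in> Rn n" "q e = \<phi> (q y)" "\<forall>i<n. \<bar>e i - G (Suc k) x i\<bar> < 1/16" by blast
      have "e = G (Suc k) y"
      proof (rule same_fibre_close_eq)
        show "e \<in> Rn n" "G (Suc k) y \<in> Rn n" "q e = q (G (Suc k) y)" using e ex[OF y] by auto
        fix j assume j: "j < n"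
        have "\<bar>G k (clamp k y) j - G k (clamp k x) j\<bar> < 1/16"
          using Suc clampB[OF BR[OF x]] clampB[OF BR[OF y]] clamp_contr[OF xy] j by blast
        moreover have "\<bar>G (Suc k) x j - G k (clamp k x) j\<bar> < 1/16" "\<bar>G (Suc k) y j - G k (clamp k y) j\<bar> < 1/16"
          using ex[OF x] ex[OF y] j by blast+
        moreover have "\<bar>e j - G (Suc k) x j\<bar> < 1/16" using e j by blast
        ultimately show "\<bar>e j - G (Suc k) y j\<bar> < 1/2" by linarith
      qed
      then show ?thesis using e(3) i by blast
    qed
    ultimately show ?case by blast
  qed
  have Bmono: "?B k \<subseteq> ?B l" if "k \<le> l" for k l
    using that \<delta> by (auto simp: cube_def intro: order_trans[OF _ mult_right_mono])
  have Gext: "G (Suc k) x = G k x" if x: "x \<in> ?B k" for k x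
  proof (rule same_fibre_close_eq)
    have x': "x \<in> ?B (Suc k)" using Bmono[of k "Suc k"] x by auto
    have g: "G k x \<in> Rn n" "q (G k x) = \<phi> (q x)" using inv[of k] x by blast+
    have "G (Suc k) x \<in> Rn n \<and> q (G (Suc k) x) = \<phi> (q x) \<and> (\<forall>i<n. \<bar>G (Suc k) x i - G k (clamp k x) i\<bar> < 1/16)"
      unfolding GSuc by (rule someI[of _ "G k x"]) (use g clamp_id[OF x] in simp)
    then show "G (Suc k) x \<in> Rn n" "q (G (Suc k) x) = q (G k x)" "G k x \<in> Rn n"
      "\<And>i. i < n \<Longrightarrow> \<bar>G (Suc k) x i - G k x i\<bar> < 1/2"
      using g clamp_id[OF x] by force+
  qed
  have Gext': "G (k + m) x = G k x" if x: "x \<in> ?B k" for k m x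
  proof (induction m)
    case (Suc m)
    have "x \<in> ?B (k + m)" using Bmono[of k "k + m"] x by auto
    then show ?case using Gext[of x "k + m"] Suc by simp
  qed simp
  have exB: "\<exists>k. x \<in> ?B k" if x: "x \<in> Rn n" for x
  proof -
    obtain k :: nat where k: "real k > (\<Sum>i<n. \<bar>x i\<bar>) / \<delta>" using reals_Archimedean2 by blast
    have "\<bar>x i\<bar> \<le> real k * \<delta>" if "i < n" for i
    proof -
      have "\<bar>x i\<bar> \<le> (\<Sum>i<n. \<bar>x i\<bar>)" using that by (intro member_le_sum) auto
      also have "\<dots> \<le> real k * \<delta>" using k \<delta> by (simp add: field_simps)
      finally show ?thesis .
    qed
    then show ?thesis using x by (auto simp: cube_def)
  qed
  define f where "f = (\<lambda>x. G (SOME k. x \<in> ?B k) x)"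
  have fG: "f x = G k x" if x: "x \<in> ?B k" for k x
  proof -
    define l where "l = (SOME k. x \<in> ?B k)"
    have l: "x \<in> ?B l" unfolding l_def by (rule someI[of "\<lambda>k. x \<in> ?B k", OF x])
    have "f x = G l x" by (simp add: f_def l_def)
    also have "\<dots> = G (l + k) x" using Gext'[OF l] by simp
    also have "\<dots> = G k x" using Gext'[OF x, of l] by (simp add: add.commute)
    finally show ?thesis .
  qed
  have fq: "f x \<in> Rn n" "q (f x) = \<phi> (q x)" if x: "x \<in> Rn n" for x
  proof -
    obtain k where k: "x \<in> ?B k" using exB[OF x] by blast
    show "f x \<in> Rn n" "q (f x) = \<phi> (q x)" using inv[of k] k fG[OF k] by auto
  qed
  have fnear: "\<bar>f y i - f x i\<bar> < 1/16" if x: "x \<in> Rn n" and y: "y \<in> Rn n" and xy: "near \<delta> x y" and i: "i < n" for x y i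
  proof -
    obtain k l where kl: "x \<in> ?B k" "y \<in> ?B l" using exB[OF x] exB[OF y] by blast
    have m: "x \<in> ?B (max k l)" "y \<in> ?B (max k l)"
      using Bmono[of k "max k l"] Bmono[of l "max k l"] kl by auto
    then show ?thesis using inv[of "max k l"] fG[OF m(1)] fG[OF m(2)] xy i by auto
  qed
  have "continuous_on (Rn n) f"
  proof (rule continuous_on_coordI, rule continuous_on_RnI)
    fix i x and e :: real assume x: "x \<in> Rn n" and e: "e > 0"
    define \<epsilon> where "\<epsilon> = min e (1/16)"
    obtain d where d: "d > 0" "\<And>x y u. x \<in> Rn n \<Longrightarrow> y \<in> Rn n \<Longrightarrow> \<forall>i<n. \<bar>y i - x i\<bar> \<le> d \<Longrightarrow> u \<in> Rn n \<Longrightarrow> q u = \<phi> (q x) \<Longrightarrow>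
       \<exists>e'\<in>Rn n. q e' = \<phi> (q y) \<and> (\<forall>i<n. \<bar>e' i - u i\<bar> < \<epsilon>)"
      using uniform_local_lift[OF \<phi>, of \<epsilon>] e unfolding \<epsilon>_def by (auto simp: Ball_def)
    have "\<bar>f y i - f x i\<bar> < e" if y: "y \<in> Rn n" and xy: "\<forall>i<n. \<bar>y i - x i\<bar> \<le> min d \<delta>" for y
    proof (cases "i < n")
      case True
      have "\<forall>i<n. \<bar>y i - x i\<bar> \<le> d" "near \<delta> x y" using xy by (auto simp: near_def)
      from d(2)[OF x y this(1) fq[OF x]]
      obtain u where u: "u \<in> Rn n" "q u = \<phi> (q y)" "\<forall>i<n. \<bar>u i - f x i\<bar> < \<epsilon>" by blast
      have "u = f y"
      proof (rule same_fibre_close_eq[OF u(1) fq(1)[OF y]])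
        show "q u = q (f y)" using u(2) fq(2)[OF y] by simp
        fix j assume j: "j < n"
        have "\<bar>u j - f x j\<bar> < 1/16" using u(3) j by (auto simp: \<epsilon>_def)
        moreover have "\<bar>f y j - f x j\<bar> < 1/16" by (rule fnear[OF x y \<open>near \<delta> x y\<close> j])
        ultimately show "\<bar>u j - f y j\<bar> < 1/2" by linarith
      qed
      then show ?thesis using u(3) True by (auto simp: \<epsilon>_def)
    next
      case False
      then show ?thesis using fq(1)[OF x] fq(1)[OF y] e by (simp add: Rn_iff)
    qed
    then show "\<exists>d>0. \<forall>y\<in>Rn n. (\<forall>i<n. \<bar>y i - x i\<bar> \<le> d) \<longrightarrow> \<bar>f y i - f x i\<bar> < e"
      using d(1) \<delta> by (intro exI[of _ "min d \<delta>"]) auto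
  qed
  then show ?thesis unfolding is_lift_def using fq by blast
qed

end

section \<open>Finite abelian actions on flat quotients\<close>

lemma int_zero_if_all_powers_dvd:
  fixes d :: int assumes "\<And>a::nat. a \<ge> 2 \<Longrightarrow> 3 ^ a dvd d" shows "d = 0"
proof (rule ccontr)
  assume "d \<noteq> 0"
  let ?a = "nat \<bar>d\<bar> + 2"
  have "(3::int) ^ ?a \<le> \<bar>d\<bar>" using assms[of ?a] \<open>d \<noteq> 0\<close> by (intro zdvd_imp_le) auto
  moreover have "nat \<bar>d\<bar> < 3 ^ nat \<bar>d\<bar>" by (rule less_exp[THEN less_le_trans]) (simp add: power_mono)
  then have "\<bar>d\<bar> < 3 ^ nat \<bar>d\<bar>" by (metis nat_less_iff abs_ge_zero of_nat_less_iff of_nat_numeral of_nat_power nat_0_le)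
  moreover have "(3::int) ^ nat \<bar>d\<bar> \<le> 3 ^ ?a" by (intro power_increasing) auto
  ultimately show False by linarith
qed

lemma additive_scale:
  fixes C :: "(nat \<Rightarrow> int) \<Rightarrow> nat \<Rightarrow> int"
  assumes add: "\<And>u v. C (\<lambda>i. u i + v i) = (\<lambda>i. C u i + C v i)"
  shows "C (\<lambda>i. c * u i) = (\<lambda>i. c * C u i)"
proof -
  have z: "C (\<lambda>i. 0) i = 0" for i
    using fun_cong[OF add[of "\<lambda>i. 0" "\<lambda>i. 0"], of i] by simp
  have nat: "C (\<lambda>i. int m * u i) = (\<lambda>i. int m * C u i)" for m u
  proof (induction m)
    case 0
    then show ?case using z by (simp add: fun_eq_iff)
  next
    case (Suc m)
    then show ?case using add[of u "\<lambda>i. int m * u i"] by (simp add: algebra_simps)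
  qed
  have neg: "C (\<lambda>i. - u i) i = - C u i" for u i
    using fun_cong[OF add[of u "\<lambda>i. - u i"], of i] z by simp
  show ?thesis
  proof (cases "c \<ge> 0")
    case True
    then show ?thesis using nat[of "nat c"] by simp
  next
    case False
    then have "c = - int (nat (- c))" by simp
    then obtain m where m: "c = - int m" by blast
    have "C (\<lambda>i. c * u i) i = c * C u i" for i
      using neg[of "\<lambda>i. int m * u i" i] nat[of m u] by (simp add: m)
    then show ?thesis by blast
  qed
qed

text \<open>
  For a matrix \<open>B = 1 + D\<close> of prime order \<open>l\<close> with \<open>D\<close> divisible by \<open>3^a\<close>, the binomial expansion of
  \<open>B^l = 1\<close> gives that \<open>l D\<close> is divisible by \<open>3^(2a)\<close>. The prime \<open>l\<close> absorbs at most one factor 3, so \<open>D\<close>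
  is divisible by \<open>3^(2a-1)\<close>, which is more than \<open>3^a\<close> as soon as \<open>a \<ge> 2\<close>; this is why the
  congruence is modulo 9. Hence \<open>D = 0\<close>. Matrices appear as additive maps on integer
  vectors.
\<close>

lemma minkowski_congruence:
  fixes B :: "(nat \<Rightarrow> int) \<Rightarrow> nat \<Rightarrow> int"
  assumes add: "\<And>u v. B (\<lambda>i. u i + v i) = (\<lambda>i. B u i + B v i)"
    and cong: "\<And>v i. 9 dvd B v i - v i"
    and per: "s > 0" "\<And>v. (B ^^ s) v = v"
  shows "B v = v"
proof -
  have prime_case: "C v = v"
    if add: "\<And>u v. C (\<lambda>i. u i + v i) = (\<lambda>i. C u i + C v i)"
      and cong: "\<And>v i. 9 dvd C v i - v i"
      and l: "prime l" "\<And>v. (C ^^ l) v = v" for C :: "(nat \<Rightarrow> int) \<Rightarrow> nat \<Rightarrow> int" and l v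
  proof -
    have scale: "C (\<lambda>i. int c * u i) = (\<lambda>i. int c * C u i)" for c u
      by (rule additive_scale[where C = C, OF add])
    have step: "3 ^ (a + 1) dvd C v i - v i" if a: "a \<ge> 2" and IH: "\<And>v i. 3 ^ a dvd C v i - v i" for a v i
    proof -
      let ?q = "(3::int) ^ a"
      have "\<exists>w. \<forall>i. C v i - v i = ?q * w i" by (rule choice[OF allI, OF IH[of v, unfolded dvd_def]])
      then obtain w where w: "\<And>i. C v i - v i = ?q * w i" by blast
      have "\<exists>w'. \<forall>i. C w i - w i = ?q * w' i" by (rule choice[OF allI, OF IH[of w, unfolded dvd_def]])
      then obtain w' where w': "\<And>i. C w i - w i = ?q * w' i" by blast
      have "\<exists>y. \<forall>i. (C ^^ j) v i = v i + int j * (?q * w i) + ?q * ?q * y i" for j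
      proof (induction j)
        case 0
        show ?case by (intro exI[of _ "\<lambda>i. 0"]) simp
      next
        case (Suc j)
        then obtain y where y: "\<And>i. (C ^^ j) v i = v i + int j * (?q * w i) + ?q * ?q * y i" by blast
        have "(C ^^ j) v = (\<lambda>i. v i + (int (j * 3 ^ a) * w i + int (3 ^ a * 3 ^ a) * y i))"
          using y by (simp add: fun_eq_iff algebra_simps)
        then have "C ((C ^^ j) v) i = C v i + (int (j * 3 ^ a) * C w i + int (3 ^ a * 3 ^ a) * C y i)" for i
          by (simp only: add scale)
        moreover have "C v i = v i + ?q * w i" "C w i = w i + ?q * w' i" for i
          using w[of i] w'[of i] by (simp_all add: algebra_simps)
        ultimately have "(C ^^ Suc j) v i = v i + int (Suc j) * (?q * w i) + ?q * ?q * (int j * w' i + C y i)" for i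
          by (simp add: algebra_simps)
        then show ?case by (intro exI[of _ "\<lambda>i. int j * w' i + C y i"] allI)
      qed
      then obtain y where y: "\<And>i. (C ^^ l) v i = v i + int l * (?q * w i) + ?q * ?q * y i" by blast
      have "v i = v i + int l * (?q * w i) + ?q * ?q * y i" using y[of i] l(2)[of v] by simp
      then have "int l * (?q * w i) = ?q * ?q * (- y i)" unfolding mult_minus_right by linarith
      then have "?q * (int l * w i) = ?q * (?q * (- y i))" by (simp only: ac_simps)
      then have "int l * w i = ?q * (- y i)" by (subst (asm) mult_cancel_left) auto
      then have dv: "?q dvd int l * w i" by (rule dvdI)
      have "3 dvd w i"
      proof (cases "l = 3")
        case True
        have "(3::int) ^ 2 dvd ?q" using a by (rule le_imp_power_dvd)
        then have "(9::int) dvd 3 * w i" using dv True by (auto intro: dvd_trans)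
        then show ?thesis by presburger
      next
        case False
        have "\<not> l dvd 3"
        proof
          assume d: "l dvd 3"
          then have "l \<le> 3" by (intro dvd_imp_le) auto
          then have "l = 2" using False prime_ge_2_nat[OF l(1)] by linarith
          then show False using d by simp
        qed
        then have "coprime l 3" by (rule prime_imp_coprime[OF l(1)])
        then have "coprime (3::int) (int l)" by (metis coprime_commute coprime_int_iff of_nat_numeral)
        moreover have "(3::int) dvd ?q" using a by (simp add: dvd_power)
        then have "3 dvd int l * w i" using dv by (rule dvd_trans)
        ultimately show ?thesis by (simp add: coprime_dvd_mult_right_iff)
      qed
      then show ?thesis unfolding w by (simp add: mult.commute mult_dvd_mono)
    qed
    have all: "3 ^ a dvd C v i - v i" if "a \<ge> 2" for a v i
      using that
    proof (induction a arbitrary: v i rule: nat_induct_at_least)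
      case base
      then show ?case using cong by simp
    next
      case (Suc a)
      show ?case using step[OF Suc.hyps Suc.IH] by simp
    qed
    have "C v i - v i = 0" for i by (rule int_zero_if_all_powers_dvd) (rule all)
    then show ?thesis by (auto simp: fun_eq_iff)
  qed
  have iter: "(\<forall>u v. (B ^^ j) (\<lambda>i. u i + v i) = (\<lambda>i. (B ^^ j) u i + (B ^^ j) v i)) \<and> (\<forall>v i. 9 dvd (B ^^ j) v i - v i)" for j
  proof (induction j)
    case (Suc j)
    have "9 dvd (B ^^ Suc j) v i - v i" for v i
      using dvd_add[of 9 "B ((B ^^ j) v) i - (B ^^ j) v i" "(B ^^ j) v i - v i"] cong Suc by simp
    then show ?case using Suc add by simp
  qed simp
  show ?thesis using per
  proof (induction s arbitrary: v rule: less_induct)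
    case (less s)
    show ?case
    proof (cases "s = 1")
      case True
      then show ?thesis using less.prems(2)[of v] by simp
    next
      case False
      then obtain l where l: "prime l" "l dvd s" using prime_factor_nat by blast
      then obtain m where m: "s = m * l" by (metis dvd_def mult.commute)
      have m0: "m > 0" "m < s" using m less.prems(1) prime_gt_1_nat[OF l(1)] by auto
      have "((B ^^ m) ^^ l) v = v" for v using less.prems(2)[of v] by (simp add: m funpow_mult mult.commute)
      note per = this
      have "(B ^^ m) v = v" for v
        by (rule prime_case[OF _ _ l(1) per]) (use iter[of m] in blast)+
      then show ?thesis by (rule less.IH[OF m0(2,1)])
    qed
  qed
qed

lemma int_shift_add: "int_shift n z (int_shift n w x) = int_shift n (\<lambda>i. z i + w i) x"
  by (auto simp: int_shift_def fun_eq_iff)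

lemma int_shift_zero: "x \<in> Rn n \<Longrightarrow> int_shift n (\<lambda>i. 0) x = x"
  by (auto simp: int_shift_def fun_eq_iff Rn_iff)

lemma int_shift_eq_iff: "int_shift n z x = int_shift n w x \<longleftrightarrow> (\<forall>i<n. z i = w i)"
  by (auto simp: int_shift_def fun_eq_iff)

lemma int_shift_cong: "(\<And>i. i < n \<Longrightarrow> z i = w i) \<Longrightarrow> int_shift n z = int_shift n w"
  by (auto simp: int_shift_def fun_eq_iff)

context flat_quotient
begin

lemma zero_Rn: "(\<lambda>i. 0) \<in> Rn n"
  by (simp add: Rn_iff)

lemma \<Gamma>_cont: assumes "\<gamma> \<in> \<Gamma>" shows "continuous_on (Rn n) \<gamma>"
proof (rule continuous_on_coordI, rule continuous_on_RnI)
  fix i x and e :: real assume x: "x \<in> Rn n" and e: "e > 0"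
  have "\<bar>\<gamma> y i - \<gamma> x i\<bar> < e" if "y \<in> Rn n" "\<forall>i<n. \<bar>y i - x i\<bar> \<le> e/2" for y
  proof (cases "i < n")
    case True
    then have "\<bar>y i - x i\<bar> \<le> e/2" using that by blast
    then show ?thesis using \<Gamma>_iso[OF assms that(1) x True] e by simp
  next
    case False
    then show ?thesis using \<Gamma>_Rn[OF assms x] \<Gamma>_Rn[OF assms that(1)] e by (simp add: Rn_iff)
  qed
  then show "\<exists>d>0. \<forall>y\<in>Rn n. (\<forall>i<n. \<bar>y i - x i\<bar> \<le> d) \<longrightarrow> \<bar>\<gamma> y i - \<gamma> x i\<bar> < e"
    using e by (intro exI[of _ "e/2"]) auto
qed

lemma q_\<Gamma>: "\<gamma> \<in> \<Gamma> \<Longrightarrow> x \<in> Rn n \<Longrightarrow> q (\<gamma> x) = q x"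
  using q_eq[of x "\<gamma> x"] \<Gamma>_Rn by auto

lemma lift_D:
  assumes "is_lift \<phi> f"
  shows "continuous_on (Rn n) f" "\<And>x. x \<in> Rn n \<Longrightarrow> f x \<in> Rn n" "\<And>x. x \<in> Rn n \<Longrightarrow> q (f x) = \<phi> (q x)"
  using assms unfolding is_lift_def by auto

lemma \<Gamma>_lift: "\<gamma> \<in> \<Gamma> \<Longrightarrow> is_lift (\<lambda>y. y) \<gamma>"
  unfolding is_lift_def using \<Gamma>_cont \<Gamma>_Rn q_\<Gamma> by blast

lemma lift_cong: "is_lift \<phi> f \<Longrightarrow> (\<And>y. y \<in> topspace Y \<Longrightarrow> \<phi> y = \<psi> y) \<Longrightarrow> is_lift \<psi> f"
  unfolding is_lift_def using q_in by metis

lemma lift_compose: "is_lift \<phi> f \<Longrightarrow> is_lift \<psi> g \<Longrightarrow> is_lift (\<lambda>y. \<phi> (\<psi> y)) (\<lambda>x. f (g x))"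
  unfolding is_lift_def by (auto intro!: continuous_on_compose2[of "Rn n" f "Rn n" g])

text \<open>
  Adjust the first lift by an element of \<open>\<Gamma>\<close> so that it agrees with the second at the origin.
\<close>

lemma two_lifts:
  assumes f: "is_lift \<phi> f" and g: "is_lift \<phi> g"
  obtains \<gamma> where "\<gamma> \<in> \<Gamma>" "\<And>x. x \<in> Rn n \<Longrightarrow> g x = \<gamma> (f x)"
proof -
  have "q (f (\<lambda>i. 0)) = q (g (\<lambda>i. 0))" using lift_D(3)[OF f zero_Rn] lift_D(3)[OF g zero_Rn] by simp
  from iffD1[OF q_eq[OF lift_D(2)[OF f zero_Rn] lift_D(2)[OF g zero_Rn]] this]
  obtain \<gamma> where \<gamma>: "\<gamma> \<in> \<Gamma>" "g (\<lambda>i. 0) = \<gamma> (f (\<lambda>i. 0))" by (rule bexE)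
  note c = lift_compose[OF \<Gamma>_lift[OF \<gamma>(1)] f]
  have "g x = \<gamma> (f x)" if "x \<in> Rn n" for x
    by (rule lifts_agree[OF lift_D(1,2)[OF g] lift_D(1,2)[OF c] _ zero_Rn \<gamma>(2) that])
       (simp_all add: lift_D(3)[OF g] lift_D(3)[OF c])
  with \<gamma>(1) show thesis by (rule that)
qed

lemma id_lift: "is_lift (\<lambda>y. y) (\<lambda>x. x)"
  unfolding is_lift_def by (auto simp: continuous_on_id)

lemma lift_of_id:
  assumes "is_lift (\<lambda>y. y) f"
  shows "\<exists>\<gamma>\<in>\<Gamma>. \<forall>x\<in>Rn n. f x = \<gamma> x"
proof -
  obtain \<gamma> where "\<gamma> \<in> \<Gamma>" "\<And>x. x \<in> Rn n \<Longrightarrow> f x = \<gamma> x" by (rule two_lifts[OF id_lift assms]) (rule that)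
  then show ?thesis by (intro bexI[of _ \<gamma>] ballI)
qed

lemma \<Gamma>_inverse:
  assumes "\<gamma> \<in> \<Gamma>"
  obtains \<gamma>' where "\<gamma>' \<in> \<Gamma>" "\<And>x. x \<in> Rn n \<Longrightarrow> \<gamma>' (\<gamma> x) = x"
proof -
  obtain \<gamma>' where "\<gamma>' \<in> \<Gamma>" "\<And>x. x \<in> Rn n \<Longrightarrow> x = \<gamma>' (\<gamma> x)"
    by (rule two_lifts[OF \<Gamma>_lift[OF assms] id_lift]) (rule that)
  then show thesis by (intro that[of \<gamma>']) auto
qed

definition commutes_with_shifts :: "((nat \<Rightarrow> real) \<Rightarrow> nat \<Rightarrow> real) \<Rightarrow> bool" where
  "commutes_with_shifts f \<longleftrightarrow> (\<forall>z. \<forall>x\<in>Rn n. f (int_shift n z x) = int_shift n z (f x))"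

text \<open>
  The displacement of such a map is periodic, hence determined on a compact cube.
\<close>

lemma commutes_with_shifts_displacement:
  assumes f: "continuous_on (Rn n) f" and c: "commutes_with_shifts f"
  obtains M where "\<And>x i. x \<in> Rn n \<Longrightarrow> i < n \<Longrightarrow> \<bar>f x i - x i\<bar> \<le> M"
proof -
  let ?C = "cube n (\<lambda>i. 0) 1"
  have CR: "?C \<subseteq> Rn n" by (auto simp: cube_def)
  have "continuous_on ?C (\<lambda>x. \<Sum>i<n. \<bar>f x i - x i\<bar>)"
    by (intro continuous_on_sum continuous_on_rabs continuous_on_diff
        continuous_on_subset[OF continuous_on_product_coordinates])
       (auto intro: continuous_on_coord continuous_on_subset[OF f CR])
  then have "bounded ((\<lambda>x. \<Sum>i<n. \<bar>f x i - x i\<bar>) ` ?C)"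
    by (intro compact_imp_bounded compact_continuous_image compact_cube)
  then obtain M where M: "\<And>x. x \<in> ?C \<Longrightarrow> \<bar>\<Sum>i<n. \<bar>f x i - x i\<bar>\<bar> \<le> M"
    by (auto simp: bounded_iff)
  show thesis
  proof (rule that[of M])
    fix x i assume x: "x \<in> Rn n" and i: "i < n"
    define z where "z = (\<lambda>i. - \<lfloor>x i\<rfloor>)"
    let ?x = "int_shift n z x"
    have "\<bar>?x i\<bar> \<le> 1" if "i < n" for i
      using that by (simp add: int_shift_def z_def) linarith
    then have "?x \<in> ?C" by (simp add: cube_def)
    then have "\<bar>\<Sum>i<n. \<bar>f ?x i - ?x i\<bar>\<bar> \<le> M" by (rule M)
    moreover have "\<bar>f ?x i - ?x i\<bar> \<le> (\<Sum>i<n. \<bar>f ?x i - ?x i\<bar>)" using i by (intro member_le_sum) auto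
    moreover have "f ?x i - ?x i = f x i - x i"
      using c x i unfolding commutes_with_shifts_def by (simp add: int_shift_def)
    ultimately show "\<bar>f x i - x i\<bar> \<le> M" by linarith
  qed
qed

end

locale flat_action = flat_quotient n Y q \<Gamma> for n and Y :: "'b topology" and q \<Gamma> +
  fixes A :: "('g, 'c) monoid_scheme" (structure) and \<phi> and r :: nat
  assumes n2: "n \<ge> 2" and comm: "comm_group A" and fin: "finite (carrier A)" and r0: "r > 0"
    and exponent: "\<And>g. g \<in> carrier A \<Longrightarrow> g [^] r = \<one>"
    and faithful: "faithful_action A (topspace Y) \<phi>"
    and cont: "\<And>g. g \<in> carrier A \<Longrightarrow> continuous_map Y Y (\<phi> g)"
begin

sublocale comm_group A by (rule comm)
sublocale act: faithful_action A "topspace Y" \<phi> by (rule faithful)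

lemma \<phi>_one: "y \<in> topspace Y \<Longrightarrow> \<phi> \<one> y = y"
  using act.id_eq_one by (metis restrict_apply')

lemma lift_mult:
  assumes "g \<in> carrier A" "h \<in> carrier A" "is_lift (\<phi> g) f" "is_lift (\<phi> h) f'"
  shows "is_lift (\<phi> (g \<otimes> h)) (\<lambda>x. f (f' x))"
  by (rule lift_cong[OF lift_compose[OF assms(3,4)]]) (use act.composition_rule assms in auto)

lemma lift_one_iff: "is_lift (\<phi> \<one>) f \<longleftrightarrow> is_lift (\<lambda>y. y) f"
  using lift_cong[of "\<phi> \<one>" f "\<lambda>y. y"] lift_cong[of "\<lambda>y. y" f "\<phi> \<one>"] \<phi>_one by auto

lemma lift_power:
  assumes "g \<in> carrier A" "is_lift (\<phi> g) f" shows "is_lift (\<phi> (g [^] (j::nat))) (f ^^ j)"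
proof (induction j)
  case 0
  then show ?case using id_lift by (simp add: lift_one_iff id_def)
next
  case (Suc j)
  have "is_lift (\<phi> (g \<otimes> g [^] j)) (\<lambda>x. f ((f ^^ j) x))"
    by (rule lift_mult[OF assms(1) _ assms(2) Suc]) (use assms in simp)
  moreover have "g \<otimes> g [^] j = g [^] Suc j" using assms(1) by (metis nat_pow_Suc2)
  ultimately show ?case by (simp add: o_def)
qed

text \<open>
  A lift of the inverse, composed with \<open>f\<close>, is a lift of the identity and so an element of \<open>\<Gamma>\<close>,
  which can be divided out.
\<close>

lemma lift_inverse:
  assumes g: "g \<in> carrier A" and f: "is_lift (\<phi> g) f"
  obtains f' where "is_lift (\<phi> (inv g)) f'" "\<And>x. x \<in> Rn n \<Longrightarrow> f' (f x) = x" "\<And>x. x \<in> Rn n \<Longrightarrow> f (f' x) = x"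
proof -
  obtain f0 where f0: "is_lift (\<phi> (inv g)) f0" using ex_lift[OF cont[of "inv g"]] g by auto
  have "is_lift (\<lambda>y. y) (\<lambda>x. f0 (f x))"
    using lift_mult[OF _ g f0 f] g by (simp add: lift_one_iff)
  from lift_of_id[OF this] obtain \<gamma> where \<gamma>: "\<gamma> \<in> \<Gamma>" "\<And>x. x \<in> Rn n \<Longrightarrow> f0 (f x) = \<gamma> x" by blast
  obtain \<gamma>' where \<gamma>': "\<gamma>' \<in> \<Gamma>" "\<And>x. x \<in> Rn n \<Longrightarrow> \<gamma>' (\<gamma> x) = x" using \<Gamma>_inverse[OF \<gamma>(1)] by blast
  define f' where "f' = (\<lambda>x. \<gamma>' (f0 x))"
  have f': "is_lift (\<phi> (inv g)) f'"
    unfolding f'_def by (rule lift_compose[OF \<Gamma>_lift[OF \<gamma>'(1)] f0])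
  have left: "f' (f x) = x" if "x \<in> Rn n" for x using \<gamma>(2) \<gamma>'(2) that by (simp add: f'_def)
  have ff': "is_lift (\<lambda>y. y) (\<lambda>x. f (f' x))"
    using lift_mult[OF g _ f f'] g by (simp add: lift_one_iff)
  have "f (f' x) = x" if x: "x \<in> Rn n" for x
  proof (rule lifts_agree[OF lift_D(1,2)[OF ff'] lift_D(1,2)[OF id_lift]])
    show "f (\<lambda>i. 0) \<in> Rn n" by (rule lift_D(2)[OF f zero_Rn])
    show "f (f' (f (\<lambda>i. 0))) = f (\<lambda>i. 0)" using left[OF zero_Rn] by simp
  qed (use x lift_D(3)[OF ff'] in auto)
  then show thesis using that f' left by blast
qed

end

text \<open>
  Normality of the translations lets lifts act on \<open>\<int>^n\<close> by conjugation. The condition on squares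
  makes this linear action periodic, and the condition on centralizers pins down the lifts that act
  trivially up to a translation.
\<close>

locale flat_action_normal = flat_action +
  assumes norm: "\<And>g f z. g \<in> carrier A \<Longrightarrow> is_lift (\<phi> g) f \<Longrightarrow>
      \<exists>z'. \<forall>x\<in>Rn n. f (int_shift n z x) = int_shift n z' (f x)"
    and \<Gamma>_square: "\<And>\<gamma>. \<gamma> \<in> \<Gamma> \<Longrightarrow> \<exists>z. \<forall>x\<in>Rn n. \<gamma> (\<gamma> x) = int_shift n z x"
    and \<Gamma>_central: "\<And>\<gamma>. \<gamma> \<in> \<Gamma> \<Longrightarrow> commutes_with_shifts \<gamma> \<Longrightarrow> \<exists>z. \<forall>x\<in>Rn n. \<gamma> x = int_shift n z x"
begin

text \<open>
  The matrix by which conjugation with the lift \<open>f\<close> acts on the integer translations. It is the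
  identity on the coordinates from \<open>n\<close> on, which makes it an additive map of all integer sequences.
\<close>

definition lin :: "((nat \<Rightarrow> real) \<Rightarrow> nat \<Rightarrow> real) \<Rightarrow> (nat \<Rightarrow> int) \<Rightarrow> nat \<Rightarrow> int" where
  "lin f z = (\<lambda>i. if i < n then \<lfloor>f (int_shift n z (\<lambda>i. 0)) i - f (\<lambda>i. 0) i\<rfloor> else z i)"

lemma lin_shift:
  assumes "g \<in> carrier A" "is_lift (\<phi> g) f" "x \<in> Rn n"
  shows "f (int_shift n z x) = int_shift n (lin f z) (f x)"
proof -
  obtain z' where z': "\<forall>x\<in>Rn n. f (int_shift n z x) = int_shift n z' (f x)" using norm[OF assms(1,2)] by blast
  have "lin f z i = z' i" if "i < n" for i
    using z'[rule_format, OF zero_Rn] that by (simp add: lin_def int_shift_def)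
  then have "int_shift n (lin f z) = int_shift n z'" by (rule int_shift_cong)
  then show ?thesis using z' assms(3) by simp
qed

lemma lin_unique:
  assumes "g \<in> carrier A" "is_lift (\<phi> g) f" "x \<in> Rn n" "f (int_shift n z x) = int_shift n w (f x)" "i < n"
  shows "lin f z i = w i"
  using lin_shift[OF assms(1-3), of z] assms(4,5) by (metis int_shift_eq_iff)

lemma lin_add:
  assumes "g \<in> carrier A" "is_lift (\<phi> g) f"
  shows "lin f (\<lambda>i. u i + v i) = (\<lambda>i. lin f u i + lin f v i)"
proof
  fix i show "lin f (\<lambda>i. u i + v i) i = lin f u i + lin f v i"
  proof (cases "i < n")
    case True
    have "f (int_shift n (\<lambda>i. u i + v i) (\<lambda>i. 0)) = int_shift n (\<lambda>i. lin f u i + lin f v i) (f (\<lambda>i. 0))"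
      by (simp add: int_shift_add[symmetric] lin_shift[OF assms] zero_Rn)
    then show ?thesis using lin_unique[OF assms zero_Rn _ True] by blast
  qed (simp add: lin_def)
qed

lemma lin_compose:
  assumes g: "g \<in> carrier A" "is_lift (\<phi> g) f" and h: "h \<in> carrier A" "is_lift (\<phi> h) f'"
  shows "lin (\<lambda>x. f (f' x)) z = lin f (lin f' z)"
proof
  fix i show "lin (\<lambda>x. f (f' x)) z i = lin f (lin f' z) i"
  proof (cases "i < n")
    case True
    note c = lift_mult[OF g(1) h(1) g(2) h(2)]
    have "f (f' (int_shift n z (\<lambda>i. 0))) = int_shift n (lin f (lin f' z)) (f (f' (\<lambda>i. 0)))"
      by (simp add: lin_shift[OF g] lin_shift[OF h] zero_Rn lift_D(2)[OF h(2)])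
    then show ?thesis using lin_unique[OF _ c zero_Rn _ True] g(1) h(1) by simp
  qed (simp add: lin_def)
qed

lemma lin_id: "lin f z = z" if "\<And>x. x \<in> Rn n \<Longrightarrow> f x = int_shift n w x"
  using that[OF int_shift_Rn[of n z "\<lambda>i. 0"]] that[OF zero_Rn]
  by (auto simp: lin_def fun_eq_iff) (simp add: int_shift_def)

lemma lin_power:
  assumes "g \<in> carrier A" "is_lift (\<phi> g) f"
  shows "lin (f ^^ j) z = (lin f ^^ j) z"
proof (induction j)
  case 0
  show ?case using lin_id[of "\<lambda>x. x" "\<lambda>i. 0"] int_shift_zero by (simp add: id_def)
next
  case (Suc j)
  have "lin (\<lambda>x. f ((f ^^ j) x)) z = lin f (lin (f ^^ j) z)"
    by (rule lin_compose[OF assms _ lift_power[OF assms]]) (use assms in simp)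
  then show ?case using Suc by (simp add: o_def)
qed

text \<open>
  \<open>f^r\<close> is a lift of the identity, hence in \<open>\<Gamma>\<close>, and its square is a translation.
\<close>

lemma lin_periodic:
  assumes g: "g \<in> carrier A" "is_lift (\<phi> g) f"
  shows "(lin f ^^ (r * 2)) z = z"
proof -
  have "is_lift (\<lambda>y. y) (f ^^ r)" using lift_power[OF g, of r] exponent[OF g(1)] by (simp add: lift_one_iff)
  from lift_of_id[OF this] obtain \<gamma> where \<gamma>: "\<gamma> \<in> \<Gamma>" "\<And>x. x \<in> Rn n \<Longrightarrow> (f ^^ r) x = \<gamma> x" by blast
  obtain w where w: "\<forall>x\<in>Rn n. \<gamma> (\<gamma> x) = int_shift n w x" using \<Gamma>_square[OF \<gamma>(1)] by blast
  have "(f ^^ (r * 2)) x = int_shift n w x" if "x \<in> Rn n" for x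
    using \<gamma>(2)[OF that] \<gamma>(2)[OF \<Gamma>_Rn[OF \<gamma>(1) that]] w that
    by (simp add: mult_2_right funpow_add)
  then have "lin (f ^^ (r * 2)) z = z" by (rule lin_id)
  then show ?thesis using lin_power[OF g] by simp
qed

definition central_subgroup where
  "central_subgroup = {g \<in> carrier A. \<exists>f. is_lift (\<phi> g) f \<and> commutes_with_shifts f}"

lemma congruent_lin_imp_central:
  assumes g: "g \<in> carrier A" "is_lift (\<phi> g) f" and cong: "\<And>z i. 9 dvd lin f z i - z i"
  shows "g \<in> central_subgroup"
proof -
  have "lin f z = z" for z
    by (rule minkowski_congruence[where s = "r * 2"]) (use lin_add[OF g] cong lin_periodic[OF g] r0 in auto)
  then have "commutes_with_shifts f"
    unfolding commutes_with_shifts_def using lin_shift[OF g] by simp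
  then show ?thesis using g unfolding central_subgroup_def by blast
qed

text \<open>
  Additive maps are congruent modulo 9 if they are so on the standard basis.
\<close>

lemma lin_coords:
  assumes g: "g \<in> carrier A" "is_lift (\<phi> g) f" and h: "h \<in> carrier A" "is_lift (\<phi> h) f'"
    and eq: "\<And>i j. i < n \<Longrightarrow> j < n \<Longrightarrow> lin f (\<lambda>l. if l = j then 1 else 0) i mod 9 = lin f' (\<lambda>l. if l = j then 1 else 0) i mod 9"
  shows "9 dvd lin f' z i - lin f z i"
proof (cases "i < n")
  case i: True
  have part: "9 dvd lin f' (\<lambda>l. if l < m then z l else 0) i - lin f (\<lambda>l. if l < m then z l else 0) i" if "m \<le> n" for m
    using that
  proof (induction m)
    case 0
    have "lin f (\<lambda>l. 0) i = 0" "lin f' (\<lambda>l. 0) i = 0"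
      using fun_cong[OF lin_add[OF g, of "\<lambda>l. 0" "\<lambda>l. 0"], of i] fun_cong[OF lin_add[OF h, of "\<lambda>l. 0" "\<lambda>l. 0"], of i] by simp_all
    then show ?case by simp
  next
    case (Suc m)
    let ?e = "\<lambda>l. if l = m then 1 else 0 :: int"
    have split: "(\<lambda>l. if l < Suc m then z l else 0) = (\<lambda>l. (if l < m then z l else 0) + z m * ?e l)"
      by (auto simp: fun_eq_iff less_Suc_eq)
    have L: "lin F (\<lambda>l. if l < Suc m then z l else 0) i = lin F (\<lambda>l. if l < m then z l else 0) i + z m * lin F ?e i"
      if "g' \<in> carrier A" "is_lift (\<phi> g') F" for F g'
      unfolding split lin_add[OF that] additive_scale[where C = "lin F", OF lin_add[OF that]] ..
    have "9 dvd lin f' ?e i - lin f ?e i"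
      using eq[OF i, of m] Suc.prems by (simp add: mod_eq_dvd_iff dvd_diff_commute)
    then have "9 dvd z m * (lin f' ?e i - lin f ?e i)" by simp
    from dvd_add[OF Suc.IH this] Suc.prems show ?case
      unfolding L[OF g] L[OF h] by (simp add: algebra_simps)
  qed
  have "int_shift n z = int_shift n (\<lambda>l. if l < n then z l else 0)" by (rule int_shift_cong) simp
  then have "lin F z i = lin F (\<lambda>l. if l < n then z l else 0) i" for F using i by (simp add: lin_def)
  then show ?thesis using part[of n] by simp
qed (simp add: lin_def)

text \<open>
  Two elements of \<open>A\<close> whose matrices agree modulo 9 differ by an element whose matrix is congruent
  to 1 modulo 9, and that element is in \<open>central_subgroup\<close>.
\<close>

lemma card_le_central_subgroup: "card (carrier A) \<le> 9 ^ (n * n) * card central_subgroup"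
proof -
  have "\<forall>g\<in>carrier A. \<exists>f. is_lift (\<phi> g) f" using ex_lift[OF cont] by blast
  from bchoice[OF this] obtain F where F': "\<forall>g\<in>carrier A. is_lift (\<phi> g) (F g)" ..
  have F: "\<And>g. g \<in> carrier A \<Longrightarrow> is_lift (\<phi> g) (F g)" by (rule bspec[OF F'])
  define key where "key = (\<lambda>g. \<lambda>ij\<in>{..<n} \<times> {..<n}. lin (F g) (\<lambda>l. if l = snd ij then 1 else 0) (fst ij) mod 9)"
  have finC: "finite central_subgroup" unfolding central_subgroup_def using fin by simp
  have central: "inv g \<otimes> h \<in> central_subgroup" if g: "g \<in> carrier A" and h: "h \<in> carrier A" and k: "key g = key h" for g h
  proof -
    obtain f' where f': "is_lift (\<phi> (inv g)) f'" "\<And>x. x \<in> Rn n \<Longrightarrow> f' (F g x) = x"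
      "\<And>x. x \<in> Rn n \<Longrightarrow> F g (f' x) = x"
      by (rule lift_inverse[OF g F[OF g]]) (rule that)
    have ig: "inv g \<in> carrier A" using g by simp
    have "lin (\<lambda>x. f' (F h x)) z i - z i = lin f' (lin (F h) z) i - lin f' (lin (F g) z) i" for z i
    proof -
      have "lin (\<lambda>x. f' (F g x)) z = z"
        by (rule lin_id[of _ "\<lambda>i. 0"]) (simp add: f'(2) int_shift_zero)
      then have "lin f' (lin (F g) z) = z" using lin_compose[OF ig f'(1) g F[OF g]] by simp
      moreover have "lin (\<lambda>x. f' (F h x)) z = lin f' (lin (F h) z)" by (rule lin_compose[OF ig f'(1) h F[OF h]])
      ultimately show ?thesis by simp
    qed
    moreover have "9 dvd lin f' (lin (F h) z) i - lin f' (lin (F g) z) i" for z i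
    proof -
      have "lin (F g) (\<lambda>l. if l = b then 1 else 0) a mod 9 = lin (F h) (\<lambda>l. if l = b then 1 else 0) a mod 9"
        if "a < n" "b < n" for a b
        using fun_cong[OF k, of "(a, b)"] that by (simp add: key_def)
      then have "9 dvd lin (F h) z j - lin (F g) z j" for j
        by (rule lin_coords[OF g F[OF g] h F[OF h]])
      then have "\<exists>v. \<forall>j. lin (F h) z j - lin (F g) z j = 9 * v j"
        unfolding dvd_def by (intro choice allI)
      then obtain v where v: "\<And>j. lin (F h) z j - lin (F g) z j = 9 * v j" by blast
      have "lin (F h) z = (\<lambda>j. lin (F g) z j + 9 * v j)"
      proof
        fix j show "lin (F h) z j = lin (F g) z j + 9 * v j" using v[of j] by simp
      qed
      then have "lin f' (lin (F h) z) i = lin f' (lin (F g) z) i + 9 * lin f' v i"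
        by (simp only: lin_add[OF ig f'(1)] additive_scale[where C = "lin f'", OF lin_add[OF ig f'(1)]])
      then show ?thesis by simp
    qed
    ultimately have "9 dvd lin (\<lambda>x. f' (F h x)) z i - z i" for z i by simp
    then show ?thesis
      by (rule congruent_lin_imp_central[OF _ lift_mult[OF ig h f'(1) F[OF h]], rotated]) (use ig h in simp)
  qed
  have fibre: "card {g \<in> carrier A. key g = k} \<le> card central_subgroup" for k
  proof (cases "{g \<in> carrier A. key g = k} = {}")
    case False
    then obtain g where g: "g \<in> carrier A" "key g = k" by auto
    have "inj_on (\<lambda>h. inv g \<otimes> h) {h \<in> carrier A. key h = k}"
    proof (rule inj_onI)
      fix h h' assume "h \<in> {h \<in> carrier A. key h = k}" "h' \<in> {h \<in> carrier A. key h = k}" "inv g \<otimes> h = inv g \<otimes> h'"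
      then show "h = h'" using g(1) by simp
    qed
    moreover have "(\<lambda>h. inv g \<otimes> h) ` {h \<in> carrier A. key h = k} \<subseteq> central_subgroup"
    proof (rule image_subsetI)
      fix h assume "h \<in> {h \<in> carrier A. key h = k}"
      then show "inv g \<otimes> h \<in> central_subgroup" by (intro central[OF g(1)]) (simp_all add: g(2))
    qed
    ultimately show ?thesis using finC by (rule card_inj_on_le)
  next
    case True
    show ?thesis unfolding True by simp
  qed
  have "key ` carrier A \<subseteq> ({..<n} \<times> {..<n}) \<rightarrow>\<^sub>E {0..<9}"
  proof (rule image_subsetI)
    fix g
    show "key g \<in> ({..<n} \<times> {..<n}) \<rightarrow>\<^sub>E {0..<9}"
      unfolding key_def restrict_PiE_iff by simp
  qed
  then have "card (key ` carrier A) \<le> card (({..<n} \<times> {..<n}) \<rightarrow>\<^sub>E {0..<9::int})"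
    by (intro card_mono finite_PiE) auto
  also have "\<dots> = 9 ^ (n * n)" by (simp add: card_PiE)
  finally have ck: "card (key ` carrier A) \<le> 9 ^ (n * n)" .
  have U: "carrier A = (\<Union>k\<in>key ` carrier A. {g \<in> carrier A. key g = k})"
  proof (rule equalityI; rule subsetI)
    fix g assume "g \<in> carrier A"
    then show "g \<in> (\<Union>k\<in>key ` carrier A. {g \<in> carrier A. key g = k})"
      by (intro UN_I[of "key g"] imageI CollectI conjI refl)
  next
    fix g assume "g \<in> (\<Union>k\<in>key ` carrier A. {g \<in> carrier A. key g = k})"
    then show "g \<in> carrier A" by (elim UN_E CollectE conjE)
  qed
  have "card (carrier A) = card (\<Union>k\<in>key ` carrier A. {g \<in> carrier A. key g = k})"
    by (rule arg_cong[where f = card, OF U])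
  also have "\<dots> \<le> (\<Sum>k\<in>key ` carrier A. card {g \<in> carrier A. key g = k})"
    by (rule card_UN_le[OF finite_imageI[OF fin]])
  also have "\<dots> \<le> (\<Sum>k\<in>key ` carrier A. card central_subgroup)" by (intro sum_mono fibre)
  also have "\<dots> = card (key ` carrier A) * card central_subgroup" by simp
  also have "\<dots> \<le> 9 ^ (n * n) * card central_subgroup" using ck by (rule mult_right_mono) simp
  finally show ?thesis .
qed

lemma commutes_compose:
  assumes "commutes_with_shifts f" "commutes_with_shifts f'" "\<And>x. x \<in> Rn n \<Longrightarrow> f' x \<in> Rn n"
  shows "commutes_with_shifts (\<lambda>x. f (f' x))"
  using assms unfolding commutes_with_shifts_def by simp

lemma commutes_power:
  assumes "commutes_with_shifts f" "\<And>x. x \<in> Rn n \<Longrightarrow> f x \<in> Rn n"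
  shows "commutes_with_shifts (f ^^ j)"
proof (induction j)
  case (Suc j)
  have "(f ^^ j) x \<in> Rn n" if "x \<in> Rn n" for x by (induction j) (use assms(2) that in auto)
  from commutes_compose[OF assms(1) Suc this] show ?case by (simp add: o_def)
qed (simp add: commutes_with_shifts_def)

lemma commutes_inverse:
  assumes "commutes_with_shifts f" "\<And>x. x \<in> Rn n \<Longrightarrow> f' (f x) = x" "\<And>x. x \<in> Rn n \<Longrightarrow> f (f' x) = x"
    "\<And>x. x \<in> Rn n \<Longrightarrow> f' x \<in> Rn n"
  shows "commutes_with_shifts f'"
  unfolding commutes_with_shifts_def
proof (intro allI ballI)
  fix z x assume x: "x \<in> Rn n"
  have "f (int_shift n z (f' x)) = int_shift n z x"
    using assms(1) assms(3)[OF x] assms(4)[OF x] unfolding commutes_with_shifts_def by simp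
  then show "f' (int_shift n z x) = int_shift n z (f' x)"
    using assms(2)[of "int_shift n z (f' x)"] by simp
qed

lemma central_power_r:
  assumes g: "g \<in> carrier A" "is_lift (\<phi> g) f" and c: "commutes_with_shifts f"
  shows "\<exists>u. \<forall>x\<in>Rn n. (f ^^ r) x = int_shift n u x"
proof -
  have "is_lift (\<lambda>y. y) (f ^^ r)" using lift_power[OF g, of r] exponent[OF g(1)] by (simp add: lift_one_iff)
  from lift_of_id[OF this] obtain \<gamma> where \<gamma>: "\<gamma> \<in> \<Gamma>" "\<And>x. x \<in> Rn n \<Longrightarrow> (f ^^ r) x = \<gamma> x" by blast
  have "commutes_with_shifts (f ^^ r)" by (rule commutes_power[OF c lift_D(2)[OF g(2)]])
  then have "commutes_with_shifts \<gamma>" using \<gamma>(2) unfolding commutes_with_shifts_def by simp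
  from \<Gamma>_central[OF \<gamma>(1) this] show ?thesis using \<gamma>(2) by auto
qed

lemma int_shift_inj: "int_shift n u x = int_shift n u y \<Longrightarrow> x \<in> Rn n \<Longrightarrow> y \<in> Rn n \<Longrightarrow> x = y"
  by (rule Rn_eqI) (auto simp: int_shift_def fun_eq_iff, metis add_right_cancel)

text \<open>
  The element of \<open>\<Gamma>\<close> relating two lifts that commute with the translations commutes with them as well.
\<close>

lemma central_lifts_agree_up_to_shift:
  assumes g: "g \<in> carrier A" and f: "is_lift (\<phi> g) f" "is_lift (\<phi> g) f'"
    and c: "commutes_with_shifts f" "commutes_with_shifts f'"
  shows "\<exists>u. \<forall>x\<in>Rn n. f' x = int_shift n u (f x)"
proof -
  obtain \<gamma> where \<gamma>: "\<gamma> \<in> \<Gamma>" "\<And>x. x \<in> Rn n \<Longrightarrow> f' x = \<gamma> (f x)"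
    by (rule two_lifts[OF f]) (rule that)
  obtain k where k0: "is_lift (\<phi> (inv g)) k" "\<And>x. x \<in> Rn n \<Longrightarrow> k (f x) = x" "\<And>x. x \<in> Rn n \<Longrightarrow> f (k x) = x"
    by (rule lift_inverse[OF g f(1)]) (rule that)
  note k = k0(1,3)
  have "\<gamma> (int_shift n z y) = int_shift n z (\<gamma> y)" if y: "y \<in> Rn n" for z y
  proof -
    have ky: "k y \<in> Rn n" by (rule lift_D(2)[OF k(1) y])
    have "\<gamma> (int_shift n z y) = \<gamma> (f (int_shift n z (k y)))"
      using c(1) ky k(2)[OF y] unfolding commutes_with_shifts_def by simp
    also have "\<dots> = f' (int_shift n z (k y))" using \<gamma>(2)[of "int_shift n z (k y)"] by simp
    also have "\<dots> = int_shift n z (f' (k y))" using c(2) ky unfolding commutes_with_shifts_def by simp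
    also have "\<dots> = int_shift n z (\<gamma> y)" using \<gamma>(2)[OF ky] k(2)[OF y] by simp
    finally show ?thesis .
  qed
  then have "commutes_with_shifts \<gamma>" unfolding commutes_with_shifts_def by blast
  from \<Gamma>_central[OF \<gamma>(1) this] show ?thesis using \<gamma>(2) lift_D(2)[OF f(1)] by auto
qed

text \<open>
  The commutator of \<open>f\<close> and \<open>f'\<close> lifts the identity and commutes with the translations, so it is the
  translation by some \<open>c\<close>. Then the commutator of \<open>f^r\<close> and \<open>f'\<close> is the translation by \<open>r c\<close>; but
  \<open>f^r\<close> is itself a translation, so \<open>r c = 0\<close>.
\<close>

lemma central_lifts_commute:
  assumes g: "g \<in> carrier A" "is_lift (\<phi> g) f" "commutes_with_shifts f"
    and h: "h \<in> carrier A" "is_lift (\<phi> h) f'" "commutes_with_shifts f'" and x: "x \<in> Rn n"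
  shows "f (f' x) = f' (f x)"
proof -
  have fR: "\<And>x. x \<in> Rn n \<Longrightarrow> f x \<in> Rn n" and f'R: "\<And>x. x \<in> Rn n \<Longrightarrow> f' x \<in> Rn n"
    using lift_D(2) g(2) h(2) by blast+
  have "is_lift (\<phi> (g \<otimes> h)) (\<lambda>x. f' (f x))"
    using lift_mult[OF h(1) g(1) h(2) g(2)] g(1) h(1) by (simp add: m_comm)
  from central_lifts_agree_up_to_shift[OF _ this lift_mult[OF g(1) h(1) g(2) h(2)]
      commutes_compose[OF h(3) g(3) fR] commutes_compose[OF g(3) h(3) f'R]]
  obtain c where c: "\<And>x. x \<in> Rn n \<Longrightarrow> f (f' x) = int_shift n c (f' (f x))" using g(1) h(1) by blast
  have fj: "(f ^^ j) x \<in> Rn n" if "x \<in> Rn n" for x j by (induction j) (use fR that in auto)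
  have pow: "(f ^^ j) (f' x) = int_shift n (\<lambda>i. int j * c i) (f' ((f ^^ j) x))" if x: "x \<in> Rn n" for x j
  proof (induction j)
    case 0
    then show ?case using int_shift_zero[OF f'R[OF x]] by simp
  next
    case (Suc j)
    have "(f ^^ Suc j) (f' x) = f (int_shift n (\<lambda>i. int j * c i) (f' ((f ^^ j) x)))" using Suc by simp
    also have "\<dots> = int_shift n (\<lambda>i. int j * c i) (f (f' ((f ^^ j) x)))"
      using g(3) f'R[OF fj[OF x]] unfolding commutes_with_shifts_def by blast
    also have "\<dots> = int_shift n (\<lambda>i. int j * c i) (int_shift n c (f' (f ((f ^^ j) x))))"
      using c[OF fj[OF x]] by simp
    also have "\<dots> = int_shift n (\<lambda>i. int (Suc j) * c i) (f' ((f ^^ Suc j) x))"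
      unfolding int_shift_add by (simp add: algebra_simps)
    finally show ?case .
  qed
  obtain u where u: "\<And>x. x \<in> Rn n \<Longrightarrow> (f ^^ r) x = int_shift n u x" using central_power_r[OF g] by blast
  have "int_shift n u (f' x) = int_shift n (\<lambda>i. int r * c i) (int_shift n u (f' x))"
    using pow[OF x, of r] u[OF x] u[OF f'R[OF x]] h(3) x unfolding commutes_with_shifts_def by simp
  then have "\<forall>i<n. u i = int r * c i + u i" unfolding int_shift_add int_shift_eq_iff .
  then have "c i = 0" if "i < n" for i using that r0 by auto
  then have "int_shift n c = int_shift n (\<lambda>i. 0)" by (intro int_shift_cong)
  then show ?thesis using c[OF x] int_shift_zero[OF f'R[OF fR[OF x]]] by simp
qed

text \<open>
  The lift \<open>m\<close> of \<open>g\<inverse> h\<close> is the quotient of the two given lifts, corrected by a translation such that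
  its \<open>r\<close>-th power is the identity. It commutes with the integer translations and so has bounded
  displacement; by Newman's theorem it is the identity.
\<close>

lemma rotation_injective:
  assumes g: "g \<in> carrier A" "is_lift (\<phi> g) f" "commutes_with_shifts f"
    and h: "h \<in> carrier A" "is_lift (\<phi> h) f'" "commutes_with_shifts f'"
    and u: "\<And>x. x \<in> Rn n \<Longrightarrow> (f ^^ r) x = int_shift n u x"
    and v: "\<And>x. x \<in> Rn n \<Longrightarrow> (f' ^^ r) x = int_shift n v x"
    and uv: "\<And>i. i < n \<Longrightarrow> u i mod int r = v i mod int r"
  shows "g = h"
proof -
  have fR: "\<And>x. x \<in> Rn n \<Longrightarrow> f x \<in> Rn n" and f'R: "\<And>x. x \<in> Rn n \<Longrightarrow> f' x \<in> Rn n"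
    using lift_D(2) g(2) h(2) by blast+
  obtain k where k: "is_lift (\<phi> (inv g)) k" "\<And>x. x \<in> Rn n \<Longrightarrow> k (f x) = x" "\<And>x. x \<in> Rn n \<Longrightarrow> f (k x) = x"
    by (rule lift_inverse[OF g(1,2)]) (rule that)
  have ig: "inv g \<in> carrier A" using g(1) by simp
  have kR: "\<And>x. x \<in> Rn n \<Longrightarrow> k x \<in> Rn n" by (rule lift_D(2)[OF k(1)])
  have kc: "commutes_with_shifts k" by (rule commutes_inverse[OF g(3) k(2,3) kR])
  \<comment> \<open>The quotient of the lifts has \<open>r\<close>-th power \<open>v - u\<close>, so dividing this by \<open>r\<close> gives the correction.\<close>
  define w where "w = (\<lambda>i. (v i - u i) div int r)"
  have w: "v i = u i + int r * w i" if "i < n" for i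
  proof -
    have "int r dvd v i - u i" using uv[OF that] by (metis mod_eq_dvd_iff)
    then show ?thesis by (simp add: w_def)
  qed
  define m where "m = (\<lambda>x. int_shift n (\<lambda>i. - w i) (k (f' x)))"
  have ml: "is_lift (\<phi> (inv g \<otimes> h)) m"
    unfolding m_def
    by (rule lift_cong[OF lift_compose[OF \<Gamma>_lift[OF int_shift_\<Gamma>] lift_mult[OF ig h(1) k(1) h(2)]]]) simp
  have mR: "\<And>x. x \<in> Rn n \<Longrightarrow> m x \<in> Rn n" by (rule lift_D(2)[OF ml])
  have mc: "commutes_with_shifts m"
    unfolding m_def commutes_with_shifts_def
    using kc h(3) f'R kR unfolding commutes_with_shifts_def by (simp add: int_shift_add add.commute)
  have fm: "f (m x) = int_shift n (\<lambda>i. - w i) (f' x)" if "x \<in> Rn n" for x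
    using g(3) kR f'R that k(3) unfolding m_def commutes_with_shifts_def by simp
  have mj: "(m ^^ j) x \<in> Rn n" if "x \<in> Rn n" for x j by (induction j) (use mR that in auto)
  have fj: "(f ^^ j) x \<in> Rn n" if "x \<in> Rn n" for x j by (induction j) (use fR that in auto)
  have f'j: "(f' ^^ j) x \<in> Rn n" if "x \<in> Rn n" for x j by (induction j) (use f'R that in auto)
  have fjc: "commutes_with_shifts (f ^^ j)" for j by (rule commutes_power[OF g(3) fR])
  have ff': "(f ^^ j) (f' x) = f' ((f ^^ j) x)" if x: "x \<in> Rn n" for x j
  proof (induction j)
    case (Suc j)
    then show ?case using central_lifts_commute[OF g h fj[OF x]] by simp
  qed simp
  have pow: "(f ^^ j) ((m ^^ j) x) = int_shift n (\<lambda>i. - (int j * w i)) ((f' ^^ j) x)" if x: "x \<in> Rn n" for x j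
  proof (induction j)
    case 0
    then show ?case using int_shift_zero[OF x] by simp
  next
    case (Suc j)
    have "(f ^^ Suc j) ((m ^^ Suc j) x) = (f ^^ j) (f (m ((m ^^ j) x)))" by (simp add: funpow_swap1)
    also have "\<dots> = int_shift n (\<lambda>i. - w i) ((f ^^ j) (f' ((m ^^ j) x)))"
      using fm[OF mj[OF x]] fjc[of j] f'R[OF mj[OF x]] unfolding commutes_with_shifts_def by simp
    also have "\<dots> = int_shift n (\<lambda>i. - w i) (f' (int_shift n (\<lambda>i. - (int j * w i)) ((f' ^^ j) x)))"
      using ff'[OF mj[OF x]] Suc by simp
    also have "\<dots> = int_shift n (\<lambda>i. - w i) (int_shift n (\<lambda>i. - (int j * w i)) (f' ((f' ^^ j) x)))"
      using h(3) f'j[OF x] unfolding commutes_with_shifts_def by simp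
    also have "\<dots> = int_shift n (\<lambda>i. - (int (Suc j) * w i)) ((f' ^^ Suc j) x)"
      unfolding int_shift_add by (simp add: algebra_simps)
    finally show ?case .
  qed
  have per: "(m ^^ r) x = x" if x: "x \<in> Rn n" for x
  proof -
    have "int_shift n u ((m ^^ r) x) = int_shift n (\<lambda>i. - (int r * w i)) (int_shift n v x)"
      using pow[OF x, of r] u[OF mj[OF x]] v[OF x] by simp
    also have "\<dots> = int_shift n u x"
      unfolding int_shift_add by (simp add: int_shift_eq_iff w)
    finally show ?thesis using int_shift_inj mj[OF x] x by blast
  qed
  obtain M where M: "\<And>x i. x \<in> Rn n \<Longrightarrow> i < n \<Longrightarrow> \<bar>m x i - x i\<bar> \<le> M"
    by (rule commutes_with_shifts_displacement[OF lift_D(1)[OF ml] mc]) (rule that)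
  have mid: "m x = x" if "x \<in> Rn n" for x
    by (rule periodic_bounded_displacement_imp_identity[OF n2 lift_D(1,2)[OF ml] M r0 per that])
  have cl: "inv g \<otimes> h \<in> carrier A" using ig h(1) by simp
  have "\<phi> (inv g \<otimes> h) y = \<phi> \<one> y" for y
  proof (cases "y \<in> topspace Y")
    case True
    then obtain x where x: "x \<in> Rn n" "y = q x" unfolding q_onto[symmetric] by (metis imageE)
    then show ?thesis using lift_D(3)[OF ml x(1)] mid[OF x(1)] \<phi>_one[OF True] by simp
  next
    case False
    then show ?thesis
      using act.bij_prop0[OF cl] act.bij_prop0[OF one_closed] by (auto simp: Bij_def extensional_def)
  qed
  then have "\<phi> (inv g \<otimes> h) = \<phi> \<one>" by blast
  then have one: "inv g \<otimes> h = \<one>" using inj_onD[OF act.faithful] cl by simp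
  have "h = g \<otimes> (inv g \<otimes> h)" using g(1) h(1) by (simp add: m_assoc[symmetric])
  then show ?thesis using g(1) by (simp add: one)
qed

text \<open>
  \<open>R\<close> stands for any set known to contain the rotation vectors modulo \<open>r\<close>; all constraints on
  the group enter through it.
\<close>

lemma card_le_rotations:
  assumes R: "finite R"
    and rot: "\<And>g f u. g \<in> carrier A \<Longrightarrow> is_lift (\<phi> g) f \<Longrightarrow> commutes_with_shifts f \<Longrightarrow>
        (\<And>x. x \<in> Rn n \<Longrightarrow> (f ^^ r) x = int_shift n u x) \<Longrightarrow> (\<lambda>i\<in>{..<n}. u i mod int r) \<in> R"
  shows "card (carrier A) \<le> 9 ^ (n * n) * card R"
proof -
  have "\<forall>g\<in>central_subgroup. \<exists>fu. is_lift (\<phi> g) (fst fu) \<and> commutes_with_shifts (fst fu) \<and>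
       (\<forall>x\<in>Rn n. (fst fu ^^ r) x = int_shift n (snd fu) x)"
  proof
    fix g assume "g \<in> central_subgroup"
    then obtain f where f: "g \<in> carrier A" "is_lift (\<phi> g) f" "commutes_with_shifts f"
      unfolding central_subgroup_def by blast
    from central_power_r[OF this] obtain u where "\<forall>x\<in>Rn n. (f ^^ r) x = int_shift n u x" by blast
    then show "\<exists>fu. is_lift (\<phi> g) (fst fu) \<and> commutes_with_shifts (fst fu) \<and>
       (\<forall>x\<in>Rn n. (fst fu ^^ r) x = int_shift n (snd fu) x)"
      using f by (intro exI[of _ "(f, u)"]) simp
  qed
  from bchoice[OF this] obtain fu where fu: "\<forall>g\<in>central_subgroup. is_lift (\<phi> g) (fst (fu g)) \<and>
      commutes_with_shifts (fst (fu g)) \<and> (\<forall>x\<in>Rn n. (fst (fu g) ^^ r) x = int_shift n (snd (fu g)) x)" by blast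
  have cA: "g \<in> carrier A" if "g \<in> central_subgroup" for g using that by (simp add: central_subgroup_def)
  let ?rot = "\<lambda>g. \<lambda>i\<in>{..<n}. snd (fu g) i mod int r"
  have "inj_on ?rot central_subgroup"
  proof (rule inj_onI)
    fix g h assume gh: "g \<in> central_subgroup" "h \<in> central_subgroup" and eq: "?rot g = ?rot h"
    have "snd (fu g) i mod int r = snd (fu h) i mod int r" if "i < n" for i
      using fun_cong[OF eq, of i] that by simp
    moreover note bspec[OF fu gh(1)] bspec[OF fu gh(2)]
    ultimately show "g = h"
      by (intro rotation_injective[OF cA[OF gh(1)] _ _ cA[OF gh(2)], where f = "fst (fu g)" and f' = "fst (fu h)"
          and u = "snd (fu g)" and v = "snd (fu h)"]) simp_all
  qed
  moreover have "?rot ` central_subgroup \<subseteq> R"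
  proof clarify
    fix g assume g: "g \<in> central_subgroup"
    show "?rot g \<in> R" by (rule rot[OF cA[OF g], of "fst (fu g)"]) (use fu g in auto)
  qed
  ultimately have "card central_subgroup \<le> card R" using R by (rule card_inj_on_le)
  then show ?thesis using card_le_central_subgroup by (meson le_trans mult_le_mono2)
qed

end

section \<open>The torus and the orbit space as flat quotients\<close>

text \<open>
  Coordinates of \<open>Rn n\<close> start at 0, those of the torus at 1.
\<close>

definition torus_proj :: "nat \<Rightarrow> (nat \<Rightarrow> real) \<Rightarrow> nat \<Rightarrow> real set" where
  "torus_proj n x = (\<lambda>i\<in>{1..n}. Z_coset (x (i - 1)))"

lemma torus_proj_eq_iff:
  "torus_proj n x = torus_proj n y \<longleftrightarrow> (\<forall>i<n. x i - y i \<in> \<int>)"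
proof
  assume eq: "torus_proj n x = torus_proj n y"
  show "\<forall>i<n. x i - y i \<in> \<int>"
  proof (intro allI impI)
    fix i assume "i < n"
    then have "Z_coset (x i) = Z_coset (y i)" using fun_cong[OF eq, of "Suc i"] by (simp add: torus_proj_def)
    then show "x i - y i \<in> \<int>" by (simp only: Z_coset_eq_iff)
  qed
next
  assume *: "\<forall>i<n. x i - y i \<in> \<int>"
  have "Z_coset (x (i - 1)) = Z_coset (y (i - 1))" if "i \<in> {1..n}" for i
  proof -
    have "i - 1 < n" using that by auto
    then show ?thesis unfolding Z_coset_eq_iff using * by blast
  qed
  then show "torus_proj n x = torus_proj n y" unfolding torus_proj_def by (intro restrict_ext) auto
qed

lemma torus_proj_eq_iff_shift:
  assumes "x \<in> Rn n" "y \<in> Rn n"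
  shows "torus_proj n x = torus_proj n y \<longleftrightarrow> (\<exists>z. y = int_shift n z x)"
proof
  assume "torus_proj n x = torus_proj n y"
  then have "\<forall>i<n. x i - y i \<in> \<int>" by (simp only: torus_proj_eq_iff)
  then have "\<forall>i. \<exists>z. i < n \<longrightarrow> x i - y i = of_int z" by (auto elim: Ints_cases)
  from choice[OF this] obtain z where z: "\<And>i. i < n \<Longrightarrow> x i - y i = of_int (z i)" by blast
  have "y = int_shift n (\<lambda>i. - z i) x"
  proof (rule Rn_eqI[OF assms(2) int_shift_Rn])
    fix i assume "i < n"
    then show "y i = int_shift n (\<lambda>i. - z i) x i" using z[of i] by (simp add: int_shift_def)
  qed
  then show "\<exists>z. y = int_shift n z x" by (intro exI[of _ "\<lambda>i. - z i"])
next
  assume "\<exists>z. y = int_shift n z x"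
  then show "torus_proj n x = torus_proj n y" unfolding torus_proj_eq_iff by (auto simp: int_shift_def)
qed

lemma torus_proj_in: "torus_proj n x \<in> topspace (torus n)"
  by (simp add: topspace_torus torus_proj_def)

lemma torus_proj_onto: "torus_proj n ` Rn n = topspace (torus n)"
proof (intro equalityI subsetI)
  fix u assume u: "u \<in> topspace (torus n)"
  have "\<exists>t. i \<in> {1..n} \<longrightarrow> u i = Z_coset t" for i
  proof (cases "i \<in> {1..n}")
    case True
    obtain t where "u i = Z_coset t" by (rule torus_coordinate[OF u True])
    then show ?thesis by blast
  qed blast
  then have "\<forall>i. \<exists>t. i \<in> {1..n} \<longrightarrow> u i = Z_coset t" ..
  from choice[OF this] obtain t where t: "\<And>i. i \<in> {1..n} \<Longrightarrow> u i = Z_coset (t i)" by blast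
  let ?x = "\<lambda>i. if i < n then t (Suc i) else 0"
  have "u i = torus_proj n ?x i" for i
  proof (cases "i \<in> {1..n}")
    case True
    then obtain j where j: "i = Suc j" "j < n" by (cases i) auto
    then show ?thesis using t[OF True] by (simp add: torus_proj_def)
  next
    case False
    then show ?thesis using PiE_arb[OF u[unfolded topspace_torus] False]
      by (simp only: torus_proj_def restrict_def if_False)
  qed
  then have "u = torus_proj n ?x" by blast
  then show "u \<in> torus_proj n ` Rn n" by (intro image_eqI[of _ _ ?x]) (auto simp: Rn_iff)
qed (auto intro: torus_proj_in)

lemma continuous_map_torus_proj: "continuous_map (Euclidean_space n) (torus n) (torus_proj n)"
  unfolding torus_def continuous_map_componentwise
proof (intro conjI ballI)
  show "torus_proj n ` Rn n \<subseteq> extensional {1..n}" by (auto simp: torus_proj_def)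
  fix i assume i: "i \<in> {1..n}"
  have "continuous_map (Euclidean_space n) euclideanreal (\<lambda>x. x (i - 1))"
    unfolding Euclidean_space_def
    by (intro continuous_map_from_subtopology continuous_map_product_projection) auto
  moreover have "continuous_map euclideanreal R_mod_Z Z_coset"
    using quotient_imp_continuous_map[OF quotient_map_quotient_topology] unfolding R_mod_Z_def .
  ultimately have "continuous_map (Euclidean_space n) R_mod_Z (Z_coset \<circ> (\<lambda>x. x (i - 1)))"
    by (rule continuous_map_compose)
  moreover have "(\<lambda>x. torus_proj n x i) = Z_coset \<circ> (\<lambda>x. x (i - 1))" using i by (auto simp: torus_proj_def)
  ultimately show "continuous_map (Euclidean_space n) R_mod_Z (\<lambda>x. torus_proj n x i)" by simp
qed

lemma openin_Z_coset_image:
  assumes "open U" shows "openin R_mod_Z (Z_coset ` U)"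
  unfolding R_mod_Z_def openin_quotient_topology
proof
  have "{x \<in> topspace euclideanreal. Z_coset x \<in> Z_coset ` U} = (\<Union>j::int. (\<lambda>x. x + of_int j) ` U)"
  proof (intro equalityI subsetI)
    fix x assume "x \<in> {x \<in> topspace euclideanreal. Z_coset x \<in> Z_coset ` U}"
    then obtain y where y: "y \<in> U" "Z_coset x = Z_coset y" by auto
    then obtain j where "x - y = of_int j" unfolding Z_coset_eq_iff by (auto elim: Ints_cases)
    then have "x = y + of_int j" by simp
    then show "x \<in> (\<Union>j::int. (\<lambda>x. x + of_int j) ` U)" using y(1) by blast
  next
    fix x assume "x \<in> (\<Union>j::int. (\<lambda>x. x + of_int j) ` U)"
    then obtain y j where "y \<in> U" "x = y + of_int j" by blast
    moreover then have "Z_coset x = Z_coset y" unfolding Z_coset_eq_iff by simp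
    ultimately show "x \<in> {x \<in> topspace euclideanreal. Z_coset x \<in> Z_coset ` U}" by simp
  qed
  moreover have "open (\<Union>j::int. (\<lambda>x. x + of_int j) ` U)"
  proof (intro open_UN ballI)
    fix j :: int
    have "(\<lambda>x. x + of_int j) ` U = (+) (of_int j) ` U" by (rule image_cong) auto
    then show "open ((\<lambda>x. x + of_int j) ` U)" using open_translation[OF assms] by simp
  qed
  ultimately show "openin euclideanreal {x \<in> topspace euclideanreal. Z_coset x \<in> Z_coset ` U}" by simp
qed auto

text \<open>
  A small cube around a point of an open set is mapped onto a product of open arcs, since
  representatives of the coordinates can be chosen independently.
\<close>

lemma open_map_torus_proj: "open_map (Euclidean_space n) (torus n) (torus_proj n)"
  unfolding open_map_def
proof (intro allI impI)
  fix U assume "openin (Euclidean_space n) U"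
  then have "openin (top_of_set (Rn n)) U" by (simp only: Euclidean_space_eq_top_of_set[symmetric])
  then obtain V where V: "open V" "U = Rn n \<inter> V" unfolding openin_open by blast
  show "openin (torus n) (torus_proj n ` U)"
  proof (subst openin_subopen, intro ballI)
    fix u assume "u \<in> torus_proj n ` U"
    then obtain x where x: "x \<in> U" "u = torus_proj n x" by blast
    have xV: "x \<in> V" "x \<in> Rn n" using x V by auto
    obtain \<rho> where \<rho>: "\<rho> > 0" "cube n x \<rho> \<subseteq> V" by (rule open_contains_cube[OF V(1) xV])
    let ?W = "PiE {1..n} (\<lambda>i. Z_coset ` {x (i - 1) - \<rho><..<x (i - 1) + \<rho>})"
    have "openin (torus n) ?W"
      unfolding torus_def using openin_Z_coset_image by (subst openin_PiE_gen) auto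
    moreover have "u \<in> ?W" using \<rho>(1) unfolding x(2) torus_proj_def by auto
    moreover have "?W \<subseteq> torus_proj n ` U"
    proof
      fix w assume w: "w \<in> ?W"
      have "\<forall>i. \<exists>t. i \<in> {1..n} \<longrightarrow> (\<bar>t - x (i - 1)\<bar> < \<rho> \<and> w i = Z_coset t)"
      proof
        fix i show "\<exists>t. i \<in> {1..n} \<longrightarrow> (\<bar>t - x (i - 1)\<bar> < \<rho> \<and> w i = Z_coset t)"
        proof (cases "i \<in> {1..n}")
          case True
          then have "w i \<in> Z_coset ` {x (i - 1) - \<rho><..<x (i - 1) + \<rho>}" using w by (rule PiE_mem[rotated])
          then obtain t where "t \<in> {x (i - 1) - \<rho><..<x (i - 1) + \<rho>}" "w i = Z_coset t" by blast
          then show ?thesis by (intro exI[of _ t]) auto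
        qed blast
      qed
      from choice[OF this] obtain t
        where t: "\<And>i. i \<in> {1..n} \<Longrightarrow> \<bar>t i - x (i - 1)\<bar> < \<rho> \<and> w i = Z_coset (t i)" by blast
      define y where "y = (\<lambda>i. if i < n then t (Suc i) else 0)"
      have "\<bar>y i - x i\<bar> \<le> \<rho>" if "i < n" for i using t[of "Suc i"] that by (simp add: y_def)
      then have "y \<in> cube n x \<rho>" by (simp add: cube_def Rn_iff y_def)
      then have "y \<in> U" using \<rho>(2) unfolding V(2) by (auto simp: cube_def)
      moreover have "w = torus_proj n y"
      proof
        fix i show "w i = torus_proj n y i"
        proof (cases "i \<in> {1..n}")
          case True
          then obtain j where j: "i = Suc j" "j < n" by (cases i) auto
          then show ?thesis using t[OF True] by (simp add: torus_proj_def y_def)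
        next
          case False
          then show ?thesis using PiE_arb[OF w False] by (simp only: torus_proj_def restrict_def if_False)
        qed
      qed
      ultimately show "w \<in> torus_proj n ` U" by blast
    qed
    ultimately show "\<exists>W. openin (torus n) W \<and> u \<in> W \<and> W \<subseteq> torus_proj n ` U" by blast
  qed
qed

lemma abs_of_int_less_half: "\<bar>of_int z :: real\<bar> < 1/2 \<Longrightarrow> z = 0"
  by linarith

lemma flat_quotient_torus: "flat_quotient n (torus n) (torus_proj n) (range (int_shift n))"
proof
  show "continuous_map (Euclidean_space n) (torus n) (torus_proj n)" by (rule continuous_map_torus_proj)
  show "open_map (Euclidean_space n) (torus n) (torus_proj n)" by (rule open_map_torus_proj)
  show "torus_proj n ` Rn n = topspace (torus n)" by (rule torus_proj_onto)
  show "torus_proj n x = torus_proj n y \<longleftrightarrow> (\<exists>\<gamma>\<in>range (int_shift n). y = \<gamma> x)" if "x \<in> Rn n" "y \<in> Rn n" for x y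
    unfolding torus_proj_eq_iff_shift[OF that] by blast
  show "\<gamma> x \<in> Rn n" if "\<gamma> \<in> range (int_shift n)" for \<gamma> x using that by auto
  show "\<bar>\<gamma> x i - \<gamma> y i\<bar> = \<bar>x i - y i\<bar>" if "\<gamma> \<in> range (int_shift n)" "i < n" for \<gamma> x y i
    using that by (auto simp: int_shift_def)
  show "\<gamma> x = x" if "\<gamma> \<in> range (int_shift n)" "x \<in> Rn n" "\<forall>i<n. \<bar>\<gamma> x i - x i\<bar> < 1/2" for \<gamma> x
  proof -
    from that(1) obtain z where z: "\<gamma> = int_shift n z" by blast
    have "z i = 0" if i: "i < n" for i
      using \<open>\<forall>i<n. \<bar>\<gamma> x i - x i\<bar> < 1/2\<close>[rule_format, OF i] i
      by (intro abs_of_int_less_half) (simp add: z int_shift_def)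
    then have "int_shift n z = int_shift n (\<lambda>i. 0)" by (intro int_shift_cong)
    then show ?thesis using int_shift_zero[OF that(2)] z by simp
  qed
qed auto

text \<open>
  A lift of the involution to \<open>\<real>^n\<close>. Its square is not the identity but an integer translation.
\<close>

definition sigma_lift :: "nat \<Rightarrow> nat \<Rightarrow> (nat \<Rightarrow> real) \<Rightarrow> nat \<Rightarrow> real" where
  "sigma_lift n k x = (\<lambda>i. if i < n then if i < k then x i + 1/2 else - x i else 0)"

lemma sigma_lift_Rn [simp]: "sigma_lift n k x \<in> Rn n"
  by (simp add: sigma_lift_def Rn_iff)

lemma sigma_torus_proj: "sigma_inv n k (torus_proj n x) = torus_proj n (sigma_lift n k x)"
proof
  fix i show "sigma_inv n k (torus_proj n x) i = torus_proj n (sigma_lift n k x) i"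
  proof (cases "i \<in> {1..n}")
    case True
    then have "i - 1 < n" "i - 1 < k \<longleftrightarrow> i \<le> k" by auto
    then show ?thesis using True
      by (simp add: sigma_inv_def torus_proj_def sigma_lift_def shift_Z_coset uminus_Z_coset)
  next
    case False
    then show ?thesis by (simp only: sigma_inv_def torus_proj_def restrict_def if_False)
  qed
qed

text \<open>
  The action of conjugation by \<open>sigma_lift\<close> on translation vectors.
\<close>

definition twist :: "nat \<Rightarrow> (nat \<Rightarrow> int) \<Rightarrow> nat \<Rightarrow> int" where
  "twist k z = (\<lambda>i. if i < k then z i else - z i)"

lemma sigma_lift_shift: "sigma_lift n k (int_shift n z x) = int_shift n (twist k z) (sigma_lift n k x)"
  by (auto simp: sigma_lift_def int_shift_def twist_def fun_eq_iff)

lemma sigma_lift_sigma_lift: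
  assumes "x \<in> Rn n"
  shows "sigma_lift n k (sigma_lift n k x) = int_shift n (\<lambda>i. if i < k then 1 else 0) x"
  by (auto simp: sigma_lift_def int_shift_def fun_eq_iff)

text \<open>
  The fundamental group of the orbit space, acting by deck transformations: translations, and glide
  reflections, which are the lifts of the involution.
\<close>

definition sigma_group :: "nat \<Rightarrow> nat \<Rightarrow> ((nat \<Rightarrow> real) \<Rightarrow> nat \<Rightarrow> real) set" where
  "sigma_group n k = range (int_shift n) \<union> range (\<lambda>z x. int_shift n z (sigma_lift n k x))"

lemma sigma_group_cases:
  assumes "\<gamma> \<in> sigma_group n k"
  obtains (shift) z where "\<gamma> = int_shift n z" | (glide) z where "\<gamma> = (\<lambda>x. int_shift n z (sigma_lift n k x))"
  using assms unfolding sigma_group_def by blast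

lemma orbit_proj_eq_iff:
  assumes "s (s x) = x" "s (s y) = y"
  shows "orbit_proj s x = orbit_proj s y \<longleftrightarrow> y = x \<or> y = s x"
  using assms unfolding orbit_proj_def by (auto simp: doubleton_eq_iff)

lemma open_map_orbit_proj:
  assumes cont: "continuous_map X X s" and inv: "\<And>x. x \<in> topspace X \<Longrightarrow> s (s x) = x"
  shows "open_map X (orbit_space X s) (orbit_proj s)"
  unfolding open_map_def orbit_space_def openin_quotient_topology
proof (intro allI impI conjI)
  fix U assume U: "openin X U"
  then have UX: "U \<subseteq> topspace X" by (rule openin_subset)
  then show "orbit_proj s ` U \<subseteq> orbit_proj s ` topspace X" by blast
  have sX: "s x \<in> topspace X" if "x \<in> topspace X" for x using cont that by (auto simp: continuous_map_def)
  have "{x \<in> topspace X. orbit_proj s x \<in> orbit_proj s ` U} = U \<union> {x \<in> topspace X. s x \<in> U}"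
  proof (intro equalityI subsetI)
    fix x assume "x \<in> {x \<in> topspace X. orbit_proj s x \<in> orbit_proj s ` U}"
    then obtain u where u: "x \<in> topspace X" "u \<in> U" "orbit_proj s x = orbit_proj s u" by blast
    then have "u = x \<or> u = s x" using orbit_proj_eq_iff[of s x u] inv UX by blast
    then show "x \<in> U \<union> {x \<in> topspace X. s x \<in> U}" using u by blast
  next
    fix x assume x: "x \<in> U \<union> {x \<in> topspace X. s x \<in> U}"
    then have xX: "x \<in> topspace X" using UX by blast
    have "orbit_proj s x = orbit_proj s (s x)" unfolding orbit_proj_def using inv[OF xX] by auto
    then show "x \<in> {x \<in> topspace X. orbit_proj s x \<in> orbit_proj s ` U}" using x xX by auto
  qed
  moreover have "openin X (U \<union> {x \<in> topspace X. s x \<in> U})"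
    using U openin_continuous_map_preimage[OF cont U] by blast
  ultimately show "openin X {x \<in> topspace X. orbit_proj s x \<in> orbit_proj s ` U}" by simp
qed

text \<open>
  The universal covering of the orbit space. For \<open>n = 2\<close> and \<open>k = 1\<close> the orbit space is the Klein
  bottle.
\<close>

definition klein_proj :: "nat \<Rightarrow> nat \<Rightarrow> (nat \<Rightarrow> real) \<Rightarrow> (nat \<Rightarrow> real set) set" where
  "klein_proj n k x = orbit_proj (sigma_inv n k) (torus_proj n x)"

lemma klein_proj_eq_iff:
  assumes "x \<in> Rn n" "y \<in> Rn n"
  shows "klein_proj n k x = klein_proj n k y \<longleftrightarrow> (\<exists>\<gamma>\<in>sigma_group n k. y = \<gamma> x)"
proof -
  have "klein_proj n k x = klein_proj n k y \<longleftrightarrow>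
      torus_proj n x = torus_proj n y \<or> torus_proj n (sigma_lift n k x) = torus_proj n y"
    unfolding klein_proj_def
    by (subst orbit_proj_eq_iff) (auto simp: sigma_inv_involution torus_proj_in sigma_torus_proj[symmetric])
  also have "\<dots> \<longleftrightarrow> (\<exists>z. y = int_shift n z x) \<or> (\<exists>z. y = int_shift n z (sigma_lift n k x))"
    unfolding torus_proj_eq_iff_shift[OF assms, symmetric]
      torus_proj_eq_iff_shift[OF sigma_lift_Rn assms(2), symmetric] ..
  also have "\<dots> \<longleftrightarrow> (\<exists>\<gamma>\<in>sigma_group n k. y = \<gamma> x)"
    unfolding sigma_group_def by (simp add: bex_Un)
  finally show ?thesis .
qed

lemma abs_half_plus_int: "\<bar>1/2 + of_int z :: real\<bar> \<ge> 1/2"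
proof (cases "z \<ge> 0")
  case False
  then have "of_int z \<le> (-1 :: real)" by linarith
  then show ?thesis by linarith
qed simp

text \<open>
  Points in the same orbit stay apart since a glide reflection changes the first coordinate by
  half an odd integer; this is where \<open>1 \<le> k\<close> enters.
\<close>

lemma flat_quotient_klein:
  assumes "1 \<le> k" "k \<le> n"
  shows "flat_quotient n (orbit_space (torus n) (sigma_inv n k)) (klein_proj n k) (sigma_group n k)"
proof
  let ?Y = "orbit_space (torus n) (sigma_inv n k)"
  have qm: "quotient_map (torus n) ?Y (orbit_proj (sigma_inv n k))"
    unfolding orbit_space_def by (rule quotient_map_quotient_topology)
  have kp: "klein_proj n k = orbit_proj (sigma_inv n k) \<circ> torus_proj n" by (auto simp: klein_proj_def)
  show "continuous_map (Euclidean_space n) ?Y (klein_proj n k)"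
    unfolding kp by (rule continuous_map_compose[OF continuous_map_torus_proj quotient_imp_continuous_map[OF qm]])
  show "open_map (Euclidean_space n) ?Y (klein_proj n k)"
    unfolding kp by (rule open_map_compose[OF open_map_torus_proj open_map_orbit_proj[OF continuous_map_sigma_inv sigma_inv_involution]])
  show "klein_proj n k ` Rn n = topspace ?Y"
    unfolding kp image_comp[symmetric] torus_proj_onto by (simp add: orbit_space_def)
  show "klein_proj n k x = klein_proj n k y \<longleftrightarrow> (\<exists>\<gamma>\<in>sigma_group n k. y = \<gamma> x)" if "x \<in> Rn n" "y \<in> Rn n" for x y
    by (rule klein_proj_eq_iff[OF that])
  show "\<gamma> x \<in> Rn n" if "\<gamma> \<in> sigma_group n k" for \<gamma> x using that by (cases rule: sigma_group_cases) auto
  show "\<bar>\<gamma> x i - \<gamma> y i\<bar> = \<bar>x i - y i\<bar>" if "\<gamma> \<in> sigma_group n k" "i < n" for \<gamma> x y i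
    using that by (cases rule: sigma_group_cases) (auto simp: int_shift_def sigma_lift_def abs_minus_commute)
  show "\<gamma> x = x" if "\<gamma> \<in> sigma_group n k" "x \<in> Rn n" "\<forall>i<n. \<bar>\<gamma> x i - x i\<bar> < 1/2" for \<gamma> x
    using that(1)
  proof (cases rule: sigma_group_cases)
    case (shift z)
    have "z i = 0" if i: "i < n" for i
      using \<open>\<forall>i<n. \<bar>\<gamma> x i - x i\<bar> < 1/2\<close>[rule_format, OF i] i
      by (intro abs_of_int_less_half) (simp add: shift int_shift_def)
    then have "int_shift n z = int_shift n (\<lambda>i. 0)" by (intro int_shift_cong)
    then show ?thesis using int_shift_zero[OF that(2)] shift by simp
  next
    case (glide z)
    have "0 < n" "0 < k" using assms by auto
    then have "\<gamma> x 0 - x 0 = 1/2 + of_int (z 0)" by (simp add: glide int_shift_def sigma_lift_def)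
    then have "\<bar>\<gamma> x 0 - x 0\<bar> \<ge> 1/2" using abs_half_plus_int by simp
    then show ?thesis using that(3) \<open>0 < n\<close> by force
  qed
  show "int_shift n z \<in> sigma_group n k" for z by (auto simp: sigma_group_def)
qed

text \<open>
  Every lift normalizes the deck group, which consists of the translations only.
\<close>

lemma card_torus_action:
  assumes "flat_action n (torus n) (torus_proj n) (range (int_shift n)) A \<phi> r"
  shows "card (carrier A) \<le> 9 ^ (n * n) * r ^ n"
proof -
  interpret flat_action n "torus n" "torus_proj n" "range (int_shift n)" A \<phi> r by (rule assms)
  interpret flat_action_normal n "torus n" "torus_proj n" "range (int_shift n)" A \<phi> r
  proof
    fix g f z assume g: "g \<in> carrier A" "is_lift (\<phi> g) f"
    have "is_lift (\<phi> g) (\<lambda>x. f (int_shift n z x))"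
      by (rule lift_cong[OF lift_compose[OF g(2) \<Gamma>_lift[OF int_shift_\<Gamma>]]]) simp
    from two_lifts[OF g(2) this] obtain \<gamma> where "\<gamma> \<in> range (int_shift n)"
        "\<And>x. x \<in> Rn n \<Longrightarrow> f (int_shift n z x) = \<gamma> (f x)" by blast
    then show "\<exists>z'. \<forall>x\<in>Rn n. f (int_shift n z x) = int_shift n z' (f x)" by blast
  next
    fix \<gamma> assume "\<gamma> \<in> range (int_shift n)"
    then obtain z where z: "\<gamma> = int_shift n z" by blast
    show "\<exists>z. \<forall>x\<in>Rn n. \<gamma> (\<gamma> x) = int_shift n z x" unfolding z int_shift_add by blast
    show "\<exists>z. \<forall>x\<in>Rn n. \<gamma> x = int_shift n z x" unfolding z by blast
  qed
  let ?R = "{..<n} \<rightarrow>\<^sub>E {0..<int r}"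
  have "card (carrier A) \<le> 9 ^ (n * n) * card ?R"
  proof (rule card_le_rotations)
    show "finite ?R" by (simp add: finite_PiE)
    show "(\<lambda>i\<in>{..<n}. u i mod int r) \<in> ?R" for u
      unfolding restrict_PiE_iff using r0 by simp
  qed
  then show ?thesis by (simp add: card_PiE)
qed

text \<open>
  Two points need the special form of the deck group. First, lifts normalize the translations: a
  lift conjugating a translation to a glide reflection is impossible, as some translation
  along the last axis is conjugate to a translation and would commute with this glide reflection.
  Second, conjugation by \<open>sigma_lift\<close> changes a central lift \<open>f\<close> only by an integer translation,
  because \<open>A\<close> is abelian. Comparing \<open>r\<close>-th powers shows that
  \<open>r\<close> divides twice the last \<open>n - k\<close> entries of the rotation vector, each of which then has at most two values
  modulo \<open>r\<close>.
\<close>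

lemma card_klein_action:
  assumes k: "1 \<le> k" "k < n"
    and act: "flat_action n (orbit_space (torus n) (sigma_inv n k)) (klein_proj n k) (sigma_group n k) A \<phi> r"
  shows "card (carrier A) \<le> 9 ^ (n * n) * (2 ^ n * r ^ k)"
proof -
  interpret flat_action n "orbit_space (torus n) (sigma_inv n k)" "klein_proj n k" "sigma_group n k" A \<phi> r by (rule act)
  let ?s = "sigma_lift n k"
  have s_in: "?s \<in> sigma_group n k"
  proof -
    have "?s = (\<lambda>x. int_shift n (\<lambda>i. 0) (?s x))" by (simp add: int_shift_zero)
    then show ?thesis unfolding sigma_group_def by blast
  qed
  define m where "m = n - 1"
  have m: "m < n" "\<not> m < k" using k by (auto simp: m_def)
  have square: "\<exists>z. \<forall>x\<in>Rn n. \<gamma> (\<gamma> x) = int_shift n z x" if "\<gamma> \<in> sigma_group n k" for \<gamma>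
    using that
  proof (cases rule: sigma_group_cases)
    case (shift z)
    show ?thesis unfolding shift int_shift_add by blast
  next
    case (glide z)
    have "\<gamma> (\<gamma> x) = int_shift n (\<lambda>i. z i + (twist k z i + (if i < k then 1 else 0))) x" if "x \<in> Rn n" for x
      unfolding glide sigma_lift_shift sigma_lift_sigma_lift[OF that] int_shift_add ..
    then show ?thesis by blast
  qed
  interpret flat_action_normal n "orbit_space (torus n) (sigma_inv n k)" "klein_proj n k" "sigma_group n k" A \<phi> r
  proof
    fix g f z assume g: "g \<in> carrier A" "is_lift (\<phi> g) f"
    have "is_lift (\<phi> g) (\<lambda>x. f (int_shift n z x))"
      by (rule lift_cong[OF lift_compose[OF g(2) \<Gamma>_lift[OF int_shift_\<Gamma>]]]) simp
    then obtain \<gamma> where \<gamma>: "\<gamma> \<in> sigma_group n k" "\<And>x. x \<in> Rn n \<Longrightarrow> f (int_shift n z x) = \<gamma> (f x)"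
      by (rule two_lifts[OF g(2)]) (rule that)
    from \<gamma>(1) show "\<exists>z'. \<forall>x\<in>Rn n. f (int_shift n z x) = int_shift n z' (f x)"
    proof (cases rule: sigma_group_cases)
      case (shift z')
      then show ?thesis using \<gamma>(2) by blast
    next
      case (glide w)
      obtain h where h: "is_lift (\<phi> (inv\<^bsub>A\<^esub> g)) h" "\<And>x. x \<in> Rn n \<Longrightarrow> h (f x) = x" "\<And>x. x \<in> Rn n \<Longrightarrow> f (h x) = x"
        by (rule lift_inverse[OF g]) (rule that)
      \<comment> \<open>Squares in the deck group are translations: so 4 times the last axis is conjugate to a translation by \<open>u\<close>.\<close>
      let ?e = "\<lambda>i. if i = m then 2 else 0 :: int"
      have "is_lift (\<phi> (inv\<^bsub>A\<^esub> g)) (\<lambda>x. h (int_shift n ?e x))"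
        by (rule lift_cong[OF lift_compose[OF h(1) \<Gamma>_lift[OF int_shift_\<Gamma>]]]) simp
      then obtain \<gamma>' where \<gamma>': "\<gamma>' \<in> sigma_group n k" "\<And>x. x \<in> Rn n \<Longrightarrow> h (int_shift n ?e x) = \<gamma>' (h x)"
        by (rule two_lifts[OF h(1)]) (rule that)
      obtain u where u: "\<And>x. x \<in> Rn n \<Longrightarrow> \<gamma>' (\<gamma>' x) = int_shift n u x" using square[OF \<gamma>'(1)] by blast
      let ?E = "\<lambda>i. ?e i + ?e i"
      have fu: "f (int_shift n u x) = int_shift n ?E (f x)" if x: "x \<in> Rn n" for x
      proof -
        have fx: "f x \<in> Rn n" by (rule lift_D(2)[OF g(2) x])
        have "h (int_shift n ?E (f x)) = h (int_shift n ?e (int_shift n ?e (f x)))" by (simp only: int_shift_add)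
        also have "\<dots> = int_shift n u x"
          by (simp only: \<gamma>'(2)[OF int_shift_Rn] \<gamma>'(2)[OF fx] h(2)[OF x] u[OF x])
        finally have "f (h (int_shift n ?E (f x))) = f (int_shift n u x)" by (rule arg_cong)
        then show ?thesis using h(3)[OF int_shift_Rn] by simp
      qed
      let ?o = "\<lambda>i. 0 :: real"
      have o: "?o \<in> Rn n" by (rule zero_Rn)
      have fo: "f ?o \<in> Rn n" by (rule lift_D(2)[OF g(2) o])
      have "f (int_shift n z (int_shift n u ?o)) = f (int_shift n u (int_shift n z ?o))"
        by (simp add: int_shift_add add.commute)
      moreover have "f (int_shift n z (int_shift n u ?o)) = \<gamma> (int_shift n ?E (f ?o))"
        by (simp only: \<gamma>(2)[OF int_shift_Rn] fu[OF o])
      moreover have "f (int_shift n u (int_shift n z ?o)) = int_shift n ?E (\<gamma> (f ?o))"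
        by (simp only: fu[OF int_shift_Rn] \<gamma>(2)[OF o])
      ultimately have "\<gamma> (int_shift n ?E (f ?o)) m = int_shift n ?E (\<gamma> (f ?o)) m" by simp
      then have False using m by (simp add: glide int_shift_def sigma_lift_def)
      then show ?thesis ..
    qed
  next
    fix \<gamma> assume \<gamma>: "\<gamma> \<in> sigma_group n k"
    then show "\<exists>z. \<forall>x\<in>Rn n. \<gamma> (\<gamma> x) = int_shift n z x" by (rule square)
    assume c: "commutes_with_shifts \<gamma>"
    from \<gamma> show "\<exists>z. \<forall>x\<in>Rn n. \<gamma> x = int_shift n z x"
    proof (cases rule: sigma_group_cases)
      case (glide w)
      have "\<gamma> (int_shift n (\<lambda>i. 1) (\<lambda>i. 0)) = int_shift n (\<lambda>i. 1) (\<gamma> (\<lambda>i. 0))"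
        using c zero_Rn unfolding commutes_with_shifts_def by blast
      from fun_cong[OF this, of m] have False using m by (simp add: glide int_shift_def sigma_lift_def)
      then show ?thesis ..
    qed blast
  qed
  let ?B = "\<lambda>i. if i < k then {0..<int r} else {t \<in> {0..<int r}. int r dvd 2 * t}"
  let ?R = "PiE {..<n} ?B"
  have fB: "finite (?B i)" for i
    by (cases "i < k") (auto intro: finite_subset[of _ "{0..<int r}"])
  have "card (carrier A) \<le> 9 ^ (n * n) * card ?R"
  proof (rule card_le_rotations)
    show "finite ?R" using fB by (intro finite_PiE) auto
    fix g f u assume g: "g \<in> carrier A" and f: "is_lift (\<phi> g) f" and c: "commutes_with_shifts f"
      and u: "\<And>x. x \<in> Rn n \<Longrightarrow> (f ^^ r) x = int_shift n u x"
    have fR: "\<And>x. x \<in> Rn n \<Longrightarrow> f x \<in> Rn n" by (rule lift_D(2)[OF f])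
    have fj: "(f ^^ j) x \<in> Rn n" if "x \<in> Rn n" for x j by (induction j) (use fR that in auto)
    \<comment> \<open>This translation turns \<open>sigma_lift\<close> into its own inverse.\<close>
    let ?t = "int_shift n (\<lambda>i. if i < k then -1 else 0)"
    define f' where "f' = (\<lambda>x. ?t (?s (f (?s x))))"
    have ts: "?s (?t (?s x)) = x" if "x \<in> Rn n" for x
    proof -
      have "?s (?t (?s x)) = int_shift n (\<lambda>i. twist k (\<lambda>i. if i < k then - 1 else 0) i + (if i < k then 1 else 0)) x"
        by (simp only: sigma_lift_shift sigma_lift_sigma_lift[OF that] int_shift_add)
      also have "\<dots> = int_shift n (\<lambda>i. 0) x" by (simp add: int_shift_eq_iff twist_def)
      finally show ?thesis using int_shift_zero[OF that] by simp
    qed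
    have f'_lift: "is_lift (\<phi> g) f'"
      unfolding f'_def
      by (rule lift_cong[OF lift_compose[OF \<Gamma>_lift[OF int_shift_\<Gamma>] lift_compose[OF \<Gamma>_lift[OF s_in]
            lift_compose[OF f \<Gamma>_lift[OF s_in]]]]]) simp
    have f'_c: "commutes_with_shifts f'"
      unfolding commutes_with_shifts_def f'_def
    proof (intro allI ballI)
      fix z x
      have tt: "twist k (twist k z) = z" by (auto simp: twist_def)
      have "f (?s (int_shift n z x)) = int_shift n (twist k z) (f (?s x))"
        using c unfolding commutes_with_shifts_def sigma_lift_shift by simp
      then show "?t (?s (f (?s (int_shift n z x)))) = int_shift n z (?t (?s (f (?s x))))"
        by (simp add: sigma_lift_shift tt int_shift_add add.commute)
    qed
    obtain d where d: "\<And>x. x \<in> Rn n \<Longrightarrow> f' x = int_shift n d (f x)"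
      using central_lifts_agree_up_to_shift[OF g f f'_lift c f'_c] by blast
    have fs: "f (?s x) = int_shift n (twist k d) (?s (f x))" if x: "x \<in> Rn n" for x
    proof -
      have "f (?s x) = ?s (f' x)" unfolding f'_def using ts[OF fR[OF sigma_lift_Rn]] by simp
      then show ?thesis using d[OF x] by (simp only: sigma_lift_shift)
    qed
    have pow: "(f ^^ j) (?s x) = int_shift n (\<lambda>i. int j * twist k d i) (?s ((f ^^ j) x))" if x: "x \<in> Rn n" for x j
    proof (induction j)
      case 0
      show ?case using int_shift_zero[OF sigma_lift_Rn] by simp
    next
      case (Suc j)
      have "(f ^^ Suc j) (?s x) = f (int_shift n (\<lambda>i. int j * twist k d i) (?s ((f ^^ j) x)))" using Suc by simp
      also have "\<dots> = int_shift n (\<lambda>i. int j * twist k d i) (f (?s ((f ^^ j) x)))"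
        using c unfolding commutes_with_shifts_def by simp
      also have "\<dots> = int_shift n (\<lambda>i. int j * twist k d i) (int_shift n (twist k d) (?s (f ((f ^^ j) x))))"
        by (simp only: fs[OF fj[OF x]])
      also have "\<dots> = int_shift n (\<lambda>i. int (Suc j) * twist k d i) (?s ((f ^^ Suc j) x))"
        unfolding int_shift_add by (simp add: algebra_simps)
      finally show ?case .
    qed
    have "int_shift n u (?s (\<lambda>i. 0)) = int_shift n (\<lambda>i. int r * twist k d i + twist k u i) (?s (\<lambda>i. 0))"
      using pow[OF zero_Rn, of r] by (simp only: u[OF sigma_lift_Rn] u[OF zero_Rn] sigma_lift_shift int_shift_add)
    then have ud: "u i = int r * twist k d i + twist k u i" if "i < n" for i
      using that unfolding int_shift_eq_iff by blast
    show "(\<lambda>i\<in>{..<n}. u i mod int r) \<in> ?R"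
      unfolding restrict_PiE_iff
    proof
      fix i assume "i \<in> {..<n}"
      then have i: "i < n" by simp
      show "u i mod int r \<in> ?B i"
      proof (cases "i < k")
        case True
        then show ?thesis using r0 by simp
      next
        case False
        have "2 * u i = int r * twist k d i" using ud[OF i] False by (simp add: twist_def)
        then have "int r dvd 2 * u i" by simp
        moreover have "2 * (u i mod int r) = 2 * u i - int r * (2 * (u i div int r))"
          by (simp add: minus_div_mult_eq_mod[symmetric] algebra_simps)
        ultimately have "int r dvd 2 * (u i mod int r)" by simp
        then show ?thesis using r0 False by simp
      qed
    qed
  qed
  also have "card ?R \<le> 2 ^ n * r ^ k"
  proof -
    have small: "card {t \<in> {0..<int r}. int r dvd 2 * t} \<le> 2"
    proof -
      have "{t \<in> {0..<int r}. int r dvd 2 * t} \<subseteq> {0, int r div 2}"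
      proof
        fix t assume "t \<in> {t \<in> {0..<int r}. int r dvd 2 * t}"
        then have t: "0 \<le> t" "t < int r" "int r dvd 2 * t" by auto
        from t(3) obtain q where q: "2 * t = int r * q" by blast
        have "int r * q < int r * 2" "0 \<le> int r * q" using q t by linarith+
        then have "q < 2" "0 \<le> q" using r0 by (auto simp: zero_le_mult_iff)
        then have "q = 0 \<or> q = 1" by linarith
        then show "t \<in> {0, int r div 2}" using q r0 by auto
      qed
      then have "card {t \<in> {0..<int r}. int r dvd 2 * t} \<le> card {0, int r div 2}" by (intro card_mono) auto
      also have "\<dots> \<le> 2" by (simp add: card_insert_if)
      finally show ?thesis .
    qed
    have "card ?R = (\<Prod>i<n. card (?B i))" by (simp add: card_PiE)
    also have "\<dots> \<le> (\<Prod>i<n. 2 * (if i < k then r else 1))"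
      by (rule prod_mono) (use small in auto)
    also have "\<dots> = 2 ^ n * (\<Prod>i<n. if i < k then r else 1)" by (simp add: prod.distrib)
    also have "(\<Prod>i<n. if i < k then r else 1) = (\<Prod>i\<in>{..<k}. r)"
      using k by (intro prod.mono_neutral_cong_right) auto
    finally show ?thesis by simp
  qed
  finally show ?thesis by simp
qed

section \<open>Actions by translations, the covering map and the discrete degrees of symmetry\<close>

lemma faithful_actionI:
  assumes G: "group G"
    and closed: "\<And>g x. g \<in> carrier G \<Longrightarrow> x \<in> E \<Longrightarrow> \<psi> g x \<in> E"
    and one: "\<And>x. x \<in> E \<Longrightarrow> \<psi> \<one>\<^bsub>G\<^esub> x = x"
    and mult: "\<And>g h x. g \<in> carrier G \<Longrightarrow> h \<in> carrier G \<Longrightarrow> x \<in> E \<Longrightarrow> \<psi> (g \<otimes>\<^bsub>G\<^esub> h) x = \<psi> g (\<psi> h x)"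
    and faithful: "\<And>g h. g \<in> carrier G \<Longrightarrow> h \<in> carrier G \<Longrightarrow> (\<And>x. x \<in> E \<Longrightarrow> \<psi> g x = \<psi> h x) \<Longrightarrow> g = h"
  shows "faithful_action G E (\<lambda>g. restrict (\<psi> g) E)"
proof -
  interpret G: group G by (rule G)
  have bij: "restrict (\<psi> g) E \<in> Bij E" if g: "g \<in> carrier G" for g
  proof -
    have "bij_betw (restrict (\<psi> g) E) E E"
    proof (rule bij_betwI[where g = "\<psi> (inv\<^bsub>G\<^esub> g)"])
      show "restrict (\<psi> g) E \<in> E \<rightarrow> E" using closed[OF g] by simp
      show "\<psi> (inv\<^bsub>G\<^esub> g) \<in> E \<rightarrow> E" using closed[OF G.inv_closed[OF g]] by simp
      fix x assume x: "x \<in> E"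
      have "\<psi> (inv\<^bsub>G\<^esub> g) (\<psi> g x) = \<psi> (inv\<^bsub>G\<^esub> g \<otimes>\<^bsub>G\<^esub> g) x"
        by (rule mult[OF G.inv_closed[OF g] g x, symmetric])
      then show "\<psi> (inv\<^bsub>G\<^esub> g) (restrict (\<psi> g) E x) = x" using one[OF x] g x by simp
      have "\<psi> g (\<psi> (inv\<^bsub>G\<^esub> g) x) = \<psi> (g \<otimes>\<^bsub>G\<^esub> inv\<^bsub>G\<^esub> g) x"
        by (rule mult[OF g G.inv_closed[OF g] x, symmetric])
      then show "restrict (\<psi> g) E (\<psi> (inv\<^bsub>G\<^esub> g) x) = x"
        using one[OF x] g closed[OF G.inv_closed[OF g] x] by simp
    qed
    then show ?thesis by (simp add: Bij_def)
  qed
  have "(\<lambda>g. restrict (\<psi> g) E) \<in> hom G (BijGroup E)"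
  proof (rule homI)
    fix g assume "g \<in> carrier G"
    then show "restrict (\<psi> g) E \<in> carrier (BijGroup E)" using bij by (simp add: BijGroup_def)
  next
    fix g h assume gh: "g \<in> carrier G" "h \<in> carrier G"
    have "restrict (\<psi> g) E \<otimes>\<^bsub>BijGroup E\<^esub> restrict (\<psi> h) E = compose E (restrict (\<psi> g) E) (restrict (\<psi> h) E)"
      using bij[OF gh(1)] bij[OF gh(2)] by (simp add: BijGroup_def)
    also have "\<dots> = restrict (\<psi> (g \<otimes>\<^bsub>G\<^esub> h)) E"
      unfolding compose_def by (rule restrict_ext) (use closed[OF gh(2)] mult[OF gh] in simp)
    finally show "restrict (\<psi> (g \<otimes>\<^bsub>G\<^esub> h)) E = restrict (\<psi> g) E \<otimes>\<^bsub>BijGroup E\<^esub> restrict (\<psi> h) E" ..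
  qed
  then have "group_hom G (BijGroup E) (\<lambda>g. restrict (\<psi> g) E)"
    using group_BijGroup by (simp add: group_hom_def group_hom_axioms_def G)
  moreover have "inj_on (\<lambda>g. restrict (\<psi> g) E) (carrier G)"
  proof (rule inj_onI)
    fix g h assume gh: "g \<in> carrier G" "h \<in> carrier G" and eq: "restrict (\<psi> g) E = restrict (\<psi> h) E"
    show "g = h"
    proof (rule faithful[OF gh])
      fix x assume "x \<in> E"
      then show "\<psi> g x = \<psi> h x" using fun_cong[OF eq, of x] by simp
    qed
  qed
  ultimately show ?thesis
    by (simp add: faithful_action_def faithful_action_axioms_def group_action_def)
qed

definition translate :: "nat \<Rightarrow> (nat \<Rightarrow> real) \<Rightarrow> (nat \<Rightarrow> real) \<Rightarrow> nat \<Rightarrow> real" where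
  "translate n v x = (\<lambda>i. if i < n then x i + v i else 0)"

lemma translate_Rn [simp]: "translate n v x \<in> Rn n"
  by (simp add: translate_def Rn_iff)

text \<open>
  Translations by multiples of \<open>1/r\<close> in the first \<open>m\<close> coordinates descend to the quotient if they
  respect its fibres, and act effectively if they can be told apart at a single point \<open>x0\<close>.
\<close>

lemma (in flat_quotient) translations_act_effectively:
  assumes m: "m \<le> n" and r: "r > 0"
    and fib: "\<And>v x y. (\<forall>i\<ge>m. v i = 0) \<Longrightarrow> x \<in> Rn n \<Longrightarrow> y \<in> Rn n \<Longrightarrow> q x = q y \<Longrightarrow> q (translate n v x) = q (translate n v y)"
    and generic: "x0 \<in> Rn n" "\<And>v w. (\<forall>i\<ge>m. v i = 0) \<Longrightarrow> (\<forall>i\<ge>m. w i = 0) \<Longrightarrow>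
        q (translate n v x0) = q (translate n w x0) \<Longrightarrow> \<forall>i<m. v i - w i \<in> \<int>"
  shows "acts_effectively (Z_mod_power r m) Y"
proof -
  let ?G = "Z_mod_power r m"
  define vec where "vec = (\<lambda>(a :: nat \<Rightarrow> int) i. if i < m then of_int (a i) / of_nat r else 0 :: real)"
  have vec0: "\<forall>i\<ge>m. vec a i = 0" for a by (simp add: vec_def)
  define rep where "rep = (\<lambda>y. SOME x. x \<in> Rn n \<and> q x = y)"
  have rep: "rep y \<in> Rn n \<and> q (rep y) = y" if "y \<in> topspace Y" for y
  proof -
    have "\<exists>x. x \<in> Rn n \<and> q x = y" using that unfolding q_onto[symmetric] by blast
    then show ?thesis unfolding rep_def by (rule someI_ex)
  qed
  define \<psi> where "\<psi> = (\<lambda>a y. q (translate n (vec a) (rep y)))"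
  have \<psi>q: "\<psi> a (q x) = q (translate n (vec a) x)" if "x \<in> Rn n" for a x
    unfolding \<psi>_def using rep[OF q_in[OF that]] that by (intro fib vec0) auto
  have ex: "\<exists>x\<in>Rn n. y = q x" if "y \<in> topspace Y" for y using rep[OF that] by metis
  have carr: "a i \<in> {0..<int r}" if "a \<in> carrier ?G" "i < m" for a i
  proof -
    have "a i \<in> carrier (integer_mod_group r)" using that by auto
    then show ?thesis using r by (simp add: carrier_integer_mod_group)
  qed
  have "faithful_action ?G (topspace Y) (\<lambda>a. restrict (\<psi> a) (topspace Y))"
  proof (rule faithful_actionI)
    show "group ?G" by simp
    show "\<psi> a y \<in> topspace Y" for a y unfolding \<psi>_def by (rule q_in) simp
    show "\<psi> \<one>\<^bsub>?G\<^esub> y = y" if y: "y \<in> topspace Y" for y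
    proof -
      obtain x where x: "x \<in> Rn n" "y = q x" using ex[OF y] by blast
      have "translate n (vec \<one>\<^bsub>?G\<^esub>) x = x"
        using x(1) by (auto simp: translate_def vec_def fun_eq_iff Rn_iff)
      then show ?thesis using \<psi>q[OF x(1)] x(2) by simp
    qed
    show "\<psi> (a \<otimes>\<^bsub>?G\<^esub> b) y = \<psi> a (\<psi> b y)" if a: "a \<in> carrier ?G" and b: "b \<in> carrier ?G" and y: "y \<in> topspace Y" for a b y
    proof -
      obtain x where x: "x \<in> Rn n" "y = q x" using ex[OF y] by blast
      have "translate n (vec (a \<otimes>\<^bsub>?G\<^esub> b)) x = int_shift n (\<lambda>i. if i < m then - ((a i + b i) div int r) else 0) (translate n (vec a) (translate n (vec b) x))"
      proof
        fix i
        have "real_of_int ((a i + b i) mod int r) / real r = of_int (a i) / real r + of_int (b i) / real r - of_int ((a i + b i) div int r)"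
        proof -
          have "real_of_int ((a i + b i) mod int r) = of_int (a i + b i) - of_int ((a i + b i) div int r) * real r"
            by (metis minus_div_mult_eq_mod of_int_diff of_int_mult of_int_of_nat_eq)
          then show ?thesis using r by (simp add: diff_divide_distrib add_divide_distrib)
        qed
        then show "translate n (vec (a \<otimes>\<^bsub>?G\<^esub> b)) x i =
          int_shift n (\<lambda>i. if i < m then - ((a i + b i) div int r) else 0) (translate n (vec a) (translate n (vec b) x)) i"
          by (simp add: translate_def int_shift_def vec_def)
      qed
      then show ?thesis using x by (simp add: \<psi>q q_shift)
    qed
    show "a = b" if a: "a \<in> carrier ?G" and b: "b \<in> carrier ?G" and eq: "\<And>y. y \<in> topspace Y \<Longrightarrow> \<psi> a y = \<psi> b y" for a b
    proof -
      have "q (translate n (vec a) x0) = q (translate n (vec b) x0)"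
        using eq[OF q_in[OF generic(1)]] \<psi>q[OF generic(1)] by simp
      then have int: "\<forall>i<m. vec a i - vec b i \<in> \<int>" by (intro generic(2) vec0)
      have ab: "a \<in> {..<m} \<rightarrow>\<^sub>E carrier (integer_mod_group r)" "b \<in> {..<m} \<rightarrow>\<^sub>E carrier (integer_mod_group r)"
        using a b by simp_all
      show ?thesis
      proof (rule PiE_ext[OF ab])
        fix i assume "i \<in> {..<m}"
        then have i: "i < m" by simp
        obtain j where j: "vec a i - vec b i = of_int j" using int i by (auto elim: Ints_cases)
        have c: "0 \<le> a i" "a i < int r" "0 \<le> b i" "b i < int r" using carr[OF a i] carr[OF b i] by auto
        have "real_of_int (a i - b i) = of_int (j * int r)" using j i r by (simp add: vec_def field_simps)
        then have "a i - b i = j * int r" by (simp only: of_int_eq_iff)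
        moreover have "\<bar>a i - b i\<bar> < int r" using c by linarith
        ultimately have "\<bar>j\<bar> * int r < 1 * int r" by (simp add: abs_mult)
        then have "\<bar>j\<bar> < 1" using r by (subst (asm) mult_less_cancel_right_pos) auto
        then show "a i = b i" using \<open>a i - b i = j * int r\<close> by simp
      qed
    qed
  qed
  moreover have "continuous_map Y Y (restrict (\<psi> a) (topspace Y))" for a
  proof -
    have qm: "quotient_map (Euclidean_space n) Y q"
      by (rule continuous_open_imp_quotient_map[OF q_cont q_open q_onto])
    have "continuous_map (Euclidean_space n) (Euclidean_space n) (\<lambda>x i. if i < n then x i + vec a i else 0)"
      unfolding continuous_map_componentwise_Euclidean_space
    proof (intro allI impI continuous_intros)
      fix i show "continuous_map (Euclidean_space n) euclideanreal (\<lambda>x. x i)"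
        unfolding Euclidean_space_def
        by (intro continuous_map_from_subtopology continuous_map_product_projection) auto
    qed auto
    then have "continuous_map (Euclidean_space n) Y (q \<circ> translate n (vec a))"
      by (intro continuous_map_compose[OF _ q_cont]) (simp add: translate_def[abs_def])
    then have "continuous_map (Euclidean_space n) Y (\<psi> a \<circ> q)"
      by (rule continuous_map_eq) (simp add: \<psi>q)
    then have "continuous_map Y Y (\<psi> a)" by (rule continuous_compose_quotient_map[OF qm])
    then show ?thesis by (rule continuous_map_eq) simp
  qed
  ultimately show ?thesis unfolding acts_effectively_def by blast
qed

lemma torus_acts_effectively:
  assumes "r > 0" shows "acts_effectively (Z_mod_power r n) (torus n)"
proof -
  interpret flat_quotient n "torus n" "torus_proj n" "range (int_shift n)" by (rule flat_quotient_torus)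
  show ?thesis
  proof (rule translations_act_effectively[OF order_refl assms])
    show "(\<lambda>i. 0) \<in> Rn n" by (rule zero_Rn)
    show "torus_proj n (translate n v x) = torus_proj n (translate n v y)" if "torus_proj n x = torus_proj n y" for v x y
      using that unfolding torus_proj_eq_iff by (simp add: translate_def)
    show "\<forall>i<n. v i - w i \<in> \<int>" if "torus_proj n (translate n v (\<lambda>i. 0)) = torus_proj n (translate n w (\<lambda>i. 0))" for v w
      using that unfolding torus_proj_eq_iff by (simp add: translate_def)
  qed
qed

text \<open>
  The last coordinate of the test point is 1/4: as it is not a multiple of 1/2, no glide
  reflection can match two translates of this point.
\<close>

lemma klein_acts_effectively:
  assumes k: "1 \<le> k" "k < n" and r: "r > 0"
  shows "acts_effectively (Z_mod_power r k) (orbit_space (torus n) (sigma_inv n k))"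
proof -
  interpret flat_quotient n "orbit_space (torus n) (sigma_inv n k)" "klein_proj n k" "sigma_group n k"
    by (rule flat_quotient_klein) (use k in auto)
  define x0 :: "nat \<Rightarrow> real" where "x0 = (\<lambda>i. if i = n - 1 then 1/4 else 0)"
  have x0: "x0 \<in> Rn n" using k by (auto simp: x0_def Rn_iff)
  have n1: "n - 1 < n" "\<not> n - 1 < k" using k by auto
  show ?thesis
  proof (rule translations_act_effectively[OF _ r _ x0])
    show "k \<le> n" using k by simp
  next
    fix v :: "nat \<Rightarrow> real" and x y assume v: "\<forall>i\<ge>k. v i = 0" and xy: "x \<in> Rn n" "y \<in> Rn n" "klein_proj n k x = klein_proj n k y"
    have ts: "translate n v (int_shift n z x) = int_shift n z (translate n v x)" for z x
      by (auto simp: translate_def int_shift_def fun_eq_iff)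
    have tg: "translate n v (sigma_lift n k x) = sigma_lift n k (translate n v x)" for x
      using v by (auto simp: translate_def sigma_lift_def fun_eq_iff)
    from xy obtain \<gamma> where \<gamma>: "\<gamma> \<in> sigma_group n k" "y = \<gamma> x" using klein_proj_eq_iff by blast
    have "translate n v y = \<gamma> (translate n v x)"
      using \<gamma>(1) unfolding \<gamma>(2) by (cases rule: sigma_group_cases) (simp_all add: ts tg)
    then show "klein_proj n k (translate n v x) = klein_proj n k (translate n v y)"
      using klein_proj_eq_iff[OF translate_Rn translate_Rn] \<gamma>(1) by blast
  next
    fix v w :: "nat \<Rightarrow> real" assume v: "\<forall>i\<ge>k. v i = 0" and w: "\<forall>i\<ge>k. w i = 0"
      and eq: "klein_proj n k (translate n v x0) = klein_proj n k (translate n w x0)"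
    then obtain \<gamma> where \<gamma>: "\<gamma> \<in> sigma_group n k" "translate n w x0 = \<gamma> (translate n v x0)"
      using klein_proj_eq_iff[OF translate_Rn translate_Rn] by blast
    from \<gamma>(1) show "\<forall>i<k. v i - w i \<in> \<int>"
    proof (cases rule: sigma_group_cases)
      case (shift z)
      show ?thesis
      proof (intro allI impI)
        fix i assume i: "i < k"
        have "w i = v i + of_int (z i)"
          using fun_cong[OF \<gamma>(2), of i] i k by (simp add: shift translate_def int_shift_def)
        then have "v i - w i = of_int (- z i)" by simp
        then show "v i - w i \<in> \<int>" by (metis Ints_of_int)
      qed
    next
      case (glide z)
      have "1/4 = - (1/4) + real_of_int (z (n - 1))"
        using fun_cong[OF \<gamma>(2), of "n - 1"] n1 v w by (simp add: glide translate_def int_shift_def sigma_lift_def x0_def)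
      then have "real_of_int (2 * z (n - 1)) = of_int 1" by simp
      then have "2 * z (n - 1) = 1" by (simp only: of_int_eq_iff)
      then show ?thesis by presburger
    qed
  qed
qed

lemma comm_group_Z_mod_power: "comm_group (Z_mod_power r m)"
proof (rule group.group_comm_groupI)
  show "group (Z_mod_power r m)" by simp
  fix x y
  show "x \<otimes>\<^bsub>Z_mod_power r m\<^esub> y = y \<otimes>\<^bsub>Z_mod_power r m\<^esub> x" by (simp add: add.commute)
qed

lemma pow_Z_mod_power:
  assumes "x \<in> carrier (Z_mod_power r m)"
  shows "x [^]\<^bsub>Z_mod_power r m\<^esub> (j::nat) = (\<lambda>i\<in>{..<m}. (int j * x i) mod int r)"
proof (induction j)
  case 0
  show ?case by (auto simp: restrict_def)
next
  case (Suc j)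
  then show ?case by (auto simp: restrict_def fun_eq_iff mod_simps algebra_simps)
qed

lemma card_Z_mod_power: "r > 0 \<Longrightarrow> card (carrier (Z_mod_power r m)) = r ^ m"
  by (simp add: card_PiE carrier_integer_mod_group)

lemma (in flat_quotient) flat_action_Z_mod_power:
  assumes "n \<ge> 2" "r > 0" "acts_effectively (Z_mod_power r m) Y"
  shows "\<exists>\<phi>. flat_action n Y q \<Gamma> (Z_mod_power r m) \<phi> r"
proof -
  let ?G = "Z_mod_power r m"
  obtain \<phi> where \<phi>: "faithful_action ?G (topspace Y) \<phi>" "\<forall>g\<in>carrier ?G. continuous_map Y Y (\<phi> g)"
    using assms(3) unfolding acts_effectively_def by blast
  have "flat_action_axioms n Y ?G \<phi> r"
  proof (rule flat_action_axioms.intro)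
    show "2 \<le> n" by (rule assms(1))
    show "comm_group ?G" by (rule comm_group_Z_mod_power)
    show "0 < r" by (rule assms(2))
    show "faithful_action ?G (topspace Y) \<phi>" by (rule \<phi>(1))
    show "finite (carrier ?G)" using assms(2) by (simp add: carrier_integer_mod_group finite_PiE)
    show "g [^]\<^bsub>?G\<^esub> r = \<one>\<^bsub>?G\<^esub>" if "g \<in> carrier ?G" for g
      using pow_Z_mod_power[OF that, of r] by (simp add: restrict_def)
    show "continuous_map Y Y (\<phi> g)" if "g \<in> carrier ?G" for g using \<phi>(2) that by blast
  qed
  then show ?thesis using flat_quotient_axioms by (auto simp: flat_action_def)
qed

text \<open>
  Otherwise \<open>r i\<close> would be at most \<open>C\<close> for every \<open>i\<close> with \<open>r i > 0\<close>.
\<close>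

lemma power_growth_bound:
  fixes r :: "nat \<Rightarrow> nat"
  assumes "filterlim r at_top sequentially" "\<And>i. r i > 0 \<Longrightarrow> r i ^ m \<le> C * r i ^ (k::nat)"
  shows "m \<le> k"
proof (rule ccontr)
  assume "\<not> m \<le> k"
  then have km: "Suc k \<le> m" by simp
  have "eventually (\<lambda>i. C + 1 \<le> r i) sequentially"
    using assms(1) unfolding filterlim_at_top by blast
  then obtain i where i: "C + 1 \<le> r i" by (auto dest: eventually_happens)
  then have r: "r i > 0" by simp
  have "r i ^ Suc k \<le> r i ^ m" using km r by (intro power_increasing) auto
  also have "\<dots> \<le> C * r i ^ k" by (rule assms(2)[OF r])
  also have "\<dots> < r i * r i ^ k" using i r by simp
  finally show False by simp
qed

lemma disc_sym_eqI:
  assumes up: "\<And>m. m \<in> mu X \<Longrightarrow> m \<le> k" and low: "\<And>r. r > 0 \<Longrightarrow> acts_effectively (Z_mod_power r k) X"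
  shows "disc_sym X = k"
proof -
  have "filterlim Suc at_top sequentially" by (rule filterlim_Suc)
  then have "k \<in> mu X" unfolding mu_def using low by blast
  moreover have "finite (mu X)" using up by (intro finite_subset[of "mu X" "{..k}"]) auto
  ultimately show ?thesis
    unfolding disc_sym_def using up by (intro Max_eqI) auto
qed

lemma disc_sym_torus:
  assumes "n \<ge> 2" shows "disc_sym (torus n) = n"
proof (rule disc_sym_eqI)
  interpret flat_quotient n "torus n" "torus_proj n" "range (int_shift n)" by (rule flat_quotient_torus)
  fix m assume "m \<in> mu (torus n)"
  then obtain r where r: "filterlim r at_top sequentially" "\<And>i. acts_effectively (Z_mod_power (r i) m) (torus n)"
    unfolding mu_def by blast
  show "m \<le> n"
  proof (rule power_growth_bound[OF r(1)])
    fix i assume pos: "r i > 0"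
    obtain \<phi> where "flat_action n (torus n) (torus_proj n) (range (int_shift n)) (Z_mod_power (r i) m) \<phi> (r i)"
      using flat_action_Z_mod_power[OF assms pos r(2)] by blast
    from card_torus_action[OF this] show "r i ^ m \<le> 9 ^ (n * n) * r i ^ n"
      unfolding card_Z_mod_power[OF pos] .
  qed
qed (rule torus_acts_effectively)

lemma disc_sym_klein:
  assumes k: "1 \<le> k" "k < n" shows "disc_sym (orbit_space (torus n) (sigma_inv n k)) = k"
proof (rule disc_sym_eqI)
  let ?X = "orbit_space (torus n) (sigma_inv n k)"
  interpret flat_quotient n ?X "klein_proj n k" "sigma_group n k"
    by (rule flat_quotient_klein) (use k in auto)
  have n2: "n \<ge> 2" using k by simp
  fix m assume "m \<in> mu ?X"
  then obtain r where r: "filterlim r at_top sequentially" "\<And>i. acts_effectively (Z_mod_power (r i) m) ?X"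
    unfolding mu_def by blast
  show "m \<le> k"
  proof (rule power_growth_bound[OF r(1)])
    fix i assume pos: "r i > 0"
    obtain \<phi> where "flat_action n ?X (klein_proj n k) (sigma_group n k) (Z_mod_power (r i) m) \<phi> (r i)"
      using flat_action_Z_mod_power[OF n2 pos r(2)] by blast
    from card_klein_action[OF k this] show "r i ^ m \<le> (9 ^ (n * n) * 2 ^ n) * r i ^ k"
      unfolding card_Z_mod_power[OF pos] by (simp only: mult.assoc)
  qed
qed (rule klein_acts_effectively[OF k])

text \<open>
  The image of \<open>V\<close> is evenly covered by \<open>V\<close> and \<open>s ` V\<close>.
\<close>

lemma covering_map_orbit_proj:
  assumes cont: "continuous_map X X s" and inv: "\<And>x. x \<in> topspace X \<Longrightarrow> s (s x) = x"
    and free: "\<And>x. x \<in> topspace X \<Longrightarrow> \<exists>V. openin X V \<and> x \<in> V \<and> disjnt V (s ` V)"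
  shows "covering_map X (orbit_space X s) (orbit_proj s)"
  unfolding covering_map_def
proof (intro conjI ballI)
  let ?Y = "orbit_space X s" and ?p = "orbit_proj s"
  have qm: "quotient_map X ?Y ?p" unfolding orbit_space_def by (rule quotient_map_quotient_topology)
  show c: "continuous_map X ?Y ?p" by (rule quotient_imp_continuous_map[OF qm])
  show onto: "?p ` topspace X = topspace ?Y" by (simp add: orbit_space_def)
  have op: "open_map X ?Y ?p" by (rule open_map_orbit_proj[OF cont inv])
  have sX: "s x \<in> topspace X" if "x \<in> topspace X" for x using cont that by (auto simp: continuous_map_def)
  fix y assume "y \<in> topspace ?Y"
  then obtain x where x: "x \<in> topspace X" "y = ?p x" unfolding onto[symmetric] by blast
  obtain V where V: "openin X V" "x \<in> V" "disjnt V (s ` V)" using free[OF x(1)] by blast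
  have VX: "V \<subseteq> topspace X" by (rule openin_subset[OF V(1)])
  have sV: "s ` V = {u \<in> topspace X. s u \<in> V}"
  proof (intro equalityI subsetI)
    fix u assume "u \<in> {u \<in> topspace X. s u \<in> V}"
    then have "u = s (s u)" "s u \<in> V" using inv by auto
    then show "u \<in> s ` V" by blast
  qed (use VX sX inv in auto)
  have sVo: "openin X (s ` V)" unfolding sV by (rule openin_continuous_map_preimage[OF cont V(1)])
  let ?T = "?p ` V"
  have pre: "{u \<in> topspace X. ?p u \<in> ?T} = V \<union> s ` V"
  proof (intro equalityI subsetI)
    fix u assume "u \<in> {u \<in> topspace X. ?p u \<in> ?T}"
    then obtain v where v: "u \<in> topspace X" "v \<in> V" "?p v = ?p u" by auto
    then have "u = v \<or> u = s v" using orbit_proj_eq_iff[of s v u] inv VX by blast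
    then show "u \<in> V \<union> s ` V" using v(2) by blast
  next
    fix u assume "u \<in> V \<union> s ` V"
    then consider "u \<in> V" | v where "v \<in> V" "u = s v" by blast
    then show "u \<in> {u \<in> topspace X. ?p u \<in> ?T}"
    proof cases
      case 1
      then show ?thesis using VX by blast
    next
      case 2
      have "?p u = ?p v" unfolding orbit_proj_def 2(2) using inv 2(1) VX by auto
      then show ?thesis using 2 VX sX by auto
    qed
  qed
  have pT: "?p ` (s ` V) = ?T"
  proof -
    have "?p (s v) = ?p v" if "v \<in> V" for v unfolding orbit_proj_def using inv that VX by auto
    then show ?thesis unfolding image_image by (intro image_cong) auto
  qed
  have homeo: "homeomorphic_map (subtopology X U) (subtopology ?Y ?T) ?p"
    if U: "openin X U" "?p ` U = ?T" "disjnt U (s ` U)" for U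
  proof (rule bijective_open_imp_homeomorphic_map)
    have UX: "U \<subseteq> topspace X" by (rule openin_subset[OF U(1)])
    show "continuous_map (subtopology X U) (subtopology ?Y ?T) ?p"
      unfolding continuous_map_in_subtopology
      using continuous_map_from_subtopology[OF c] U(2) UX by auto
    show "open_map (subtopology X U) (subtopology ?Y ?T) ?p"
      by (rule open_map_into_subtopology[OF open_map_from_subtopology[OF op U(1)]]) (use U(2) in auto)
    have "?T \<subseteq> topspace ?Y" unfolding onto[symmetric] using VX by blast
    then show "?p ` topspace (subtopology X U) = topspace (subtopology ?Y ?T)"
      using U(2) UX by (simp add: Int_absorb1)
    show "inj_on ?p (topspace (subtopology X U))"
    proof (rule inj_onI)
      fix u v assume "u \<in> topspace (subtopology X U)" "v \<in> topspace (subtopology X U)" and eq: "?p u = ?p v"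
      then have uv: "u \<in> U" "v \<in> U" by auto
      then have "v = u \<or> v = s u" using orbit_proj_eq_iff[of s u v] inv UX eq by blast
      moreover have "v \<noteq> s u" using U(3) uv unfolding disjnt_iff by blast
      ultimately show "u = v" by blast
    qed
  qed
  have ssV: "s ` (s ` V) = V"
  proof -
    have "s (s v) = v" if "v \<in> V" for v using inv that VX by blast
    then show ?thesis unfolding image_image by simp
  qed
  show "\<exists>T. y \<in> T \<and> openin ?Y T \<and> (\<exists>\<V>. \<Union>\<V> = {x \<in> topspace X. ?p x \<in> T} \<and> (\<forall>U\<in>\<V>. openin X U) \<and>
      pairwise disjnt \<V> \<and> (\<forall>U\<in>\<V>. homeomorphic_map (subtopology X U) (subtopology ?Y T) ?p))"
  proof (rule exI[of _ ?T], intro conjI exI[of _ "{V, s ` V}"])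
    show "y \<in> ?T" using x V(2) by blast
    show "openin ?Y ?T" using op V(1) unfolding open_map_def by blast
    show "\<Union> {V, s ` V} = {u \<in> topspace X. ?p u \<in> ?T}" unfolding pre by blast
    show "\<forall>U\<in>{V, s ` V}. openin X U" using V(1) sVo by blast
    show "pairwise disjnt {V, s ` V}" using V(3) by (auto simp: pairwise_insert disjnt_sym)
    have "disjnt (s ` V) (s ` (s ` V))" unfolding ssV by (rule disjnt_sym[OF V(3)])
    then show "\<forall>U\<in>{V, s ` V}. homeomorphic_map (subtopology X U) (subtopology ?Y ?T) ?p"
      using homeo[OF V(1) refl V(3)] homeo[OF sVo pT] by blast
  qed
qed

text \<open>
  Cubes of radius 1/8 are disjoint from their images, since the involution moves the first
  coordinate by 1/2.
\<close>

lemma covering_map_torus_orbit_space: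
  assumes k: "1 \<le> k" "k \<le> n"
  shows "covering_map (torus n) (orbit_space (torus n) (sigma_inv n k)) (orbit_proj (sigma_inv n k))"
proof (rule covering_map_orbit_proj[OF continuous_map_sigma_inv sigma_inv_involution])
  fix u assume "u \<in> topspace (torus n)"
  then obtain x where x: "x \<in> Rn n" "u = torus_proj n x" unfolding torus_proj_onto[symmetric] by blast
  let ?C = "open_cube n x (1/8)"
  have "openin (top_of_set (Rn n)) ?C"
    unfolding open_cube_eq by (rule openin_open_Int[OF open_cube_ambient])
  then have "openin (Euclidean_space n) ?C" by (simp only: Euclidean_space_eq_top_of_set[symmetric])
  then have "openin (torus n) (torus_proj n ` ?C)" using open_map_torus_proj unfolding open_map_def by blast
  moreover have "u \<in> torus_proj n ` ?C" unfolding x(2) using x(1) by (intro imageI) (simp add: open_cube_def)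
  moreover have "disjnt (torus_proj n ` ?C) (sigma_inv n k ` (torus_proj n ` ?C))"
    unfolding disjnt_iff
  proof (intro allI notI)
    fix t assume "t \<in> torus_proj n ` ?C \<and> t \<in> sigma_inv n k ` torus_proj n ` ?C"
    then obtain a b where ab: "a \<in> ?C" "b \<in> ?C" "torus_proj n a = torus_proj n (sigma_lift n k b)"
      unfolding sigma_torus_proj[symmetric] by auto
    have n0: "0 < n" "0 < k" using k by auto
    then have "a 0 - (b 0 + 1/2) \<in> \<int>" using ab(3) unfolding torus_proj_eq_iff by (auto simp: sigma_lift_def)
    then obtain z where z: "a 0 - (b 0 + 1/2) = of_int z" by (elim Ints_cases)
    have "\<bar>a 0 - x 0\<bar> < 1/8" "\<bar>b 0 - x 0\<bar> < 1/8" using ab n0 by (auto simp: open_cube_def)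
    then have "\<bar>1/2 + of_int z :: real\<bar> < 1/2" using z by linarith
    then show False using abs_half_plus_int[of z] by linarith
  qed
  ultimately show "\<exists>V. openin (torus n) V \<and> u \<in> V \<and> disjnt V (sigma_inv n k ` V)" by blast
qed

theorem theorem1p13:
  fixes k n :: nat
  assumes "1 \<le> k" and "k \<le> n - 1"
  shows "covering_map (torus n) (orbit_space (torus n) (sigma_inv n k)) (orbit_proj (sigma_inv n k)) \<and>
         disc_sym (torus n) = n \<and>
         disc_sym (orbit_space (torus n) (sigma_inv n k)) = k"
proof (intro conjI)
  have k: "k < n" "k \<le> n" "n \<ge> 2" using assms by auto
  show "covering_map (torus n) (orbit_space (torus n) (sigma_inv n k)) (orbit_proj (sigma_inv n k))"
    by (rule covering_map_torus_orbit_space[OF assms(1) k(2)])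
  show "disc_sym (torus n) = n" by (rule disc_sym_torus[OF k(3)])
  show "disc_sym (orbit_space (torus n) (sigma_inv n k)) = k" by (rule disc_sym_klein[OF assms(1) k(1)])
qed

end
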